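(* Every divisor on an axially symmetric domain $\Omega\subset\mathbb H$ is principal: if a divisor is represented by an axially symmetric open covering $\{U_l\}$ of $\Omega$ and semiregular functions $f_l\in\mathcal{SMR}(U_l)$, $f_l\not\equiv0$, with $f_k^{-*}*f_l\in\mathcal{SR}^*(U_k\cap U_l)$ for all $k,l$, then there exists a semiregular function $f\in\mathcal{SMR}(\Omega)$ such that $f_l^{-*}*f\in\mathcal{SR}^*(V_l)$ for all $l$, for a suitable axially symmetric open covering $\{V_l\}$ of $\Omega$ refining $\{U_l\}$ (with $V_l\subset U_l$).
   Context: $\mathbb S=\{I\in\mathbb H:I^2=-1\}$. Axially symmetric set: $x+Iy\in E\Rightarrow x+Jy\in E$ for all $J\in\mathbb S$; axially symmetric domain: connected axially symmetric open set. $\mathcal{SR}(U)$: slice-regular functions $f(x+Jy)=F_1(x+iy)+JF_2(x+iy)$ with $F_1+\mathbf iF_2$ holomorphic into $\mathbb H\otimes\mathbb C$, $F_1(\bar z)=F_1(z)$, $F_2(\bar z)=-F_2(z)$; $*$ is the product induced by stem functions; $f^{-*}$ the $*$-inverse. $\mathcal{SR}^*(U)$: slice-regular functions without zeros on $U$. A function $f$ is semiregular on $U$ ($f\in\mathcal{SMR}(U)$) if it is slice-regular on an axially symmetric open $U'\subset U$ such that every point of $U\setminus U'$ is a pole or removable singularity of $f$ (poles in the sense of the quaternionic Laurent/spherical expansions; they form a discrete set of points and spheres); nonzero semiregular functions are $*$-invertible in $\mathcal{SMR}$. Two germs $f,g$ of semiregular functions are equivalent if $f=g*h$ with $h$ a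 germ in $\mathcal{SR}^*$; a divisor on $\Omega$ is a global section of the sheaf $(\mathcal{SMR}\setminus\{0\})/\sim$ (on axially symmetric open sets), represented as in the claim. *)

theory Defs
  imports "HOL-Complex_Analysis.Complex_Analysis"
begin

text \<open>A quaternion a + b i + c j + d k is the tuple (a,b,c,d). Addition, scalar
multiplication, norm (Euclidean) and topology are those of the product type.\<close>

type_synonym quat = "real \<times> real \<times> real \<times> real"

definition qreal :: "real \<Rightarrow> quat" where
  "qreal r = (r, 0, 0, 0)"

definition qi :: quat where
  "qi = (0, 1, 0, 0)"

fun qmul :: "quat \<Rightarrow> quat \<Rightarrow> quat" where
  "qmul (a1, b1, c1, d1) (a2, b2, c2, d2) =
     (a1*a2 - b1*b2 - c1*c2 - d1*d2,
      a1*b2 + b1*a2 + c1*d2 - d1*c2,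
      a1*c2 - b1*d2 + c1*a2 + d1*b2,
      a1*d2 + b1*c2 - c1*b2 + d1*a2)"

fun qconj :: "quat \<Rightarrow> quat" where
  "qconj (a, b, c, d) = (a, -b, -c, -d)"

definition qinv :: "quat \<Rightarrow> quat" where
  "qinv q = inverse ((norm q)^2) *\<^sub>R qconj q"

definition qpow :: "quat \<Rightarrow> nat \<Rightarrow> quat" where
  "qpow q n = (qmul q ^^ n) (qreal 1)"

definition qcomp :: "nat \<Rightarrow> quat \<Rightarrow> real" where
  "qcomp k q = (if k = 0 then fst q else if k = 1 then fst (snd q)
                else if k = 2 then fst (snd (snd q)) else snd (snd (snd q)))"

definition imag_units :: "quat set" where
  "imag_units = {I. qmul I I = qreal (-1)}"

definition qslice :: "real \<Rightarrow> quat \<Rightarrow> real \<Rightarrow> quat" where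
  "qslice x J y = qreal x + y *\<^sub>R J"

definition axsym :: "quat set \<Rightarrow> bool" where
  "axsym E \<longleftrightarrow> (\<forall>x y I J. I \<in> imag_units \<longrightarrow> J \<in> imag_units \<longrightarrow>
                   qslice x I y \<in> E \<longrightarrow> qslice x J y \<in> E)"

definition qsphere :: "quat \<Rightarrow> quat set" where
  "qsphere p = {qslice (fst p) J (norm (snd p)) | J. J \<in> imag_units}"

text \<open>Domain of the stem functions: D = {x + iy : x + i_H y \<in> U} (conjugation-symmetric
if U is axially symmetric).\<close>
definition slice_dom :: "quat set \<Rightarrow> complex set" where
  "slice_dom U = {z. qslice (Re z) qi (Im z) \<in> U}"

text \<open>A stem function F = F1 + i F2 with values in H \<otimes> C = C^4 is holomorphic iff its
four complex components are holomorphic.\<close>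
definition stem_holo :: "complex set \<Rightarrow> (complex \<Rightarrow> quat) \<Rightarrow> (complex \<Rightarrow> quat) \<Rightarrow> bool" where
  "stem_holo D F1 F2 \<longleftrightarrow>
     (\<forall>k<4. (\<lambda>z. Complex (qcomp k (F1 z)) (qcomp k (F2 z))) holomorphic_on D)"

definition slice_regular :: "quat set \<Rightarrow> (quat \<Rightarrow> quat) \<Rightarrow> bool" where
  "slice_regular U f \<longleftrightarrow> open U \<and> axsym U \<and>
     (\<exists>F1 F2. (\<forall>z\<in>slice_dom U. F1 (cnj z) = F1 z \<and> F2 (cnj z) = - F2 z) \<and>
        stem_holo (slice_dom U) F1 F2 \<and>
        (\<forall>x y J. J \<in> imag_units \<longrightarrow> qslice x J y \<in> U \<longrightarrow>
            f (qslice x J y) = F1 (Complex x y) + qmul J (F2 (Complex x y))))"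

text \<open>Stem function recovered from the values of f on the slice C_i (representation formula).\<close>
definition stem1 :: "(quat \<Rightarrow> quat) \<Rightarrow> complex \<Rightarrow> quat" where
  "stem1 f z = (1/2) *\<^sub>R (f (qslice (Re z) qi (Im z)) + f (qslice (Re z) qi (- Im z)))"

definition stem2 :: "(quat \<Rightarrow> quat) \<Rightarrow> complex \<Rightarrow> quat" where
  "stem2 f z = - qmul qi ((1/2) *\<^sub>R (f (qslice (Re z) qi (Im z)) - f (qslice (Re z) qi (- Im z))))"

text \<open>Writing q = x + J y with y = |Im q| \<ge> 0, J \<in> S.\<close>
definition qunit_of :: "quat \<Rightarrow> quat" where
  "qunit_of q = (if snd q = 0 then qi else (0, (1 / norm (snd q)) *\<^sub>R snd q))"

definition qcpx :: "quat \<Rightarrow> complex" where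
  "qcpx q = Complex (fst q) (norm (snd q))"

definition slice_of :: "(complex \<Rightarrow> quat) \<Rightarrow> (complex \<Rightarrow> quat) \<Rightarrow> quat \<Rightarrow> quat" where
  "slice_of F1 F2 q = F1 (qcpx q) + qmul (qunit_of q) (F2 (qcpx q))"

text \<open>*-product: induced by the product of stem functions in H \<otimes> C.\<close>
definition sprod :: "(quat \<Rightarrow> quat) \<Rightarrow> (quat \<Rightarrow> quat) \<Rightarrow> quat \<Rightarrow> quat" where
  "sprod f g = slice_of
     (\<lambda>z. qmul (stem1 f z) (stem1 g z) - qmul (stem2 f z) (stem2 g z))
     (\<lambda>z. qmul (stem1 f z) (stem2 g z) + qmul (stem2 f z) (stem1 g z))"

definition sconj :: "(quat \<Rightarrow> quat) \<Rightarrow> quat \<Rightarrow> quat" where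
  "sconj f = slice_of (\<lambda>z. qconj (stem1 f z)) (\<lambda>z. qconj (stem2 f z))"

definition ssym :: "(quat \<Rightarrow> quat) \<Rightarrow> quat \<Rightarrow> quat" where
  "ssym f = sprod (sconj f) f"

text \<open>*-inverse f^{-*}(q) = f^s(q)^{-1} f^c(q) (meaningful where f^s(q) \<noteq> 0).\<close>
definition sinv :: "(quat \<Rightarrow> quat) \<Rightarrow> quat \<Rightarrow> quat" where
  "sinv f q = qmul (qinv (ssym f q)) (sconj f q)"

text \<open>Characteristic polynomial of the sphere S_p: Delta_p(q) = q^2 - 2 Re(p) q + |p|^2.\<close>
definition Delta :: "quat \<Rightarrow> quat \<Rightarrow> quat" where
  "Delta p q = qmul q q - (2 * fst p) *\<^sub>R q + qreal ((norm p)^2)"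

text \<open>f is semiregular on U: slice-regular on an axially symmetric open U' \<subseteq> U such that
every point p of U - U' is a pole or removable singularity, i.e. f is regular on a punctured
symmetric neighbourhood of S_p and Delta_p^m f extends slice-regularly across S_p for some m.\<close>
definition semiregular :: "quat set \<Rightarrow> (quat \<Rightarrow> quat) \<Rightarrow> bool" where
  "semiregular U f \<longleftrightarrow> open U \<and> axsym U \<and>
     (\<exists>U'. U' \<subseteq> U \<and> slice_regular U' f \<and>
        (\<forall>p\<in>U - U'. \<exists>W m g. p \<in> W \<and> W \<subseteq> U \<and> W - qsphere p \<subseteq> U' \<and>
            slice_regular W g \<and>
            (\<forall>q\<in>W - qsphere p. g q = qmul (qpow (Delta p q) m) (f q))))"

text \<open>Equality of semiregular functions on W: agreement on a dense open subset of W.\<close>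
definition smr_agree :: "quat set \<Rightarrow> (quat \<Rightarrow> quat) \<Rightarrow> (quat \<Rightarrow> quat) \<Rightarrow> bool" where
  "smr_agree W f g \<longleftrightarrow>
     (\<exists>W'. open W' \<and> W' \<subseteq> W \<and> W \<subseteq> closure W' \<and> (\<forall>q\<in>W'. f q = g q))"

definition smr_zero :: "quat set \<Rightarrow> (quat \<Rightarrow> quat) \<Rightarrow> bool" where
  "smr_zero W f \<longleftrightarrow> smr_agree W f (\<lambda>_. 0)"

definition SR_star :: "quat set \<Rightarrow> (quat \<Rightarrow> quat) \<Rightarrow> bool" where
  "SR_star W g \<longleftrightarrow> (\<exists>h. slice_regular W h \<and> (\<forall>q\<in>W. h q \<noteq> 0) \<and> smr_agree W h g)"

end

theory Submission
  imports Defs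
begin

text \<open>
  Passing to stem functions turns the divisor into a family of meromorphic functions with values in
  the biquaternions \<open>H \<otimes> \<complex>\<close>, symmetric under conjugation on a symmetric planar open set and given near each
  point up to right multiplication by invertible holomorphic germs; only a discrete set of points
  carries a nontrivial germ. As in the Weierstrass theorem, the solution is a convergent product of
  global factors, each close to 1 on a member of an exhaustion and repairing finitely many new points.

  A factor repairing the point \<open>p\<close> is built from Weierstrass factors \<open>W\<close> with a simple zero at \<open>p\<close>: if the
  norm of the germ \<open>G\<close> vanishes at \<open>p\<close>, some idempotent \<open>e = (1 - \<i>J)/2\<close> kills \<open>G p\<close>, and dividing \<open>G\<close>
  from the left by \<open>W e + W\<^sup>* (1 - e)\<close>, where \<open>W\<^sup>* z = cnj (W (cnj z))\<close>, lowers the vanishing order of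
  the norm. Poles are first cleared by powers of the central factor \<open>W W\<^sup>*\<close>.
\<close>

section \<open>Biquaternions\<close>

text \<open>Biquaternions form the algebra of complex 2 by 2 matrices with \<open>bN\<close> as
  determinant, so a germ can degenerate without vanishing, and its zeros cannot simply be split off
  as scalar factors; hence the idempotents. The dictionary with slice functions: an induced function
  has a zero on the sphere over \<open>z\<close> exactly when \<open>bN\<close> of its stem vanishes
  at \<open>z\<close>, so zero-free slice-regular functions are the invertible holomorphic stems.
  Germs are fixed up to units on the right, so each new factor is multiplied on the right of the
  product \<open>F\<close> reached so far, and the germ it needs at \<open>p\<close> is the inverse
  of \<open>F\<close> times the prescribed one. Conjugation symmetry leaves only the closed upper
  half-plane to be treated, but at a real \<open>p\<close> both \<open>W\<close> and its reflection
  vanish and the norm must lose order two at once; the symmetry of the germ makes this possible.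
  Closeness to 1 comes from Weierstrass factors of high degree: relative to a smaller compact set,
  each new point is near a point of the complement or far out.\<close>

datatype biquat = Biquat (b0: complex) (b1: complex) (b2: complex) (b3: complex)

lemma biquat_eqI:
  assumes "b0 x = b0 y" "b1 x = b1 y" "b2 x = b2 y" "b3 x = b3 y"
  shows "x = y"
  using assms by (simp add: biquat.expand)

lemma biquat_eq_iff: "x = y \<longleftrightarrow> b0 x = b0 y \<and> b1 x = b1 y \<and> b2 x = b2 y \<and> b3 x = b3 y"
  using biquat_eqI by auto

instantiation biquat :: ring_1
begin

definition "0 = Biquat 0 0 0 0"
definition "1 = Biquat 1 0 0 0"
definition "x + y = Biquat (b0 x + b0 y) (b1 x + b1 y) (b2 x + b2 y) (b3 x + b3 y)"
definition "x - y = Biquat (b0 x - b0 y) (b1 x - b1 y) (b2 x - b2 y) (b3 x - b3 y)"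
definition "- x = Biquat (- b0 x) (- b1 x) (- b2 x) (- b3 x)"
definition "x * y = Biquat
  (b0 x * b0 y - b1 x * b1 y - b2 x * b2 y - b3 x * b3 y)
  (b0 x * b1 y + b1 x * b0 y + b2 x * b3 y - b3 x * b2 y)
  (b0 x * b2 y - b1 x * b3 y + b2 x * b0 y + b3 x * b1 y)
  (b0 x * b3 y + b1 x * b2 y - b2 x * b1 y + b3 x * b0 y)"

instance
  by standard
    (simp_all add: biquat_eq_iff zero_biquat_def one_biquat_def plus_biquat_def minus_biquat_def
      uminus_biquat_def times_biquat_def algebra_simps)

end

lemma biquat_sel [simp]:
  "b0 (0::biquat) = 0" "b1 (0::biquat) = 0" "b2 (0::biquat) = 0" "b3 (0::biquat) = 0"
  "b0 (1::biquat) = 1" "b1 (1::biquat) = 0" "b2 (1::biquat) = 0" "b3 (1::biquat) = 0"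
  "b0 (x + y) = b0 x + b0 y" "b1 (x + y) = b1 x + b1 y"
  "b2 (x + y) = b2 x + b2 y" "b3 (x + y) = b3 x + b3 y"
  "b0 (x - y) = b0 x - b0 y" "b1 (x - y) = b1 x - b1 y"
  "b2 (x - y) = b2 x - b2 y" "b3 (x - y) = b3 x - b3 y"
  "b0 (- x) = - b0 x" "b1 (- x) = - b1 x" "b2 (- x) = - b2 x" "b3 (- x) = - b3 x"
  for x y :: biquat
  by (simp_all add: zero_biquat_def one_biquat_def plus_biquat_def minus_biquat_def uminus_biquat_def)

lemma biquat_mult_sel:
  "b0 (x * y) = b0 x * b0 y - b1 x * b1 y - b2 x * b2 y - b3 x * b3 y"
  "b1 (x * y) = b0 x * b1 y + b1 x * b0 y + b2 x * b3 y - b3 x * b2 y"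
  "b2 (x * y) = b0 x * b2 y - b1 x * b3 y + b2 x * b0 y + b3 x * b1 y"
  "b3 (x * y) = b0 x * b3 y + b1 x * b2 y - b2 x * b1 y + b3 x * b0 y"
  by (simp_all add: times_biquat_def)

definition cB :: "complex \<Rightarrow> biquat" where "cB c = Biquat c 0 0 0"

lemma cB_sel [simp]: "b0 (cB c) = c" "b1 (cB c) = 0" "b2 (cB c) = 0" "b3 (cB c) = 0"
  by (simp_all add: cB_def)

lemma cB_0 [simp]: "cB 0 = 0" and cB_1 [simp]: "cB 1 = 1"
  and cB_mult: "cB (c * d) = cB c * cB d"
  and cB_commute: "x * cB c = cB c * x"
  by (simp_all add: biquat_eq_iff biquat_mult_sel)

lemma cB_mult_left_commute: "x * (cB c * y) = cB c * (x * y)"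
  by (metis cB_commute mult.assoc)

lemma cB_mult_sel [simp]:
  "b0 (cB c * x) = c * b0 x" "b1 (cB c * x) = c * b1 x"
  "b2 (cB c * x) = c * b2 x" "b3 (cB c * x) = c * b3 x"
  by (simp_all add: biquat_mult_sel)

definition bconj :: "biquat \<Rightarrow> biquat" where
  "bconj x = Biquat (b0 x) (- b1 x) (- b2 x) (- b3 x)"

definition bcnj :: "biquat \<Rightarrow> biquat" where
  "bcnj x = Biquat (cnj (b0 x)) (cnj (b1 x)) (cnj (b2 x)) (cnj (b3 x))"

definition bN :: "biquat \<Rightarrow> complex" where
  "bN x = (b0 x)\<^sup>2 + (b1 x)\<^sup>2 + (b2 x)\<^sup>2 + (b3 x)\<^sup>2"

text \<open>Where \<open>bN x = 0\<close> the value is 0. This matches \<open>qinv 0 = 0\<close>, so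
  that the formula for \<open>sinv\<close> holds at every point.\<close>

definition binv :: "biquat \<Rightarrow> biquat" where
  "binv x = cB (inverse (bN x)) * bconj x"

lemma bconj_sel [simp]:
  "b0 (bconj x) = b0 x" "b1 (bconj x) = - b1 x" "b2 (bconj x) = - b2 x" "b3 (bconj x) = - b3 x"
  by (simp_all add: bconj_def)

lemma bcnj_sel [simp]:
  "b0 (bcnj x) = cnj (b0 x)" "b1 (bcnj x) = cnj (b1 x)" "b2 (bcnj x) = cnj (b2 x)" "b3 (bcnj x) = cnj (b3 x)"
  by (simp_all add: bcnj_def)

lemma bcnj_simps [simp]:
  "bcnj (x + y) = bcnj x + bcnj y" "bcnj (x - y) = bcnj x - bcnj y" "bcnj (x * y) = bcnj x * bcnj y"
  "bcnj 1 = 1" "bcnj 0 = 0" "bcnj (bcnj x) = x" "bcnj (cB c) = cB (cnj c)"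
  "bcnj (bconj x) = bconj (bcnj x)"
  by (simp_all add: biquat_eq_iff biquat_mult_sel)

lemma bN_bcnj [simp]: "bN (bcnj x) = cnj (bN x)"
  by (simp add: bN_def)

lemma bcnj_binv [simp]: "bcnj (binv x) = binv (bcnj x)"
  by (simp add: binv_def)

lemma bN_mult [simp]: "bN (x * y) = bN x * bN y"
  by (simp add: bN_def biquat_mult_sel power2_eq_square algebra_simps)

lemma bN_1 [simp]: "bN 1 = 1" and bN_0 [simp]: "bN 0 = 0" and bN_cB [simp]: "bN (cB c) = c\<^sup>2"
  and bN_bconj [simp]: "bN (bconj x) = bN x"
  by (simp_all add: bN_def)

lemma mult_bconj: "x * bconj x = cB (bN x)" and bconj_mult_self: "bconj x * x = cB (bN x)"
  by (simp_all add: biquat_eq_iff biquat_mult_sel bN_def algebra_simps power2_eq_square)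

lemma bN_binv [simp]: "bN (binv x) = inverse (bN x)"
  by (cases "bN x = 0") (simp_all add: binv_def power2_eq_square)

lemma binv_left: "bN x \<noteq> 0 \<Longrightarrow> binv x * x = 1"
  by (simp add: binv_def mult.assoc bconj_mult_self flip: cB_mult)

lemma binv_right: "bN x \<noteq> 0 \<Longrightarrow> x * binv x = 1"
  by (simp add: binv_def cB_mult_left_commute mult_bconj flip: cB_mult)

lemma binv_cancel_left: "bN x \<noteq> 0 \<Longrightarrow> binv x * (x * y) = y"
  and binv_cancel_right: "bN x \<noteq> 0 \<Longrightarrow> x * (binv x * y) = y"
  by (simp_all add: binv_left binv_right flip: mult.assoc)

section \<open>A submultiplicative norm on biquaternions\<close>

definition bnorm :: "biquat \<Rightarrow> real" where
  "bnorm x = cmod (b0 x) + cmod (b1 x) + cmod (b2 x) + cmod (b3 x)"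

lemma bnorm_nonneg [simp]: "0 \<le> bnorm x"
  by (simp add: bnorm_def)

lemma bnorm_eq_0 [simp]: "bnorm x = 0 \<longleftrightarrow> x = 0"
proof
  assume "bnorm x = 0"
  then have "cmod (b0 x) + cmod (b1 x) + cmod (b2 x) + cmod (b3 x) = 0"
    by (simp add: bnorm_def)
  then have "cmod (b0 x) = 0 \<and> cmod (b1 x) = 0 \<and> cmod (b2 x) = 0 \<and> cmod (b3 x) = 0"
    using norm_ge_zero[of "b0 x"] norm_ge_zero[of "b1 x"] norm_ge_zero[of "b2 x"] norm_ge_zero[of "b3 x"]
    by linarith
  then show "x = 0" by (simp add: biquat_eq_iff)
qed (simp add: bnorm_def)

lemma bnorm_1 [simp]: "bnorm 1 = 1" and bnorm_cB [simp]: "bnorm (cB c) = cmod c"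
  and bnorm_bcnj [simp]: "bnorm (bcnj x) = bnorm x"
  by (simp_all add: bnorm_def)

lemma bnorm_triangle: "bnorm (x + y) \<le> bnorm x + bnorm y"
  unfolding bnorm_def biquat_sel
  using norm_triangle_ineq[of "b0 x" "b0 y"] norm_triangle_ineq[of "b1 x" "b1 y"]
    norm_triangle_ineq[of "b2 x" "b2 y"] norm_triangle_ineq[of "b3 x" "b3 y"] by linarith

lemma bnorm_mult: "bnorm (x * y) \<le> bnorm x * bnorm y"
proof -
  have tri: "cmod (p + q + r + s) \<le> cmod p + cmod q + cmod r + cmod s" for p q r s
    using norm_triangle_ineq[of "p + q + r" s] norm_triangle_ineq[of "p + q" r] norm_triangle_ineq[of p q]
    by linarith
  show ?thesis
    unfolding bnorm_def biquat_mult_sel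
    using tri[of "b0 x * b0 y" "- (b1 x * b1 y)" "- (b2 x * b2 y)" "- (b3 x * b3 y)"]
      tri[of "b0 x * b1 y" "b1 x * b0 y" "b2 x * b3 y" "- (b3 x * b2 y)"]
      tri[of "b0 x * b2 y" "- (b1 x * b3 y)" "b2 x * b0 y" "b3 x * b1 y"]
      tri[of "b0 x * b3 y" "b1 x * b2 y" "- (b2 x * b1 y)" "b3 x * b0 y"]
    by (simp add: norm_mult algebra_simps)
qed

text \<open>If \<open>bN x = 0\<close>, then \<open>x\<close> kills \<open>bconj x\<close>, so
  multiplication by \<open>x - 1\<close> acts on \<open>bconj x\<close> as minus the identity; a
  factor of norm below 1 can do this only to zero. This keeps limits of factors near 1
  invertible.\<close>

lemma bN_nonzero_near_1:
  assumes "bnorm (x - 1) < 1"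
  shows "bN x \<noteq> 0"
proof
  assume "bN x = 0"
  then have "x * bconj x = 0" by (simp add: mult_bconj)
  then have "bconj x = - ((x - 1) * bconj x)" by (simp add: algebra_simps)
  then have "bnorm (bconj x) \<le> bnorm (x - 1) * bnorm (bconj x)"
    using bnorm_mult[of "x - 1" "bconj x"]
    by (metis add_0 bnorm_def norm_minus_cancel biquat_sel(17-20))
  with assms have "bnorm (bconj x) = 0"
    by (smt (verit) bnorm_nonneg mult_less_cancel_right2)
  then have "x = 0" by (simp add: biquat_eq_iff)
  with assms show False
    by (simp add: bnorm_def)
qed

section \<open>Analytic germs of biquaternionic functions\<close>

definition bana :: "(complex \<Rightarrow> biquat) \<Rightarrow> complex \<Rightarrow> bool" where
  "bana F z \<longleftrightarrow> (\<lambda>w. b0 (F w)) analytic_on {z} \<and> (\<lambda>w. b1 (F w)) analytic_on {z}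
     \<and> (\<lambda>w. b2 (F w)) analytic_on {z} \<and> (\<lambda>w. b3 (F w)) analytic_on {z}"

definition unit_at :: "complex \<Rightarrow> (complex \<Rightarrow> biquat) \<Rightarrow> bool" where
  "unit_at z u \<longleftrightarrow> bana u z \<and> bN (u z) \<noteq> 0"

lemma bana_const [simp]: "bana (\<lambda>_. c) z"
  by (simp add: bana_def)

lemma bana_cB: "f analytic_on {z} \<Longrightarrow> bana (\<lambda>w. cB (f w)) z"
  by (simp add: bana_def)

lemma bana_add: "bana F z \<Longrightarrow> bana G z \<Longrightarrow> bana (\<lambda>w. F w + G w) z"
  by (auto simp: bana_def intro!: analytic_intros)

lemma bana_mult: "bana F z \<Longrightarrow> bana G z \<Longrightarrow> bana (\<lambda>w. F w * G w) z"
  by (auto simp: bana_def biquat_mult_sel intro!: analytic_intros)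

lemma analytic_bN: "bana F z \<Longrightarrow> (\<lambda>w. bN (F w)) analytic_on {z}"
  by (auto simp: bana_def bN_def intro!: analytic_intros)

lemma bana_bconj: "bana F z \<Longrightarrow> bana (\<lambda>w. bconj (F w)) z"
  by (auto simp: bana_def intro!: analytic_intros)

lemma bana_binv: "bana F z \<Longrightarrow> bN (F z) \<noteq> 0 \<Longrightarrow> bana (\<lambda>w. binv (F w)) z"
  unfolding binv_def
  by (intro bana_mult bana_cB bana_bconj analytic_on_inverse analytic_bN) auto

lemma bana_cong:
  assumes "bana F z" "eventually (\<lambda>w. F w = G w) (nhds z)"
  shows "bana G z"
proof -
  have "eventually (\<lambda>w. b0 (F w) = b0 (G w)) (nhds z)" "eventually (\<lambda>w. b1 (F w) = b1 (G w)) (nhds z)"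
    "eventually (\<lambda>w. b2 (F w) = b2 (G w)) (nhds z)" "eventually (\<lambda>w. b3 (F w) = b3 (G w)) (nhds z)"
    using assms(2) by (auto elim: eventually_mono)
  then show ?thesis
    using assms(1) unfolding bana_def by (simp add: analytic_at_cong[OF _ refl])
qed

lemma analytic_eq_at:
  fixes f g :: "complex \<Rightarrow> complex"
  assumes "f analytic_on {z}" "g analytic_on {z}" "eventually (\<lambda>w. f w = g w) (at z)"
  shows "f z = g z"
proof -
  have "isCont f z" "isCont g z"
    using assms analytic_at_imp_isCont by auto
  then have "(f \<longlongrightarrow> f z) (at z)" "(g \<longlongrightarrow> g z) (at z)"
    by (auto simp: isCont_def)
  moreover have "(f \<longlongrightarrow> g z) (at z)"
    using assms(3) \<open>(g \<longlongrightarrow> g z) (at z)\<close> by (simp add: tendsto_cong)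
  ultimately show ?thesis
    using LIM_unique by blast
qed

lemma bana_eq_at:
  assumes "bana F z" "bana G z" "eventually (\<lambda>w. F w = G w) (at z)"
  shows "F z = G z"
proof -
  have "eventually (\<lambda>w. b0 (F w) = b0 (G w)) (at z)" "eventually (\<lambda>w. b1 (F w) = b1 (G w)) (at z)"
    "eventually (\<lambda>w. b2 (F w) = b2 (G w)) (at z)" "eventually (\<lambda>w. b3 (F w) = b3 (G w)) (at z)"
    using assms(3) by (auto elim: eventually_mono)
  then show ?thesis
    using assms(1,2) analytic_eq_at[of "\<lambda>w. b0 (F w)" z "\<lambda>w. b0 (G w)"]
      analytic_eq_at[of "\<lambda>w. b1 (F w)" z "\<lambda>w. b1 (G w)"]
      analytic_eq_at[of "\<lambda>w. b2 (F w)" z "\<lambda>w. b2 (G w)"]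
      analytic_eq_at[of "\<lambda>w. b3 (F w)" z "\<lambda>w. b3 (G w)"]
    by (simp add: biquat_eq_iff bana_def)
qed

lemma eventually_nhds_of_at: "eventually P (at z) \<Longrightarrow> P z \<Longrightarrow> eventually P (nhds z)"
  by (simp add: eventually_nhds_conv_at)

lemma analytic_at_eventually:
  fixes f :: "complex \<Rightarrow> complex"
  assumes "f analytic_on {z}"
  shows "eventually (\<lambda>w. f analytic_on {w}) (nhds z)"
proof -
  obtain S where S: "open S" "z \<in> S" "f holomorphic_on S"
    using assms by (auto simp: analytic_at)
  have "f analytic_on {w}" if "w \<in> S" for w
    unfolding analytic_at by (intro exI[of _ S] conjI S that)
  then show ?thesis
    unfolding eventually_nhds using S(1,2) by blast
qed

lemma bana_eventually:
  assumes "bana F z" shows "eventually (bana F) (nhds z)"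
proof -
  note * = assms[unfolded bana_def, THEN conjunct1, THEN analytic_at_eventually]
    assms[unfolded bana_def, THEN conjunct2, THEN conjunct1, THEN analytic_at_eventually]
    assms[unfolded bana_def, THEN conjunct2, THEN conjunct2, THEN conjunct1, THEN analytic_at_eventually]
    assms[unfolded bana_def, THEN conjunct2, THEN conjunct2, THEN conjunct2, THEN analytic_at_eventually]
  from * show ?thesis
    by eventually_elim (simp add: bana_def)
qed

lemma eventually_analytic_nonzero:
  fixes f :: "complex \<Rightarrow> complex"
  assumes "f analytic_on {z}" "f z \<noteq> 0"
  shows "eventually (\<lambda>w. f w \<noteq> 0) (nhds z)"
proof -
  have "isCont f z" using assms analytic_at_imp_isCont by blast
  then have "eventually (\<lambda>w. f w \<noteq> 0) (at z)"
    using assms(2) tendsto_imp_eventually_ne by (auto simp: isCont_def)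
  then show ?thesis using assms(2) eventually_nhds_of_at by blast
qed

lemma unit_at_eventually:
  assumes "unit_at z u" shows "eventually (\<lambda>w. unit_at w u) (nhds z)"
proof -
  have u: "bana u z" "bN (u z) \<noteq> 0"
    using assms by (simp_all add: unit_at_def)
  show ?thesis
    using bana_eventually[OF u(1)] eventually_analytic_nonzero[OF analytic_bN[OF u(1)] u(2)]
    by eventually_elim (simp add: unit_at_def)
qed

lemma unit_at_mult: "unit_at z u \<Longrightarrow> unit_at z v \<Longrightarrow> unit_at z (\<lambda>w. u w * v w)"
  by (simp add: unit_at_def bana_mult)

lemma unit_at_binv: "unit_at z u \<Longrightarrow> unit_at z (\<lambda>w. binv (u w))"
  by (simp add: unit_at_def bana_binv)

lemma unit_at_1 [simp]: "unit_at z (\<lambda>_. 1)"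
  by (simp add: unit_at_def)

lemma unit_at_cB: "f analytic_on {z} \<Longrightarrow> f z \<noteq> 0 \<Longrightarrow> unit_at z (\<lambda>w. cB (f w))"
  by (simp add: unit_at_def bana_cB)

text \<open>Only punctured germs are compared, so the values that total functions take at poles are
  immaterial. The unit stands on the right, as in the equivalence of semiregular germs; left
  multiplication by an arbitrary function therefore respects the relation.\<close>

definition eqv :: "complex \<Rightarrow> (complex \<Rightarrow> biquat) \<Rightarrow> (complex \<Rightarrow> biquat) \<Rightarrow> bool" where
  "eqv z F G \<longleftrightarrow> (\<exists>u. unit_at z u \<and> eventually (\<lambda>w. F w = G w * u w) (at z))"

lemma eqv_trans:
  assumes "eqv z F G" "eqv z G H" shows "eqv z F H"
proof -
  obtain u v where u: "unit_at z u" "eventually (\<lambda>w. F w = G w * u w) (at z)"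
    and v: "unit_at z v" "eventually (\<lambda>w. G w = H w * v w) (at z)"
    using assms unfolding eqv_def by blast
  have "eventually (\<lambda>w. F w = H w * (v w * u w)) (at z)"
    using u(2) v(2) by eventually_elim (simp add: mult.assoc)
  then show ?thesis
    unfolding eqv_def using unit_at_mult[OF v(1) u(1)] by blast
qed

lemma eqv_sym:
  assumes "eqv z F G" shows "eqv z G F"
proof -
  obtain u where u: "unit_at z u" "eventually (\<lambda>w. F w = G w * u w) (at z)"
    using assms unfolding eqv_def by blast
  have "eventually (\<lambda>w. unit_at w u) (at z)"
    using unit_at_eventually[OF u(1)] by (auto simp: eventually_nhds_conv_at)
  then have "eventually (\<lambda>w. G w = F w * binv (u w)) (at z)"
    using u(2) by eventually_elim (simp add: mult.assoc binv_right unit_at_def)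
  then show ?thesis
    unfolding eqv_def using unit_at_binv[OF u(1)] by blast
qed

lemma eqv_mult_left:
  assumes "eqv z F G" shows "eqv z (\<lambda>w. H w * F w) (\<lambda>w. H w * G w)"
proof -
  obtain u where u: "unit_at z u" "eventually (\<lambda>w. F w = G w * u w) (at z)"
    using assms unfolding eqv_def by blast
  from u(2) have "eventually (\<lambda>w. H w * F w = H w * G w * u w) (at z)"
    by eventually_elim (simp add: mult.assoc)
  then show ?thesis using u(1) unfolding eqv_def by blast
qed

lemma eqv_mult_unit: "unit_at z u \<Longrightarrow> eqv z (\<lambda>w. F w * u w) F"
  unfolding eqv_def by auto

lemma eqv_cong: "eventually (\<lambda>w. F w = G w) (at z) \<Longrightarrow> eqv z F G"
  unfolding eqv_def by (rule exI[of _ "\<lambda>_. 1"]) simp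

section \<open>Conjugation symmetry of germs\<close>

definition bsym :: "(complex \<Rightarrow> biquat) \<Rightarrow> bool" where
  "bsym F \<longleftrightarrow> (\<forall>z. F (cnj z) = bcnj (F z))"

lemma bsym_mult: "bsym F \<Longrightarrow> bsym G \<Longrightarrow> bsym (\<lambda>z. F z * G z)"
  by (simp add: bsym_def)

lemma bsym_binv: "bsym F \<Longrightarrow> bsym (\<lambda>z. binv (F z))"
  by (simp add: bsym_def)

lemma eventually_at_cnj:
  assumes "eventually P (at z)" shows "eventually (\<lambda>w. P (cnj w)) (at (cnj z))"
proof -
  have "filterlim cnj (at z) (at (cnj z))"
    unfolding filterlim_at
    by (auto intro!: tendsto_eq_intros always_eventually simp: eventually_at_filter)
  then show ?thesis using assms by (simp add: filterlim_iff)
qed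

lemma analytic_cnj_cnj:
  fixes f :: "complex \<Rightarrow> complex"
  assumes "f analytic_on {z}" shows "(\<lambda>w. cnj (f (cnj w))) analytic_on {cnj z}"
proof -
  obtain S where S: "open S" "z \<in> S" "f holomorphic_on S"
    using assms by (auto simp: analytic_at)
  have op: "open (cnj -` S)"
    by (rule open_vimage[OF S(1)]) (intro continuous_intros)
  have "cnj ` (cnj -` S) = S" by (force simp: image_iff intro: exI[of _ "cnj _"])
  then have "(cnj \<circ> f \<circ> cnj) holomorphic_on (cnj -` S)"
    using S op by (intro holomorphic_on_compose_cnj_cnj) auto
  then show ?thesis
    using S(2) op by (auto simp: analytic_at o_def)
qed

lemma bana_cnj: "bana F z \<Longrightarrow> bana (\<lambda>w. bcnj (F (cnj w))) (cnj z)"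
  using analytic_cnj_cnj[of "\<lambda>w. b0 (F w)" z] analytic_cnj_cnj[of "\<lambda>w. b1 (F w)" z]
    analytic_cnj_cnj[of "\<lambda>w. b2 (F w)" z] analytic_cnj_cnj[of "\<lambda>w. b3 (F w)" z]
  by (simp add: bana_def)

lemma unit_at_cnj: "unit_at z u \<Longrightarrow> unit_at (cnj z) (\<lambda>w. bcnj (u (cnj w)))"
  by (simp add: unit_at_def bana_cnj)

lemma eqv_cnj:
  assumes "eqv z F G" "bsym F" "bsym G" shows "eqv (cnj z) F G"
proof -
  obtain u where u: "unit_at z u" "eventually (\<lambda>w. F w = G w * u w) (at z)"
    using assms unfolding eqv_def by blast
  have "eventually (\<lambda>w. F w = G w * bcnj (u (cnj w))) (at (cnj z))"
    using eventually_at_cnj[OF u(2)]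
  proof eventually_elim
    case (elim w)
    then have "bcnj (F (cnj w)) = bcnj (G (cnj w)) * bcnj (u (cnj w))" by simp
    then show ?case using assms(2,3) by (simp add: bsym_def)
  qed
  then show ?thesis using unit_at_cnj[OF u(1)] unfolding eqv_def by blast
qed

lemma eventually_at_neq2: "eventually (\<lambda>w. w \<noteq> p \<and> w \<noteq> q) (at p)" for p q :: complex
  using eventually_neq_at_within[of p p UNIV] eventually_neq_at_within[of q p UNIV]
  by (rule eventually_conj)

lemma eventually_at_open: "open D \<Longrightarrow> p \<in> D \<Longrightarrow> eventually (\<lambda>w. w \<in> D) (at p)"
  by (simp add: eventually_at_in_open')

lemma eventually_at_of_nhds: "eventually P (nhds z) \<Longrightarrow> eventually P (at z)"
  by (simp add: eventually_nhds_conv_at)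

section \<open>Division of analytic germs by powers of a linear factor\<close>

lemma analytic_divide_root:
  fixes f :: "complex \<Rightarrow> complex"
  assumes "f analytic_on {p}" "f p = 0"
  obtains k where "k analytic_on {p}" "eventually (\<lambda>w. f w = (w - p) * k w) (nhds p)"
proof -
  obtain S where S: "open S" "p \<in> S" "f holomorphic_on S"
    using assms by (auto simp: analytic_at)
  define k where "k = (\<lambda>z. if z = p then deriv f p else (f z - f p) / (z - p))"
  have "k holomorphic_on S"
    unfolding k_def using S by (intro pole_lemma) (auto simp: interior_open)
  then have "k analytic_on {p}"
    unfolding analytic_at using S by blast
  moreover have "f w = (w - p) * k w" for w
    using assms(2) by (simp add: k_def)
  ultimately show thesis using that by simp
qed

lemma bana_divide_root:
  assumes "bana F p" "F p = 0"
  obtains k where "bana k p" "eventually (\<lambda>w. F w = cB (w - p) * k w) (nhds p)"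
proof -
  have a: "(\<lambda>w. b0 (F w)) analytic_on {p}" "(\<lambda>w. b1 (F w)) analytic_on {p}"
    "(\<lambda>w. b2 (F w)) analytic_on {p}" "(\<lambda>w. b3 (F w)) analytic_on {p}"
    using assms(1) by (simp_all add: bana_def)
  obtain k0 where k0: "k0 analytic_on {p}" "eventually (\<lambda>w. b0 (F w) = (w - p) * k0 w) (nhds p)"
    using analytic_divide_root[OF a(1)] assms(2) by auto
  obtain k1 where k1: "k1 analytic_on {p}" "eventually (\<lambda>w. b1 (F w) = (w - p) * k1 w) (nhds p)"
    using analytic_divide_root[OF a(2)] assms(2) by auto
  obtain k2 where k2: "k2 analytic_on {p}" "eventually (\<lambda>w. b2 (F w) = (w - p) * k2 w) (nhds p)"
    using analytic_divide_root[OF a(3)] assms(2) by auto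
  obtain k3 where k3: "k3 analytic_on {p}" "eventually (\<lambda>w. b3 (F w) = (w - p) * k3 w) (nhds p)"
    using analytic_divide_root[OF a(4)] assms(2) by auto
  have "eventually (\<lambda>w. F w = cB (w - p) * Biquat (k0 w) (k1 w) (k2 w) (k3 w)) (nhds p)"
    using k0(2) k1(2) k2(2) k3(2) by eventually_elim (simp add: biquat_eq_iff)
  moreover have "bana (\<lambda>w. Biquat (k0 w) (k1 w) (k2 w) (k3 w)) p"
    using k0(1) k1(1) k2(1) k3(1) by (simp add: bana_def)
  ultimately show thesis using that by blast
qed

text \<open>Were \<open>m > n\<close>, cancelling would present \<open>e\<close> as a multiple of
  \<open>w - p\<close>, against \<open>e p \<noteq> 0\<close>. In the correction of a point the
  inequality shows that the order of the norm really drops.\<close>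

lemma analytic_cancel_power:
  fixes q e :: "complex \<Rightarrow> complex"
  assumes "q analytic_on {p}" "e analytic_on {p}" "e p \<noteq> 0"
    and ev: "eventually (\<lambda>w. (w - p) ^ m * q w = (w - p) ^ n * e w) (at p)"
  shows "m \<le> n" "eventually (\<lambda>w. q w = (w - p) ^ (n - m) * e w) (at p)"
proof -
  have ne: "eventually (\<lambda>w. w \<noteq> p) (at p)"
    by (simp add: eventually_at_filter)
  show le: "m \<le> n"
  proof (rule ccontr)
    assume "\<not> m \<le> n"
    then have nm: "m = n + (m - n)" "m - n > 0" by auto
    have "eventually (\<lambda>w. (w - p) ^ (m - n) * q w = e w) (at p)"
      using ev ne
    proof eventually_elim
      case (elim w)
      have "(w - p) ^ m = (w - p) ^ n * (w - p) ^ (m - n)"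
        using nm(1) by (metis power_add)
      with elim show ?case by (simp add: mult.assoc)
    qed
    then have "(p - p) ^ (m - n) * q p = e p"
      by (intro analytic_eq_at[of "\<lambda>w. (w - p) ^ (m - n) * q w"])
        (auto intro!: analytic_intros assms)
    with nm(2) assms(3) show False by (simp add: zero_power)
  qed
  show "eventually (\<lambda>w. q w = (w - p) ^ (n - m) * e w) (at p)"
    using ev ne
  proof eventually_elim
    case (elim w)
    have "(w - p) ^ n = (w - p) ^ m * (w - p) ^ (n - m)"
      using le by (metis le_add_diff_inverse power_add)
    with elim show ?case by (simp add: mult.assoc)
  qed
qed

section \<open>Correcting a single point\<close>

text \<open>Encodes \<open>(1 - \<i>J)/2\<close> with an imaginary unit \<open>J\<close>: as
  \<open>b0 e\<close> is real, the last equation makes the other three components purely imaginary,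
  and the middle one then says that \<open>J\<close> has length 1.\<close>

definition idem :: "biquat \<Rightarrow> bool" where
  "idem e \<longleftrightarrow> b0 e = 1/2 \<and> (b1 e)\<^sup>2 + (b2 e)\<^sup>2 + (b3 e)\<^sup>2 = - 1/4 \<and> bcnj e = 1 - e"

text \<open>The witness is normalised from \<open>x\<close> times the quaternionic conjugate of its complex
  conjugate; multiplied from the left by its quaternionic conjugate, \<open>x\<close> acquires the factor
  \<open>bN x = 0\<close>.\<close>
lemma idem_annihilating:
  assumes "bN x = 0"
  obtains e where "idem e" "e * x = 0"
proof (cases "x = 0")
  case True
  have "idem (Biquat (1/2) (\<i>/2) 0 0)"
    by (simp add: idem_def biquat_eq_iff power_divide)
  with True show thesis using that by simp
next
  case False
  define y where "y = bcnj x * bconj x"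
  define s where "s = b0 y"
  have s: "s = complex_of_real ((cmod (b0 x))\<^sup>2 + (cmod (b1 x))\<^sup>2 + (cmod (b2 x))\<^sup>2 + (cmod (b3 x))\<^sup>2)"
    by (simp add: s_def y_def biquat_mult_sel complex_norm_square algebra_simps del: of_real_power)
  then have cnjs: "cnj s = s" by simp
  have s0: "s \<noteq> 0"
  proof
    assume "s = 0"
    then have "(cmod (b0 x))\<^sup>2 + (cmod (b1 x))\<^sup>2 + (cmod (b2 x))\<^sup>2 + (cmod (b3 x))\<^sup>2 = 0"
      using s by (metis of_real_eq_0_iff)
    then have "cmod (b0 x) = 0 \<and> cmod (b1 x) = 0 \<and> cmod (b2 x) = 0 \<and> cmod (b3 x) = 0"
      by (smt (verit) zero_le_power2 power2_eq_iff_nonneg zero_power2 norm_ge_zero)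
    with False show False by (simp add: biquat_eq_iff)
  qed
  define e where "e = cB (1 / (2 * s)) * y"
  have "bN y = 0" using assms by (simp add: y_def)
  then have "(b1 y)\<^sup>2 + (b2 y)\<^sup>2 + (b3 y)\<^sup>2 = - s\<^sup>2"
    by (simp add: bN_def s_def algebra_simps add_eq_0_iff)
  moreover have "(b1 e)\<^sup>2 + (b2 e)\<^sup>2 + (b3 e)\<^sup>2 = ((b1 y)\<^sup>2 + (b2 y)\<^sup>2 + (b3 y)\<^sup>2) / (4 * s\<^sup>2)"
    by (simp add: e_def power_divide power_mult_distrib add_divide_distrib)
  ultimately have e2: "(b1 e)\<^sup>2 + (b2 e)\<^sup>2 + (b3 e)\<^sup>2 = - 1/4"
    using s0 by simp
  have e0: "b0 e = 1/2" using s0 by (simp add: e_def s_def)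
  have "bcnj y = bconj y"
    by (simp add: y_def biquat_eq_iff biquat_mult_sel algebra_simps)
  then have "bcnj e = bconj e"
    using cnjs by (simp add: e_def biquat_eq_iff)
  also have "\<dots> = 1 - e" by (simp add: biquat_eq_iff e0)
  finally have "idem e" using e0 e2 by (simp add: idem_def)
  moreover have "e * x = 0"
    using assms by (simp add: e_def y_def mult.assoc bconj_mult_self)
  ultimately show thesis using that by blast
qed

lemma idem_mult:
  assumes "idem e"
  shows "e * e = e" "e * (1 - e) = 0" "(1 - e) * e = 0" "(1 - e) * (1 - e) = 1 - e"
proof -
  have sq: "b1 e * b1 e = - 1/4 - b2 e * b2 e - b3 e * b3 e" and h: "b0 e = 1/2"
    using assms unfolding idem_def power2_eq_square by (auto simp: algebra_simps add_eq_0_iff)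
  show "e * e = e"
    using sq by (simp add: biquat_eq_iff biquat_mult_sel h)
  then show "e * (1 - e) = 0" "(1 - e) * e = 0" "(1 - e) * (1 - e) = 1 - e"
    by (simp_all add: algebra_simps)
qed

text \<open>In matrix terms \<open>e\<close> and \<open>1 - e\<close> are complementary rank-one
  projections and \<open>bN\<close> is the determinant; the combination is diagonal with entries
  \<open>a\<close> and \<open>b\<close>.\<close>

lemma bN_idem_comb:
  assumes "idem e"
  shows "bN (cB a * e + cB b * (1 - e)) = a * b"
proof -
  have h: "b0 e = 1/2" and sq: "(b1 e)\<^sup>2 + (b2 e)\<^sup>2 + (b3 e)\<^sup>2 = - 1/4"
    using assms by (auto simp: idem_def)
  have lin: "a * x + b * (0 - x) = (a - b) * x" for x :: complex
    by (simp add: algebra_simps)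
  have "bN (cB a * e + cB b * (1 - e))
      = (a * (1/2) + b * (1 - 1/2))\<^sup>2 + ((a - b) * b1 e)\<^sup>2 + ((a - b) * b2 e)\<^sup>2 + ((a - b) * b3 e)\<^sup>2"
    unfolding bN_def biquat_sel cB_mult_sel h lin ..
  also have "\<dots> = (a * (1/2) + b * (1/2))\<^sup>2 + (a - b)\<^sup>2 * ((b1 e)\<^sup>2 + (b2 e)\<^sup>2 + (b3 e)\<^sup>2)"
    by (simp add: power_mult_distrib distrib_left)
  also have "\<dots> = a * b"
    unfolding sq by (simp add: power2_eq_square field_simps)
  finally show ?thesis .
qed

text \<open>The product \<open>(z - p) * w z\<close> is a Weierstrass factor with its only zero in
  \<open>D\<close> at \<open>p\<close>. The cofactor \<open>w\<close> is quantified rather than the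
  product, because it has to be inverted at \<open>p\<close> itself.\<close>

definition escapes :: "complex set \<Rightarrow> complex set \<Rightarrow> complex \<Rightarrow> bool" where
  "escapes D K p \<longleftrightarrow> (\<forall>\<epsilon>>0. \<exists>w. (\<forall>z\<in>D. w analytic_on {z} \<and> w z \<noteq> 0) \<and>
     (\<forall>z\<in>K. cmod ((z - p) * w z - 1) \<le> \<epsilon>))"

text \<open>At \<open>cnj p\<close> no condition is imposed: there the germ of \<open>B\<close> is
  the reflection of its germ at \<open>p\<close>.\<close>

definition corrects :: "complex set \<Rightarrow> complex set \<Rightarrow> complex \<Rightarrow> (complex \<Rightarrow> biquat) \<Rightarrow> bool" where
  "corrects D K p G \<longleftrightarrow> (\<forall>\<epsilon>>0. \<exists>B. bsym B \<and> (\<forall>z\<in>D - {p, cnj p}. unit_at z B) \<and>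
     (\<forall>z\<in>K. bnorm (B z - 1) \<le> \<epsilon>) \<and> eqv p B G)"

lemma bnorm_mult_near_1:
  assumes "bnorm (x - 1) \<le> \<delta>" "bnorm (y - 1) \<le> \<delta>" "\<delta> \<le> 1"
  shows "bnorm (x * y - 1) \<le> 3 * \<delta>"
proof -
  have d0: "0 \<le> \<delta>" using assms(1) bnorm_nonneg order_trans by blast
  have eq: "x * y - 1 = (x - 1) * (y - 1) + ((x - 1) + (y - 1))" by (simp add: algebra_simps)
  have "bnorm (x * y - 1) \<le> bnorm ((x - 1) * (y - 1)) + bnorm ((x - 1) + (y - 1))"
    unfolding eq by (rule bnorm_triangle)
  moreover have "bnorm ((x - 1) + (y - 1)) \<le> bnorm (x - 1) + bnorm (y - 1)"
    by (rule bnorm_triangle)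
  moreover have "bnorm (x - 1) * bnorm (y - 1) \<le> \<delta> * 1"
    using assms d0 by (intro mult_mono) auto
  ultimately show ?thesis
    using bnorm_mult[of "x - 1" "y - 1"] assms by linarith
qed

text \<open>Since units act on the right, a factor \<open>B\<close> divided off on the left is
  restored by multiplying a solution for \<open>binv B * G\<close> on the left by \<open>B\<close>.
  The remaining germ depends on \<open>B\<close>, hence on the accuracy, which is why the whole
  predicate \<open>corrects\<close> is assumed for it and not a single factor.\<close>

lemma corrects_step:
  assumes "open D" "p \<in> D"
    and step: "\<And>\<epsilon>. \<epsilon> > 0 \<Longrightarrow> \<exists>B. bsym B \<and> (\<forall>z\<in>D - {p, cnj p}. unit_at z B) \<and>
      (\<forall>z\<in>K. bnorm (B z - 1) \<le> \<epsilon>) \<and> corrects D K p (\<lambda>z. binv (B z) * G z)"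
  shows "corrects D K p G"
  unfolding corrects_def
proof (intro allI impI)
  fix \<epsilon> :: real assume "\<epsilon> > 0"
  \<comment> \<open>Two factors within \<open>\<delta> \<le> 1\<close> of 1 have a product within
    \<open>3 * \<delta>\<close> of 1: two linear terms and one quadratic term.\<close>
  define \<delta> where "\<delta> = min 1 (\<epsilon> / 3)"
  have d: "\<delta> > 0" "\<delta> \<le> 1" "3 * \<delta> \<le> \<epsilon>" using \<open>\<epsilon> > 0\<close> by (auto simp: \<delta>_def)
  obtain B where B: "bsym B" "\<forall>z\<in>D - {p, cnj p}. unit_at z B" "\<forall>z\<in>K. bnorm (B z - 1) \<le> \<delta>"
    "corrects D K p (\<lambda>z. binv (B z) * G z)"
    using step[OF d(1)] by blast
  obtain C where C: "bsym C" "\<forall>z\<in>D - {p, cnj p}. unit_at z C" "\<forall>z\<in>K. bnorm (C z - 1) \<le> \<delta>"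
    "eqv p C (\<lambda>z. binv (B z) * G z)"
    using B(4) d(1) unfolding corrects_def by blast
  have "eventually (\<lambda>w. B w * (binv (B w) * G w) = G w) (at p)"
    using eventually_at_open[OF assms(1,2)] eventually_at_neq2[of p "cnj p"]
  proof eventually_elim
    case (elim w)
    then have "bN (B w) \<noteq> 0" using B(2) by (auto simp: unit_at_def)
    then show ?case by (rule binv_cancel_right)
  qed
  then have "eqv p (\<lambda>w. B w * C w) G"
    by (rule eqv_trans[OF eqv_mult_left[OF C(4)] eqv_cong])
  moreover have "\<forall>z\<in>K. bnorm (B z * C z - 1) \<le> \<epsilon>"
    using bnorm_mult_near_1[OF _ _ d(2)] B(3) C(3) d(3) by fastforce
  ultimately show "\<exists>B. bsym B \<and> (\<forall>z\<in>D - {p, cnj p}. unit_at z B) \<and>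
      (\<forall>z\<in>K. bnorm (B z - 1) \<le> \<epsilon>) \<and> eqv p B G"
    using bsym_mult[OF B(1) C(1)] B(2) C(2) unit_at_mult
    by (intro exI[of _ "\<lambda>w. B w * C w"]) blast
qed

text \<open>At a real point the symmetry of \<open>G\<close> passes through the punctured
  neighbourhood to the limit value. As a consequence, an idempotent that annihilates this value has
  a complement that annihilates it too.\<close>

lemma real_of_bsym_germ:
  assumes "bsym G" "bana g p" "eventually (\<lambda>w. G w = g w) (at p)" "cnj p = p"
  shows "bcnj (g p) = g p"
proof -
  have "eventually (\<lambda>w. G (cnj w) = g (cnj w)) (at p)"
    using eventually_at_cnj[OF assms(3)] assms(4) by simp
  then have ev: "eventually (\<lambda>w. bcnj (g (cnj w)) = g w) (at p)"
    using assms(3)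
  proof eventually_elim
    case (elim w)
    then have "bcnj (g (cnj w)) = bcnj (G (cnj w))" by simp
    also have "\<dots> = G w" using assms(1) by (simp add: bsym_def)
    finally show ?case using elim by simp
  qed
  have "bana (\<lambda>w. bcnj (g (cnj w))) p"
    using bana_cnj[OF assms(2)] assms(4) by simp
  from bana_eq_at[OF this assms(2) ev] show ?thesis using assms(4) by simp
qed

text \<open>Induction on the order \<open>n\<close> of the norm at \<open>p\<close>. Order 0 means
  that the germ is a unit, corrected by the constant 1. Otherwise \<open>g p\<close> is singular, an
  idempotent kills it, and the order falls by 1, or by 2 at a real point; hence the strong form of
  the induction.\<close>

lemma corrects_holomorphic:
  assumes D: "open D" "\<And>z. z \<in> D \<Longrightarrow> cnj z \<in> D" and K: "\<And>z. z \<in> K \<Longrightarrow> cnj z \<in> K"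
    and p: "p \<in> D" and esc: "escapes D K p"
    and "bsym G" "bana g p" "eventually (\<lambda>w. G w = g w) (at p)"
    and "e analytic_on {p}" "e p \<noteq> 0" "eventually (\<lambda>w. bN (g w) = (w - p) ^ n * e w) (at p)"
  shows "corrects D K p G"
  using assms(6-)
proof (induction n arbitrary: G g e rule: less_induct)
  case (less n G g e)
  note G = less.prems(1) and g = less.prems(2) and Gg = less.prems(3)
    and e = less.prems(4,5) and Ng = less.prems(6)
  have Ngp: "bN (g p) = (p - p) ^ n * e p"
    by (rule analytic_eq_at[of "\<lambda>w. bN (g w)" p "\<lambda>w. (w - p) ^ n * e w", OF _ _ Ng])
       (auto intro!: analytic_bN g analytic_intros e)
  show ?case
  proof (cases "n = 0")
    case True
    then have "unit_at p g" using Ngp e g by (simp add: unit_at_def)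
    then have "eqv p G (\<lambda>_. 1)" unfolding eqv_def using Gg by auto
    then have "eqv p (\<lambda>_. 1) G" by (rule eqv_sym)
    then show ?thesis
      unfolding corrects_def by (intro allI impI exI[of _ "\<lambda>_. 1"]) (auto simp: bsym_def bnorm_def)
  next
    case False
    then have "bN (g p) = 0" using Ngp by simp
    then obtain i where i: "idem i" "i * g p = 0" by (rule idem_annihilating)
    \<comment> \<open>The order of \<open>W'\<close> at \<open>p\<close>: its only zero in
      \<open>D\<close> is \<open>cnj p\<close>, which is \<open>p\<close> exactly when
      \<open>p\<close> is real.\<close>
    define a :: nat where "a = (if cnj p = p then 1 else 0)"
    obtain k1 where k1: "bana k1 p" "eventually (\<lambda>w. i * g w = cB (w - p) * k1 w) (nhds p)"
      by (rule bana_divide_root[OF bana_mult[OF bana_const g] i(2)])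
    have "\<exists>k2. bana k2 p \<and> eventually (\<lambda>w. (1 - i) * g w = cB ((w - p) ^ a) * k2 w) (nhds p)"
    proof (cases "cnj p = p")
      case True
      \<comment> \<open>\<open>bcnj\<close> exchanges \<open>i\<close> and \<open>1 - i\<close> and
        fixes \<open>g p\<close>, so both idempotents annihilate \<open>g p\<close>, and
        \<open>z - p\<close> divides both components.\<close>
      have "bcnj (i * g p) = (1 - i) * g p"
        using i(1) real_of_bsym_germ[OF G g Gg True] by (simp only: idem_def bcnj_simps(3))
      moreover have "bcnj (i * g p) = 0" by (simp only: i bcnj_simps)
      ultimately have "(1 - i) * g p = 0" by metis
      then obtain k2 where "bana k2 p" "eventually (\<lambda>w. (1 - i) * g w = cB (w - p) * k2 w) (nhds p)"
        by (rule bana_divide_root[OF bana_mult[OF bana_const g]])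
      moreover have "cB ((w - p) ^ a) = cB (w - p)" for w using True by (simp add: a_def)
      ultimately show ?thesis by auto
    next
      case False
      then show ?thesis
        by (intro exI[of _ "\<lambda>w. (1 - i) * g w"] conjI bana_mult[OF bana_const g]) (simp add: a_def)
    qed
    then obtain k2 where k2: "bana k2 p" "eventually (\<lambda>w. (1 - i) * g w = cB ((w - p) ^ a) * k2 w) (nhds p)"
      by blast
    show ?thesis
    proof (rule corrects_step[OF D(1) p])
      fix \<epsilon> :: real assume "\<epsilon> > 0"
      \<comment> \<open>\<open>B z - 1\<close> combines \<open>W z - 1\<close> and
        \<open>W' z - 1\<close> with coefficients \<open>i\<close> and \<open>1 - i\<close>, which
        accounts for the two norms; the summand 1 keeps the denominator visibly positive.\<close>
      define \<delta> where "\<delta> = \<epsilon> / (bnorm i + bnorm (1 - i) + 1)"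
      have pos: "bnorm i + bnorm (1 - i) + 1 > 0"
        using bnorm_nonneg[of i] bnorm_nonneg[of "1 - i"] by linarith
      then have d: "\<delta> > 0" using \<open>\<epsilon> > 0\<close> by (simp add: \<delta>_def)
      obtain w where w: "\<And>z. z \<in> D \<Longrightarrow> w analytic_on {z}" "\<And>z. z \<in> D \<Longrightarrow> w z \<noteq> 0"
        "\<And>z. z \<in> K \<Longrightarrow> cmod ((z - p) * w z - 1) \<le> \<delta>"
        using esc d unfolding escapes_def by blast
      define W where "W = (\<lambda>z. (z - p) * w z)"
      define W' where "W' = (\<lambda>z. cnj (W (cnj z)))"
      \<comment> \<open>The part of \<open>W'\<close> that does not vanish at \<open>p\<close>: the
        reflected \<open>w\<close> if \<open>p\<close> is real, all of \<open>W'\<close>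
        otherwise.\<close>
      define w' where "w' = (if cnj p = p then (\<lambda>z. cnj (w (cnj z))) else W')"
      have W'_eq: "W' z = (z - p) ^ a * w' z" for z
        by (simp add: a_def w'_def W'_def W_def)
      have W_ana: "W analytic_on {z}" if "z \<in> D" for z
        unfolding W_def by (intro analytic_intros w that)
      have W'_ana: "W' analytic_on {z}" if "z \<in> D" for z
        unfolding W'_def using analytic_cnj_cnj[OF W_ana[OF D(2)[OF that]]] by simp
      have W_nz: "W z \<noteq> 0" if "z \<in> D" "z \<noteq> p" for z
        using w(2) that by (simp add: W_def)
      have W'_nz: "W' z \<noteq> 0" if "z \<in> D" "z \<noteq> cnj p" for z
        unfolding W'_def using W_nz[OF D(2)[OF that(1)]] that(2) by (metis complex_cnj_cnj complex_cnj_zero_iff)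
      have w'_ana: "w' analytic_on {p}"
        using analytic_cnj_cnj[OF w(1)[OF D(2)[OF p]]] W'_ana[OF p] by (simp add: w'_def)
      have w'_nz: "w' p \<noteq> 0"
        using w(2)[OF D(2)[OF p]] W'_nz[OF p] by (auto simp: w'_def)
      define B where "B = (\<lambda>z. cB (W z) * i + cB (W' z) * (1 - i))"
      have bcnj_i: "bcnj i = 1 - i" using i by (simp add: idem_def)
      have B_sym: "bsym B"
        unfolding bsym_def B_def by (simp add: bcnj_i W'_def add.commute)
      have NB: "bN (B z) = W z * W' z" for z
        unfolding B_def by (rule bN_idem_comb[OF i(1)])
      have B_ana: "bana B z" if "z \<in> D" for z
        unfolding B_def by (intro bana_add bana_mult bana_cB W_ana W'_ana that bana_const)
      have B_unit: "unit_at z B" if "z \<in> D - {p, cnj p}" for z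
        using that W_nz[of z] W'_nz[of z] B_ana[of z] by (simp add: unit_at_def NB)
      have B_near: "bnorm (B z - 1) \<le> \<epsilon>" if "z \<in> K" for z
      proof -
        have eq: "B z - 1 = cB (W z - 1) * i + cB (W' z - 1) * (1 - i)"
          by (simp add: B_def biquat_eq_iff algebra_simps)
        have "bnorm (B z - 1) \<le> bnorm (cB (W z - 1) * i) + bnorm (cB (W' z - 1) * (1 - i))"
          unfolding eq by (rule bnorm_triangle)
        moreover have "bnorm (cB (W z - 1) * i) \<le> \<delta> * bnorm i"
        proof (rule order_trans[OF bnorm_mult])
          show "bnorm (cB (W z - 1)) * bnorm i \<le> \<delta> * bnorm i"
            using w(3)[OF that] by (intro mult_right_mono) (auto simp: W_def)
        qed
        moreover have "bnorm (cB (W' z - 1) * (1 - i)) \<le> \<delta> * bnorm (1 - i)"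
        proof (rule order_trans[OF bnorm_mult])
          have "W' z - 1 = cnj (W (cnj z) - 1)" by (simp add: W'_def)
          then have "cmod (W' z - 1) \<le> \<delta>"
            using w(3)[OF K[OF that]] by (simp only: complex_mod_cnj W_def)
          then show "bnorm (cB (W' z - 1)) * bnorm (1 - i) \<le> \<delta> * bnorm (1 - i)"
            by (intro mult_right_mono) auto
        qed
        ultimately have "bnorm (B z - 1) \<le> \<delta> * (bnorm i + bnorm (1 - i) + 1)"
          using d by (simp add: algebra_simps)
        then show ?thesis using pos by (simp add: \<delta>_def)
      qed
      \<comment> \<open>The quotient of \<open>g\<close> by \<open>B\<close> in closed form:
        \<open>B\<close> acts as \<open>W\<close> on left multiples of \<open>i\<close> and as
        \<open>W'\<close> on those of \<open>1 - i\<close>. The powers of \<open>z - p\<close> have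
        already been cancelled, leaving \<open>k1\<close> and \<open>k2\<close>, so \<open>h\<close>
        is analytic at \<open>p\<close>.\<close>
      define h where "h = (\<lambda>z. cB (inverse (w z)) * (i * k1 z) + cB (inverse (w' z)) * ((1 - i) * k2 z))"
      have h_ana: "bana h p"
        unfolding h_def
        by (intro bana_add bana_mult bana_cB bana_const k1 k2 analytic_on_inverse w'_ana w(1)[OF p])
           (use w(2)[OF p] w'_nz in auto)
      have nearD: "eventually (\<lambda>z. z \<in> D) (at p)"
        by (rule eventually_at_open[OF D(1) p])
      have w'_ev: "eventually (\<lambda>z. w' z \<noteq> 0) (at p)"
        by (rule eventually_at_of_nhds[OF eventually_analytic_nonzero[OF w'_ana w'_nz]])
      have gBh: "eventually (\<lambda>z. g z = B z * h z) (at p)"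
        using eventually_at_of_nhds[OF k1(2)] eventually_at_of_nhds[OF k2(2)] nearD w'_ev
      proof eventually_elim
        case (elim z)
        have cancel: "cB (u * v) * x * (cB (inverse v) * y) = cB u * (x * y)" if "v \<noteq> 0" for u v x y
        proof -
          have "cB (u * v) * x * (cB (inverse v) * y) = cB (u * v) * cB (inverse v) * (x * y)"
            by (simp only: mult.assoc cB_mult_left_commute[of x])
          also have "\<dots> = cB u * (x * y)" using that by (simp add: mult.assoc flip: cB_mult)
          finally show ?thesis .
        qed
        have swap: "cB u * x * (cB v * (y * k)) = cB u * (cB v * (x * y * k))" for u v x y k
          by (simp only: mult.assoc cB_mult_left_commute[of x])
        have t12: "cB (W z) * i * (cB (inverse (w' z)) * ((1 - i) * k2 z)) = 0"
          by (simp only: swap idem_mult(2)[OF i(1)] mult_zero_left mult_zero_right)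
        have t21: "cB (W' z) * (1 - i) * (cB (inverse (w z)) * (i * k1 z)) = 0"
          by (simp only: swap idem_mult(3)[OF i(1)] mult_zero_left mult_zero_right)
        have "cB (W z) * i * (cB (inverse (w z)) * (i * k1 z)) = cB (z - p) * (i * (i * k1 z))"
          unfolding W_def by (rule cancel) (use elim w(2) in auto)
        also have "\<dots> = i * (cB (z - p) * (i * k1 z))"
          by (simp only: cB_mult_left_commute[of i])
        also have "\<dots> = i * (i * (cB (z - p) * k1 z))"
          by (simp only: cB_mult_left_commute[of i])
        also have "\<dots> = i * g z"
          by (simp only: elim(1)[symmetric]) (simp only: mult.assoc[symmetric] idem_mult(1)[OF i(1)])
        finally have t11: "cB (W z) * i * (cB (inverse (w z)) * (i * k1 z)) = i * g z" .
        have "cB (W' z) * (1 - i) * (cB (inverse (w' z)) * ((1 - i) * k2 z))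
            = cB ((z - p) ^ a) * ((1 - i) * ((1 - i) * k2 z))"
          unfolding W'_eq by (rule cancel) (use elim in auto)
        also have "\<dots> = (1 - i) * ((1 - i) * (cB ((z - p) ^ a) * k2 z))"
          by (simp only: cB_mult_left_commute[of "1 - i"])
        also have "\<dots> = (1 - i) * g z"
          by (simp only: elim(2)[symmetric]) (simp only: mult.assoc[symmetric] idem_mult(4)[OF i(1)])
        finally have t22: "cB (W' z) * (1 - i) * (cB (inverse (w' z)) * ((1 - i) * k2 z)) = (1 - i) * g z" .
        have "B z * h z = i * g z + (1 - i) * g z"
          unfolding B_def h_def distrib_left distrib_right t11 t12 t21 t22 by simp
        then show ?case by (simp add: algebra_simps)
      qed
      have Gh: "eventually (\<lambda>z. binv (B z) * G z = h z) (at p)"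
        using gBh Gg nearD eventually_at_neq2[of p "cnj p"]
      proof eventually_elim
        case (elim z)
        then have "bN (B z) \<noteq> 0" using B_unit[of z] by (simp add: unit_at_def)
        with elim show ?case by (simp add: binv_cancel_left)
      qed
      \<comment> \<open>Taking norms in \<open>g = B * h\<close> turns \<open>B\<close> into
        \<open>W * W'\<close>, that is \<open>(z - p) ^ (1 + a)\<close> times the nonvanishing
        \<open>w * w'\<close>.\<close>
      have ev: "eventually (\<lambda>z. (z - p) ^ (1 + a) * bN (h z) = (z - p) ^ n * (e z / (w z * w' z))) (at p)"
        using gBh Ng nearD w'_ev
      proof eventually_elim
        case (elim z)
        have "w z \<noteq> 0" using w(2) elim by blast
        then show ?case
          using elim by (simp add: NB W_def W'_eq field_simps)
      qed
      have e': "(\<lambda>z. e z / (w z * w' z)) analytic_on {p}" "e p / (w p * w' p) \<noteq> 0"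
        using w(2)[OF p] w'_nz e by (auto intro!: analytic_intros w(1)[OF p] w'_ana)
      have hN: "1 + a \<le> n" "eventually (\<lambda>z. bN (h z) = (z - p) ^ (n - (1 + a)) * (e z / (w z * w' z))) (at p)"
        using analytic_cancel_power[OF analytic_bN[OF h_ana] e' ev] by auto
      have "corrects D K p (\<lambda>z. binv (B z) * G z)"
        using False hN(1)
        by (intro less.IH[OF _ bsym_mult[OF bsym_binv[OF B_sym] G] h_ana Gh e' hN(2)]) auto
      then show "\<exists>B. bsym B \<and> (\<forall>z\<in>D - {p, cnj p}. unit_at z B) \<and>
        (\<forall>z\<in>K. bnorm (B z - 1) \<le> \<epsilon>) \<and> corrects D K p (\<lambda>z. binv (B z) * G z)"
        using B_sym B_unit B_near by blast
    qed
  qed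
qed

text \<open>The germ of \<open>G\<close> at \<open>z\<close> is meromorphic with norm not identically zero. The pole is cleared by
  a symmetric polynomial so that the notion matches that of a semiregular function.\<close>
definition mgerm :: "complex \<Rightarrow> (complex \<Rightarrow> biquat) \<Rightarrow> bool" where
  "mgerm z G \<longleftrightarrow> (\<exists>m n g e. bana g z \<and> e analytic_on {z} \<and> e z \<noteq> 0 \<and>
     eventually (\<lambda>w. g w = cB (((w - z) * (w - cnj z)) ^ m) * G w \<and> bN (g w) = (w - z) ^ n * e w) (at z))"

lemma inverse_power_near_1:
  assumes "\<epsilon> > 0"
  obtains \<delta> where "\<delta> > 0" "\<And>x y :: complex. cmod (x - 1) \<le> \<delta> \<Longrightarrow> cmod (y - 1) \<le> \<delta> \<Longrightarrow>
    cmod (inverse ((x * y) ^ m) - 1) \<le> \<epsilon>"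
proof -
  define f :: "complex \<times> complex \<Rightarrow> complex" where "f = (\<lambda>q. inverse ((fst q * snd q) ^ m))"
  have "isCont f (1, 1)"
    unfolding f_def by (intro continuous_intros) auto
  then obtain d where d: "d > 0" "\<And>q. dist q (1, 1) < d \<Longrightarrow> dist (f q) (f (1, 1)) < \<epsilon>"
    using assms unfolding continuous_at_eps_delta by metis
  show thesis
  proof (rule that[of "d / 3"])
    show "d / 3 > 0" using d by simp
    fix x y :: complex assume xy: "cmod (x - 1) \<le> d / 3" "cmod (y - 1) \<le> d / 3"
    have "dist (x, y) (1, 1) \<le> dist x 1 + dist y 1"
      by (simp add: dist_Pair_Pair sqrt_sum_squares_le_sum)
    also have "\<dots> < d" using xy d(1) by (simp add: dist_norm)
    finally have "dist (x, y) (1, 1) < d" .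
    then show "cmod (inverse ((x * y) ^ m) - 1) \<le> \<epsilon>"
      using d(2)[of "(x, y)"] by (simp add: f_def dist_norm)
  qed
qed

text \<open>A central factor can be moved to the left, so the reciprocal of \<open>s\<close> serves
  as the factor split off: dividing by it multiplies \<open>G\<close> by \<open>s\<close>, which
  contains the polynomial of \<open>mgerm\<close> and leaves a holomorphic germ.\<close>

lemma corrects_mgerm:
  assumes D: "open D" "\<And>z. z \<in> D \<Longrightarrow> cnj z \<in> D" and K: "\<And>z. z \<in> K \<Longrightarrow> cnj z \<in> K"
    and p: "p \<in> D" and esc: "escapes D K p" and G: "bsym G" "mgerm p G"
  shows "corrects D K p G"
proof -
  obtain m n g e where g: "bana g p" and e: "e analytic_on {p}" "e p \<noteq> 0"
    and gG: "eventually (\<lambda>w. g w = cB (((w - p) * (w - cnj p)) ^ m) * G w \<and> bN (g w) = (w - p) ^ n * e w) (at p)"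
    using G(2) unfolding mgerm_def by blast
  show ?thesis
  proof (rule corrects_step[OF D(1) p])
    fix \<epsilon> :: real assume "\<epsilon> > 0"
    obtain \<delta> where d: "\<delta> > 0" "\<And>x y :: complex. cmod (x - 1) \<le> \<delta> \<Longrightarrow> cmod (y - 1) \<le> \<delta> \<Longrightarrow>
      cmod (inverse ((x * y) ^ m) - 1) \<le> \<epsilon>"
      using inverse_power_near_1[OF \<open>\<epsilon> > 0\<close>, of m] by blast
    obtain w where w: "\<And>z. z \<in> D \<Longrightarrow> w analytic_on {z}" "\<And>z. z \<in> D \<Longrightarrow> w z \<noteq> 0"
      "\<And>z. z \<in> K \<Longrightarrow> cmod ((z - p) * w z - 1) \<le> \<delta>"
      using esc d(1) unfolding escapes_def by blast
    define v where "v = (\<lambda>z. (w z * cnj (w (cnj z))) ^ m)"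
    \<comment> \<open>The \<open>m\<close>-th power of the Weierstrass factor at \<open>p\<close>
      times its reflection. Both are near 1 on \<open>K\<close> because \<open>K\<close> is
      symmetric.\<close>
    define s where "s = (\<lambda>z. ((z - p) * (z - cnj p)) ^ m * v z)"
    have v_ana: "v analytic_on {z}" if "z \<in> D" for z
      unfolding v_def using analytic_cnj_cnj[OF w(1)[OF D(2)[OF that]]] w(1)[OF that]
      by (intro analytic_intros) auto
    have v_nz: "v z \<noteq> 0" if "z \<in> D" for z
      using w(2) D(2) that by (simp add: v_def)
    define B where "B = (\<lambda>z. cB (inverse (s z)))"
    have B_sym: "bsym B"
      by (simp add: bsym_def B_def s_def v_def mult.commute)
    have s_nz: "s z \<noteq> 0" if "z \<in> D - {p, cnj p}" for z
      using that v_nz[of z] by (auto simp: s_def)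
    have B_unit: "unit_at z B" if "z \<in> D - {p, cnj p}" for z
      unfolding B_def using that s_nz[of z]
      by (intro unit_at_cB analytic_on_inverse) (auto simp: s_def intro!: analytic_intros v_ana)
    have B_near: "bnorm (B z - 1) \<le> \<epsilon>" if "z \<in> K" for z
    proof -
      have "cnj ((cnj z - p) * w (cnj z) - 1) = (z - cnj p) * cnj (w (cnj z)) - 1" by simp
      then have "cmod ((z - cnj p) * cnj (w (cnj z)) - 1) \<le> \<delta>"
        using w(3)[OF K[OF that]] by (metis complex_mod_cnj)
      moreover have "s z = (((z - p) * w z) * ((z - cnj p) * cnj (w (cnj z)))) ^ m"
        by (simp add: s_def v_def power_mult_distrib)
      ultimately have "cmod (inverse (s z) - 1) \<le> \<epsilon>"
        using d(2)[OF w(3)[OF that]] by simp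
      moreover have "B z - 1 = cB (inverse (s z) - 1)"
        by (simp add: B_def biquat_eq_iff)
      ultimately show ?thesis by simp
    qed
    have h_ana: "bana (\<lambda>z. cB (v z) * g z) p"
      by (intro bana_mult bana_cB v_ana p g)
    have Gh: "eventually (\<lambda>z. binv (B z) * G z = cB (v z) * g z) (at p)"
      using gG eventually_at_open[OF D(1) p] eventually_at_neq2[of p "cnj p"]
    proof eventually_elim
      case (elim z)
      then have "s z \<noteq> 0" using s_nz by auto
      have "binv (B z) = cB (s z)"
        using \<open>s z \<noteq> 0\<close> by (simp add: B_def binv_def biquat_eq_iff power2_eq_square)
      then show ?case
        using elim by (simp add: s_def cB_mult mult.assoc) (simp add: mult.commute flip: mult.assoc cB_mult)
    qed
    have hN: "eventually (\<lambda>z. bN (cB (v z) * g z) = (z - p) ^ n * ((v z)\<^sup>2 * e z)) (at p)"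
      using gG
    proof eventually_elim
      case (elim z)
      then have "bN (g z) = (z - p) ^ n * e z" by blast
      then show ?case by (simp only: bN_mult bN_cB mult.left_commute)
    qed
    have "corrects D K p (\<lambda>z. binv (B z) * G z)"
      by (rule corrects_holomorphic[OF D K p esc bsym_mult[OF bsym_binv[OF B_sym] G(1)] h_ana Gh _ _ hN])
         (use v_nz[OF p] e in \<open>auto intro!: analytic_intros v_ana p\<close>)
    then show "\<exists>B. bsym B \<and> (\<forall>z\<in>D - {p, cnj p}. unit_at z B) \<and>
        (\<forall>z\<in>K. bnorm (B z - 1) \<le> \<epsilon>) \<and> corrects D K p (\<lambda>z. binv (B z) * G z)"
      using B_sym B_unit B_near by blast
  qed
qed

section \<open>Correcting finitely many points\<close>

lemma mgerm_unit_mult: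
  assumes u: "unit_at p u" and G: "mgerm p G"
  shows "mgerm p (\<lambda>w. u w * G w)"
proof -
  obtain m n g e where g: "bana g p" and e: "e analytic_on {p}" "e p \<noteq> 0"
    and gG: "eventually (\<lambda>w. g w = cB (((w - p) * (w - cnj p)) ^ m) * G w \<and> bN (g w) = (w - p) ^ n * e w) (at p)"
    using G unfolding mgerm_def by blast
  have u': "bana u p" "bN (u p) \<noteq> 0" using u by (simp_all add: unit_at_def)
  have "eventually (\<lambda>w. u w * g w = cB (((w - p) * (w - cnj p)) ^ m) * (u w * G w)
      \<and> bN (u w * g w) = (w - p) ^ n * (bN (u w) * e w)) (at p)"
    using gG
  proof eventually_elim
    case (elim w)
    have "u w * g w = cB (((w - p) * (w - cnj p)) ^ m) * (u w * G w)"
      using elim by (simp only: cB_mult_left_commute)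
    moreover have "bN (g w) = (w - p) ^ n * e w" using elim by blast
    then have "bN (u w * g w) = (w - p) ^ n * (bN (u w) * e w)"
      by (simp only: bN_mult mult.left_commute)
    ultimately show ?case ..
  qed
  moreover have "bana (\<lambda>w. u w * g w) p" by (intro bana_mult u' g)
  moreover have "(\<lambda>w. bN (u w) * e w) analytic_on {p}" "bN (u p) * e p \<noteq> 0"
    using u' e by (auto intro!: analytic_intros analytic_bN)
  ultimately show ?thesis unfolding mgerm_def by blast
qed

lemma unit_at_nonzero_near: "unit_at p u \<Longrightarrow> eventually (\<lambda>w. bN (u w) \<noteq> 0) (at p)"
  by (erule eventually_mono[OF eventually_at_of_nhds[OF unit_at_eventually]]) (simp add: unit_at_def)

text \<open>Points are added one at a time. At a new \<open>p\<close> the product so far is a unit,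
  so the next factor needs the germ \<open>binv (F w * B w) * T p w\<close>; being a unit off
  \<open>p\<close> and \<open>cnj p\<close>, it spoils no earlier point. Keeping \<open>S\<close> in
  the closed upper half-plane prevents \<open>cnj p\<close> from being another member of
  \<open>S\<close>.\<close>

lemma correct_finite:
  assumes D: "open D" "\<And>z. z \<in> D \<Longrightarrow> cnj z \<in> D" and K: "\<And>z. z \<in> K \<Longrightarrow> cnj z \<in> K"
    and "finite S" and "S \<subseteq> D" and "\<And>p. p \<in> S \<Longrightarrow> 0 \<le> Im p \<and> escapes D K p"
    and F: "bsym F" and "\<And>p. p \<in> S \<Longrightarrow> unit_at p F"
    and "\<And>p. p \<in> S \<Longrightarrow> bsym (T p) \<and> mgerm p (T p)" and "\<epsilon> > 0"
  shows "\<exists>B. bsym B \<and> (\<forall>z\<in>D. z \<notin> S \<longrightarrow> cnj z \<notin> S \<longrightarrow> unit_at z B) \<and>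
    (\<forall>z\<in>K. bnorm (B z - 1) \<le> \<epsilon>) \<and> (\<forall>p\<in>S. eqv p (\<lambda>w. F w * B w) (T p))"
  using assms(4-6,8-)
proof (induction S arbitrary: \<epsilon> rule: finite_induct)
  case empty
  then show ?case by (intro exI[of _ "\<lambda>_. 1"]) (auto simp: bsym_def bnorm_def)
next
  case (insert p S)
  define \<delta> where "\<delta> = min 1 (\<epsilon> / 3)"
  have d: "\<delta> > 0" "\<delta> \<le> 1" "3 * \<delta> \<le> \<epsilon>" using insert.prems(5) by (auto simp: \<delta>_def)
  have "\<exists>B. bsym B \<and> (\<forall>z\<in>D. z \<notin> S \<longrightarrow> cnj z \<notin> S \<longrightarrow> unit_at z B) \<and>
    (\<forall>z\<in>K. bnorm (B z - 1) \<le> \<delta>) \<and> (\<forall>p\<in>S. eqv p (\<lambda>w. F w * B w) (T p))"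
    by (rule insert.IH) (use insert.prems d in auto)
  then obtain B where B: "bsym B" "\<And>z. z \<in> D \<Longrightarrow> z \<notin> S \<Longrightarrow> cnj z \<notin> S \<Longrightarrow> unit_at z B"
    "\<And>z. z \<in> K \<Longrightarrow> bnorm (B z - 1) \<le> \<delta>" "\<And>q. q \<in> S \<Longrightarrow> eqv q (\<lambda>w. F w * B w) (T q)"
    by blast
  have p: "p \<in> D" "0 \<le> Im p" "escapes D K p" "unit_at p F" "bsym (T p)" "mgerm p (T p)"
    using insert.prems by auto
  have cnj_neq: "q \<noteq> cnj p" if "q \<in> S" for q
  proof
    assume "q = cnj p"
    moreover have "0 \<le> Im q" using insert.prems(2)[of q] that by auto
    ultimately have "q = p" using p(2) by (auto simp: complex_eq_iff)
    with that insert.hyps show False by blast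
  qed
  have "unit_at p B"
    using B(2)[OF p(1)] insert.hyps cnj_neq by blast
  then have FB: "unit_at p (\<lambda>w. F w * B w)"
    by (rule unit_at_mult[OF p(4)])
  have "corrects D K p (\<lambda>w. binv (F w * B w) * T p w)"
    by (intro corrects_mgerm[OF D K p(1,3)] bsym_mult bsym_binv F B(1) p(5)
        mgerm_unit_mult[OF unit_at_binv[OF FB] p(6)])
  then obtain C where C: "bsym C" "\<And>z. z \<in> D - {p, cnj p} \<Longrightarrow> unit_at z C"
    "\<And>z. z \<in> K \<Longrightarrow> bnorm (C z - 1) \<le> \<delta>" "eqv p C (\<lambda>w. binv (F w * B w) * T p w)"
    using d(1) unfolding corrects_def by blast
  have assoc: "(\<lambda>w. F w * (B w * C w)) = (\<lambda>w. F w * B w * C w)"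
    by (simp add: mult.assoc)
  have "eventually (\<lambda>w. F w * B w * (binv (F w * B w) * T p w) = T p w) (at p)"
    using unit_at_nonzero_near[OF FB] by eventually_elim (rule binv_cancel_right)
  then have "eqv p (\<lambda>w. F w * (B w * C w)) (T p)"
    unfolding assoc by (rule eqv_trans[OF eqv_mult_left[OF C(4)] eqv_cong])
  moreover have "eqv q (\<lambda>w. F w * (B w * C w)) (T q)" if "q \<in> S" for q
  proof -
    have "q \<in> D - {p, cnj p}" using that cnj_neq[OF that] insert.hyps insert.prems(1) by auto
    then show ?thesis
      unfolding assoc by (intro eqv_trans[OF eqv_mult_unit B(4)] C(2) that)
  qed
  moreover have "unit_at z (\<lambda>w. B w * C w)" if "z \<in> D" "z \<notin> insert p S" "cnj z \<notin> insert p S" for z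
    using that by (intro unit_at_mult B(2) C(2)) auto
  moreover have "bnorm (B z * C z - 1) \<le> \<epsilon>" if "z \<in> K" for z
    using bnorm_mult_near_1[OF B(3)[OF that] C(3)[OF that] d(2)] d(3) by linarith
  ultimately show ?case
    using bsym_mult[OF B(1) C(1)] by (intro exI[of _ "\<lambda>w. B w * C w"]) blast
qed

section \<open>Exhaustion of the domain\<close>

text \<open>The usual compact exhaustion, with the distance bound \<open>1/t\<close> cleared of its
  quotient. The index is real so that it can be halved, and \<open>0 < t\<close> makes the set of
  index 0 empty even if \<open>D\<close> is the whole plane and the distance condition is
  void.\<close>

definition exh :: "complex set \<Rightarrow> real \<Rightarrow> complex set" where
  "exh D t = {z. 0 < t \<and> cmod z \<le> t \<and> (\<forall>d\<in>- D. 1 \<le> t * cmod (z - d))}"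

lemma exh_0 [simp]: "exh D 0 = {}"
  by (simp add: exh_def)

lemma exh_mono: "s \<le> t \<Longrightarrow> exh D s \<subseteq> exh D t"
  unfolding exh_def by (auto intro: order_trans[OF _ mult_right_mono[of s t]])

lemma exh_subset: "exh D t \<subseteq> D"
  unfolding exh_def by force

lemma cnj_exh:
  assumes "\<And>z. z \<in> D \<Longrightarrow> cnj z \<in> D" "z \<in> exh D t"
  shows "cnj z \<in> exh D t"
proof -
  have "1 \<le> t * cmod (cnj z - d)" if "d \<in> - D" for d
  proof -
    have "cnj d \<in> - D" using that assms(1)[of "cnj d"] by auto
    then have "1 \<le> t * cmod (z - cnj d)" using assms(2) by (simp add: exh_def)
    also have "cmod (z - cnj d) = cmod (cnj (z - cnj d))" by (simp only: complex_mod_cnj)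
    finally show ?thesis by simp
  qed
  with assms(2) show ?thesis by (simp add: exh_def)
qed

lemma compact_exh: "compact (exh D t)"
proof (cases "t > 0")
  case True
  then have "exh D t = cball 0 t \<inter> (\<Inter>d\<in>- D. {z. 1 \<le> t * cmod (z - d)})"
    by (auto simp: exh_def)
  also have "compact \<dots>"
    by (intro compact_Int_closed compact_cball closed_INT ballI closed_Collect_le continuous_intros)
  finally show ?thesis .
qed (simp add: exh_def)

lemma exh_ball:
  assumes "open D" "p \<in> D"
  obtains r m where "r > 0" "ball p r \<subseteq> exh D (real m)"
proof -
  obtain r where r: "r > 0" "ball p r \<subseteq> D"
    using assms open_contains_ball by blast
  \<comment> \<open>On the ball of half the radius the distance to the complement is at least
    \<open>r / 2\<close>, hence \<open>2 / r\<close>.\<close>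
  obtain m :: nat where m: "max (cmod p + r) (2 / r) < real m"
    using reals_Archimedean2 by blast
  have "z \<in> exh D (real m)" if "z \<in> ball p (r / 2)" for z
  proof -
    have pz: "cmod (z - p) < r / 2" using that by (simp add: dist_norm norm_minus_commute)
    have "cmod z \<le> cmod p + cmod (z - p)" by (metis norm_triangle_sub)
    then have "cmod z \<le> real m" using m pz r by linarith
    moreover have "1 \<le> real m * cmod (z - d)" if "d \<in> - D" for d
    proof -
      have "r \<le> cmod (d - p)" using that r(2) by (force simp: dist_norm norm_minus_commute)
      also have "\<dots> \<le> cmod (d - z) + cmod (z - p)" using norm_triangle_ineq[of "d - z" "z - p"] by simp
      finally have "r / 2 \<le> cmod (z - d)" using pz by (simp add: norm_minus_commute)
      moreover have "2 / r \<le> real m" using m by linarith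
      ultimately have "2 / r * (r / 2) \<le> real m * cmod (z - d)"
        using r by (intro mult_mono) auto
      then show ?thesis using r by simp
    qed
    moreover have "0 < real m" using m r by (smt (verit) norm_ge_zero)
    ultimately show ?thesis by (simp add: exh_def)
  qed
  then have "ball p (r / 2) \<subseteq> exh D (real m)" by blast
  then show thesis using that[of "r / 2" m] r(1) by simp
qed

text \<open>The elementary factor of degree \<open>m\<close> satisfies
  \<open>|E_m(q) - 1| \<le> 3 |q|^(m+1)\<close> for \<open>|q| \<le> 1/2\<close>. A function
  \<open>q\<close> that is at most 1/2 on \<open>K\<close> and takes the value 1 only at
  \<open>p\<close>, with multiplicity one, thus yields factors of any accuracy by raising
  \<open>m\<close>.\<close>

lemma escapes_aux:
  assumes q: "\<And>z. z \<in> D \<Longrightarrow> q analytic_on {z}" and s: "\<And>z. z \<in> D \<Longrightarrow> s analytic_on {z} \<and> s z \<noteq> 0"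
    and eq: "\<And>z. z \<in> D \<Longrightarrow> 1 - q z = (z - p) * s z"
    and K: "K \<subseteq> D" "\<And>z. z \<in> K \<Longrightarrow> cmod (q z) \<le> 1/2"
  shows "escapes D K p"
  unfolding escapes_def
proof (intro allI impI)
  fix \<epsilon> :: real assume "\<epsilon> > 0"
  then obtain m where m: "(1/2) ^ m < \<epsilon> / 3"
    using real_arch_pow_inv[of "\<epsilon> / 3" "1/2"] by auto
  define w where "w = (\<lambda>z. s z * exp (\<Sum>k=1..m. q z ^ k / of_nat k))"
  have W: "(z - p) * w z = weierstrass_factor m (q z)" if "z \<in> D" for z
    using eq[OF that] by (simp add: w_def weierstrass_factor_def flip: mult.assoc)
  have "cmod ((z - p) * w z - 1) \<le> \<epsilon>" if "z \<in> K" for z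
  proof -
    have "cmod ((z - p) * w z - 1) \<le> 3 * cmod (q z) ^ Suc m"
      using weierstrass_factor_bound[OF K(2)[OF that], of m] W K(1) that by auto
    also have "\<dots> \<le> 3 * (1/2) ^ Suc m"
      using K(2)[OF that] by (intro mult_left_mono power_mono) auto
    also have "\<dots> \<le> \<epsilon>" using m \<open>\<epsilon> > 0\<close> by simp
    finally show ?thesis .
  qed
  moreover have "w analytic_on {z} \<and> w z \<noteq> 0" if "z \<in> D" for z
    unfolding w_def using q[OF that] s[OF that] by (auto intro!: analytic_intros)
  ultimately show "\<exists>w. (\<forall>z\<in>D. w analytic_on {z} \<and> w z \<noteq> 0) \<and> (\<forall>z\<in>K. cmod ((z - p) * w z - 1) \<le> \<epsilon>)"
    by blast
qed

text \<open>A point outside \<open>exh D t\<close> either has modulus above \<open>t\<close> and is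
  pushed to infinity with \<open>q = z / p\<close>, or lies closer than \<open>1/t\<close> to some
  \<open>d\<close> outside \<open>D\<close> and is pushed there with
  \<open>q = (p - d) / (z - d)\<close>. On \<open>exh D (t / 2)\<close> either \<open>q\<close> is
  at most 1/2 in modulus; the ratio 2 of the indices is chosen for this bound.\<close>

lemma escapes_exh:
  assumes "p \<in> D" "p \<notin> exh D t"
  shows "escapes D (exh D (t / 2)) p"
proof (cases "t > 0")
  case False
  then have "exh D (t / 2) = {}" by (auto simp: exh_def)
  then show ?thesis
    unfolding escapes_def by (auto intro!: exI[of _ "\<lambda>_. 1"])
next
  case True
  show ?thesis
  proof (cases "cmod p \<le> t")
    case False
    with True have p0: "p \<noteq> 0" by auto
    show ?thesis
    proof (rule escapes_aux[of D "\<lambda>z. z / p" "\<lambda>z. - 1 / p"])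
      show "exh D (t / 2) \<subseteq> D" by (rule exh_subset)
      show "cmod (z / p) \<le> 1 / 2" if "z \<in> exh D (t / 2)" for z
        using that False p0 by (auto simp: exh_def norm_divide field_simps)
    qed (use p0 in \<open>auto intro!: analytic_intros simp: field_simps\<close>)
  next
    case pt: True
    then obtain d where d: "d \<in> - D" "t * cmod (p - d) < 1"
      using assms(2) True by (auto simp: exh_def not_le)
    have zd: "z \<noteq> d" if "z \<in> D" for z using that d by auto
    show ?thesis
    proof (rule escapes_aux[of D "\<lambda>z. (p - d) / (z - d)" "\<lambda>z. 1 / (z - d)"])
      show "exh D (t / 2) \<subseteq> D" by (rule exh_subset)
      show "cmod ((p - d) / (z - d)) \<le> 1 / 2" if "z \<in> exh D (t / 2)" for z
      proof -
        have "1 \<le> t / 2 * cmod (z - d)" using that d by (simp add: exh_def)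
        then have "t * (2 * cmod (p - d)) \<le> t * cmod (z - d)" using d(2) by linarith
        then have "2 * cmod (p - d) \<le> cmod (z - d)" using True by simp
        moreover have "cmod (z - d) > 0" using zd that exh_subset by auto
        ultimately show ?thesis by (simp add: norm_divide field_simps)
      qed
    qed (use zd in \<open>auto intro!: analytic_intros simp: field_simps\<close>)
  qed
qed

section \<open>The infinite product\<close>

definition btends :: "(nat \<Rightarrow> biquat) \<Rightarrow> biquat \<Rightarrow> bool" where
  "btends X l \<longleftrightarrow> (\<lambda>n. b0 (X n)) \<longlonglongrightarrow> b0 l \<and> (\<lambda>n. b1 (X n)) \<longlonglongrightarrow> b1 l \<and>
     (\<lambda>n. b2 (X n)) \<longlonglongrightarrow> b2 l \<and> (\<lambda>n. b3 (X n)) \<longlonglongrightarrow> b3 l"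

lemma btends_unique: "btends X l \<Longrightarrow> btends X m \<Longrightarrow> l = m"
  unfolding btends_def by (auto intro!: biquat_eqI elim: LIMSEQ_unique)

lemma btends_mult_left: "btends X l \<Longrightarrow> btends (\<lambda>n. c * X n) (c * l)"
  unfolding btends_def biquat_mult_sel by (auto intro!: tendsto_intros)

lemma btends_bcnj: "btends X l \<Longrightarrow> btends (\<lambda>n. bcnj (X n)) (bcnj l)"
  unfolding btends_def bcnj_sel by (auto intro!: tendsto_intros)

lemma btends_offset: "btends (\<lambda>n. X (n + k)) l \<Longrightarrow> btends X l"
  unfolding btends_def
  using LIMSEQ_offset[of "\<lambda>n. b0 (X n)" k] LIMSEQ_offset[of "\<lambda>n. b1 (X n)" k]
    LIMSEQ_offset[of "\<lambda>n. b2 (X n)" k] LIMSEQ_offset[of "\<lambda>n. b3 (X n)" k] by blast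

text \<open>The increments are dominated by a geometric series, so the telescoping sum converges
  uniformly on \<open>X\<close>.\<close>

lemma analytic_limit:
  fixes f :: "nat \<Rightarrow> complex \<Rightarrow> complex"
  assumes X: "open X" and f: "\<And>n z. z \<in> X \<Longrightarrow> f n analytic_on {z}"
    and step: "\<And>n z. z \<in> X \<Longrightarrow> cmod (f (Suc n) z - f n z) \<le> (1/2) ^ n"
  obtains g where "\<And>z. z \<in> X \<Longrightarrow> g analytic_on {z}" "\<And>z. z \<in> X \<Longrightarrow> (\<lambda>n. f n z) \<longlonglongrightarrow> g z"
proof -
  define g where "g = (\<lambda>z. f 0 z + (\<Sum>n. f (Suc n) z - f n z))"
  have "uniform_limit X (\<lambda>n z. \<Sum>i<n. f (Suc i) z - f i z) (\<lambda>z. \<Sum>n. f (Suc n) z - f n z) sequentially"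
    by (rule Weierstrass_m_test[OF step]) (auto intro!: summable_geometric)
  then have "uniform_limit X (\<lambda>n z. f 0 z + (\<Sum>i<n. f (Suc i) z - f i z)) g sequentially"
    unfolding g_def by (intro uniform_limit_intros)
  moreover have "(\<lambda>n z. f 0 z + (\<Sum>i<n. f (Suc i) z - f i z)) = f"
    using sum_lessThan_telescope[of "\<lambda>i. f i z" for z] by (intro ext) simp
  ultimately have ul: "uniform_limit X f g sequentially" by simp
  have hol: "f n holomorphic_on X" for n
    using f by (meson analytic_imp_holomorphic analytic_on_analytic_at)
  have "g holomorphic_on X"
  proof (rule holomorphic_uniform_sequence[OF X hol])
    fix x assume "x \<in> X"
    then obtain d where "d > 0" "cball x d \<subseteq> X"
      using X open_contains_cball by blast
    then show "\<exists>d>0. cball x d \<subseteq> X \<and> uniform_limit (cball x d) f g sequentially"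
      using uniform_limit_on_subset[OF ul] by blast
  qed
  then have "g analytic_on {z}" if "z \<in> X" for z
    using X that by (auto simp: analytic_at)
  moreover have "(\<lambda>n. f n z) \<longlonglongrightarrow> g z" if "z \<in> X" for z
    by (rule tendsto_uniform_limitI[OF ul that])
  ultimately show thesis using that by blast
qed

text \<open>While the partial products have norm at most 2, the increments are at most
  \<open>2 * (1/2)^(n+3)\<close>, and these sum to less than 1/2, which in turn keeps the partial
  products within 1/2 of 1. The exponent \<open>n + 3\<close> closes this loop, and the limit, also
  within 1/2 of 1, is invertible.\<close>

lemma product_limit:
  assumes X: "open X" and ana: "\<And>n z. z \<in> X \<Longrightarrow> bana (b n) z"
    and near: "\<And>n z. z \<in> X \<Longrightarrow> bnorm (b n z - 1) \<le> (1/2) ^ (n + 3)"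
    and Q: "\<And>z. Q 0 z = 1" "\<And>n z. Q (Suc n) z = Q n z * b n z"
  obtains L where "\<And>z. z \<in> X \<Longrightarrow> unit_at z L" "\<And>z. z \<in> X \<Longrightarrow> btends (\<lambda>n. Q n z) (L z)"
proof -
  have Q_ana: "bana (Q n) z" if "z \<in> X" for n z
  proof (induction n)
    case 0
    have "Q 0 = (\<lambda>_. 1)" using Q by blast
    then show ?case by simp
  next
    case (Suc n)
    have "Q (Suc n) = (\<lambda>z. Q n z * b n z)" using Q by blast
    then show ?case using bana_mult[OF Suc ana[OF that]] by simp
  qed
  have diff: "Q (Suc n) z - Q n z = Q n z * (b n z - 1)" for n z
    by (simp add: Q algebra_simps)
  \<comment> \<open>\<open>(1 - (1/2)^n) / 2\<close> is the sum of the increment bounds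
    \<open>(1/2)^(k+2)\<close> over \<open>k < n\<close>.\<close>
  have Q_near: "bnorm (Q n z - 1) \<le> (1 - (1/2) ^ n) / 2 \<and> bnorm (Q (Suc n) z - Q n z) \<le> (1/2) ^ (n + 2)"
    if "z \<in> X" for n z
  proof -
    have step: "bnorm (Q (Suc n) z - Q n z) \<le> (1/2) ^ (n + 2)" if "bnorm (Q n z - 1) \<le> (1 - (1/2) ^ n) / 2" for n
    proof -
      have pow: "0 \<le> (1/2 :: real) ^ n" by simp
      have "bnorm (Q n z) \<le> bnorm (Q n z - 1) + bnorm 1"
        using bnorm_triangle[of "Q n z - 1" 1] by simp
      then have "bnorm (Q n z) \<le> 2" using that pow unfolding bnorm_1 by argo
      then have "bnorm (Q n z) * bnorm (b n z - 1) \<le> 2 * (1/2) ^ (n + 3)"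
        using near[OF \<open>z \<in> X\<close>] by (intro mult_mono) auto
      moreover have "2 * (1/2 :: real) ^ (n + 3) = (1/2) ^ (n + 2)" by (simp add: power_add power_divide)
      ultimately show ?thesis
        unfolding diff using bnorm_mult[of "Q n z" "b n z - 1"] by linarith
    qed
    have "bnorm (Q n z - 1) \<le> (1 - (1/2) ^ n) / 2"
    proof (induction n)
      case 0 then show ?case by (simp add: Q bnorm_def)
    next
      case (Suc n)
      have "Q (Suc n) z - 1 = (Q n z - 1) + (Q (Suc n) z - Q n z)" by simp
      then have "bnorm (Q (Suc n) z - 1) \<le> bnorm (Q n z - 1) + bnorm (Q (Suc n) z - Q n z)"
        using bnorm_triangle[of "Q n z - 1" "Q (Suc n) z - Q n z"] by simp
      also have "\<dots> \<le> (1 - (1/2) ^ n) / 2 + (1/2) ^ (n + 2)"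
        using Suc step[OF Suc] by linarith
      also have "\<dots> = (1 - (1/2) ^ Suc n) / 2" by (simp add: field_simps)
      finally show ?case .
    qed
    with step show ?thesis by blast
  qed
  have small: "cmod (c (Q (Suc n) z) - c (Q n z)) \<le> (1/2) ^ n"
    if "z \<in> X" "c (Q (Suc n) z) - c (Q n z) = c (Q (Suc n) z - Q n z)"
      "cmod (c (Q (Suc n) z - Q n z)) \<le> bnorm (Q (Suc n) z - Q n z)" for c n z
  proof -
    have "(1/2 :: real) ^ (n + 2) \<le> (1/2) ^ n" by (simp add: power_add)
    then show ?thesis
      unfolding that(2) using that(3) conjunct2[OF Q_near[OF that(1), of n]] by linarith
  qed
  have le: "cmod (b0 x) \<le> bnorm x" "cmod (b1 x) \<le> bnorm x" "cmod (b2 x) \<le> bnorm x" "cmod (b3 x) \<le> bnorm x" for x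
    by (simp_all add: bnorm_def)
  have comp: "(\<lambda>w. b0 (Q n w)) analytic_on {z}" "(\<lambda>w. b1 (Q n w)) analytic_on {z}"
    "(\<lambda>w. b2 (Q n w)) analytic_on {z}" "(\<lambda>w. b3 (Q n w)) analytic_on {z}" if "z \<in> X" for n z
    using Q_ana[OF that, of n] by (simp_all add: bana_def)
  obtain g0 where g0: "\<And>z. z \<in> X \<Longrightarrow> g0 analytic_on {z}" "\<And>z. z \<in> X \<Longrightarrow> (\<lambda>n. b0 (Q n z)) \<longlonglongrightarrow> g0 z"
    by (rule analytic_limit[of X "\<lambda>n z. b0 (Q n z)", OF X comp(1) small[of _ b0, OF _ _ le(1)]]) ((simp; fail) | blast)+
  obtain g1 where g1: "\<And>z. z \<in> X \<Longrightarrow> g1 analytic_on {z}" "\<And>z. z \<in> X \<Longrightarrow> (\<lambda>n. b1 (Q n z)) \<longlonglongrightarrow> g1 z"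
    by (rule analytic_limit[of X "\<lambda>n z. b1 (Q n z)", OF X comp(2) small[of _ b1, OF _ _ le(2)]]) ((simp; fail) | blast)+
  obtain g2 where g2: "\<And>z. z \<in> X \<Longrightarrow> g2 analytic_on {z}" "\<And>z. z \<in> X \<Longrightarrow> (\<lambda>n. b2 (Q n z)) \<longlonglongrightarrow> g2 z"
    by (rule analytic_limit[of X "\<lambda>n z. b2 (Q n z)", OF X comp(3) small[of _ b2, OF _ _ le(3)]]) ((simp; fail) | blast)+
  obtain g3 where g3: "\<And>z. z \<in> X \<Longrightarrow> g3 analytic_on {z}" "\<And>z. z \<in> X \<Longrightarrow> (\<lambda>n. b3 (Q n z)) \<longlonglongrightarrow> g3 z"
    by (rule analytic_limit[of X "\<lambda>n z. b3 (Q n z)", OF X comp(4) small[of _ b3, OF _ _ le(4)]]) ((simp; fail) | blast)+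
  define L where "L = (\<lambda>z. Biquat (g0 z) (g1 z) (g2 z) (g3 z))"
  have lim: "btends (\<lambda>n. Q n z) (L z)" if "z \<in> X" for z
    unfolding btends_def L_def using g0(2) g1(2) g2(2) g3(2) that by simp
  moreover have "unit_at z L" if "z \<in> X" for z
  proof -
    have "(\<lambda>n. bnorm (Q n z - 1)) \<longlonglongrightarrow> bnorm (L z - 1)"
      using lim[OF that] unfolding btends_def bnorm_def biquat_sel by (intro tendsto_intros) auto
    moreover have "bnorm (Q n z - 1) \<le> 1/2" for n
      by (rule order_trans[OF conjunct1[OF Q_near[OF that, of n]]]) simp
    ultimately have "bnorm (L z - 1) \<le> 1/2"
      by (intro LIMSEQ_le_const2[of _ _ "1/2"]) auto
    then have "bN (L z) \<noteq> 0" by (intro bN_nonzero_near_1) simp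
    moreover have "bana L z" using g0(1) g1(1) g2(1) g3(1) that by (simp add: bana_def L_def)
    ultimately show ?thesis by (simp add: unit_at_def)
  qed
  ultimately show thesis using that by blast
qed

lemma finite_Int_compact:
  fixes P K :: "complex set"
  assumes "compact K" "\<And>z. z \<in> K \<Longrightarrow> eventually (\<lambda>w. w \<notin> P) (at z)"
  shows "finite (P \<inter> K)"
  using finite_not_islimpt_in_compact[OF assms(1), of P] assms(2)
  by (simp add: islimpt_iff_eventually Int_commute)

text \<open>\<open>T\<close> gives each point a symmetric germ of its own; nearby points are tied
  together only through triviality off a discrete set. The points new at stage \<open>n\<close> lie
  outside \<open>exh D n\<close>, so their factor can be made close to 1 on
  \<open>exh D (n / 2)\<close>, and these smaller sets still exhaust \<open>D\<close>.\<close>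

lemma product_theorem:
  assumes D: "open D" "\<And>z. z \<in> D \<Longrightarrow> cnj z \<in> D"
    and T: "\<And>p. p \<in> D \<Longrightarrow> 0 \<le> Im p \<Longrightarrow> bsym (T p) \<and> mgerm p (T p)"
    and disc: "\<And>p. p \<in> D \<Longrightarrow> 0 \<le> Im p \<Longrightarrow>
      eventually (\<lambda>z. 0 \<le> Im z \<longrightarrow> eqv z (T z) (\<lambda>_. 1)) (at p)"
  shows "\<exists>\<Psi>. bsym \<Psi> \<and> (\<forall>p\<in>D. 0 \<le> Im p \<longrightarrow> eqv p \<Psi> (T p))"
proof -
  define P where "P = {z \<in> D. 0 \<le> Im z \<and> \<not> eqv z (T z) (\<lambda>_. 1)}"
  define K where "K = (\<lambda>n::nat. exh D (real n))"
  define L where "L = (\<lambda>n::nat. exh D (real n / 2))"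
  have K_mono: "K m \<subseteq> K n" if "m \<le> n" for m n
    unfolding K_def using that by (intro exh_mono) simp
  have L_mono: "L m \<subseteq> L n" if "m \<le> n" for m n
    unfolding L_def using that by (intro exh_mono) simp
  have LK: "L n \<subseteq> K n" for n
    unfolding K_def L_def by (rule exh_mono) simp
  have KD: "K n \<subseteq> D" for n unfolding K_def by (rule exh_subset)
  have K_sym: "cnj z \<in> K n" if "z \<in> K n" for z n
    using that unfolding K_def by (intro cnj_exh D(2))
  have fin: "finite (P \<inter> K n)" for n
  proof (rule finite_Int_compact)
    show "compact (K n)" unfolding K_def by (rule compact_exh)
    fix z assume "z \<in> K n"
    then have "z \<in> D" using KD by blast
    show "eventually (\<lambda>w. w \<notin> P) (at z)"
    proof (cases "0 \<le> Im z")
      case True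
      then show ?thesis
        using disc[OF \<open>z \<in> D\<close>] unfolding P_def by (auto elim!: eventually_mono)
    next
      case False
      have "eventually (\<lambda>w. Im w < 0) (at z)"
        using False tendsto_Im[OF tendsto_ident_at[of z UNIV]] by (intro order_tendstoD(2)) auto
      then show ?thesis unfolding P_def by (auto elim!: eventually_mono)
    qed
  qed
  \<comment> \<open>The invertibility demanded at points of \<open>P\<close> still to come is what
    allows \<open>correct_finite\<close> to treat them later.\<close>
  define good where "good = (\<lambda>n F. bsym F \<and>
    (\<forall>z\<in>D. 0 \<le> Im z \<longrightarrow> (if z \<in> P \<inter> K n then eqv z F (T z) else unit_at z F)))"
  \<comment> \<open>Smallness is available only on \<open>L n\<close>; the unit condition on the
    larger \<open>K n\<close> supplies the analyticity of the factors when the limit is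
    taken.\<close>
  define next_of where "next_of = (\<lambda>n F F'. \<exists>B. F' = (\<lambda>z. F z * B z) \<and> (\<forall>z\<in>K n. unit_at z B) \<and>
    (\<forall>z\<in>L n. bnorm (B z - 1) \<le> (1/2) ^ (n + 3)))"
  have "\<exists>f. \<forall>n. good n (f n) \<and> next_of n (f n) (f (Suc n))"
  proof (rule dependent_nat_choice)
    show "\<exists>F. good 0 F"
      by (intro exI[of _ "\<lambda>_. 1"]) (simp add: good_def K_def bsym_def)
    fix F n assume F: "good n F"
    define S where "S = P \<inter> K (Suc n) - K n"
    have "\<exists>B. bsym B \<and> (\<forall>z\<in>D. z \<notin> S \<longrightarrow> cnj z \<notin> S \<longrightarrow> unit_at z B) \<and>
      (\<forall>z\<in>L n. bnorm (B z - 1) \<le> (1/2) ^ (n + 3)) \<and> (\<forall>p\<in>S. eqv p (\<lambda>w. F w * B w) (T p))"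
    proof (rule correct_finite[OF D])
      show "cnj z \<in> L n" if "z \<in> L n" for z
        using that unfolding L_def by (intro cnj_exh D(2))
      show "finite S" unfolding S_def using fin by auto
      show "S \<subseteq> D" unfolding S_def P_def by auto
      show "0 \<le> Im p \<and> escapes D (L n) p" if "p \<in> S" for p
        using that escapes_exh[of p D "real n"] unfolding S_def P_def K_def L_def by auto
      show "unit_at p F" if "p \<in> S" for p
        using F that unfolding good_def S_def P_def by auto
      show "bsym F" using F by (simp add: good_def)
      show "bsym (T p) \<and> mgerm p (T p)" if "p \<in> S" for p
        using T that unfolding S_def P_def by auto
    qed auto
    then obtain B where B: "bsym B" "\<And>z. z \<in> D \<Longrightarrow> z \<notin> S \<Longrightarrow> cnj z \<notin> S \<Longrightarrow> unit_at z B"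
      "\<And>z. z \<in> L n \<Longrightarrow> bnorm (B z - 1) \<le> (1/2) ^ (n + 3)" "\<And>p. p \<in> S \<Longrightarrow> eqv p (\<lambda>w. F w * B w) (T p)"
      by blast
    have "good (Suc n) (\<lambda>z. F z * B z)"
      unfolding good_def
    proof (intro conjI ballI impI)
      show "bsym (\<lambda>z. F z * B z)" using F B(1) bsym_mult by (simp add: good_def)
      fix z assume z: "z \<in> D" "0 \<le> Im z"
      have Fz: "if z \<in> P \<inter> K n then eqv z F (T z) else unit_at z F"
        using F z unfolding good_def by blast
      have u: "unit_at z B" if "z \<notin> S"
      proof (rule B(2)[OF z(1) that])
        show "cnj z \<notin> S"
        proof
          assume "cnj z \<in> S"
          then have "0 \<le> Im (cnj z)" unfolding S_def P_def by blast
          then have "cnj z = z" using z by (simp add: complex_eq_iff)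
          with \<open>cnj z \<in> S\<close> that show False by simp
        qed
      qed
      show "if z \<in> P \<inter> K (Suc n) then eqv z (\<lambda>z. F z * B z) (T z) else unit_at z (\<lambda>z. F z * B z)"
      proof (cases "z \<in> S")
        case True
        then show ?thesis using B(4) unfolding S_def by auto
      next
        case False
        then have "z \<in> P \<inter> K (Suc n) \<longleftrightarrow> z \<in> P \<inter> K n"
          unfolding S_def using K_mono[of n "Suc n"] by auto
        then show ?thesis
          using Fz u[OF False] eqv_trans[OF eqv_mult_unit] unit_at_mult by (auto split: if_splits)
      qed
    qed
    \<comment> \<open>\<open>S\<close> avoids the symmetric set \<open>K n\<close>, so neither
      \<open>z\<close> nor \<open>cnj z\<close> is among the corrected points.\<close>
    moreover have "unit_at z B" if "z \<in> K n" for z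
      using that K_sym[OF that] KD by (intro B(2)) (auto simp: S_def)
    ultimately show "\<exists>F'. good (Suc n) F' \<and> next_of n F F'"
      unfolding next_of_def using B(3) by blast
  qed
  then obtain F where F: "\<And>n. good n (F n)" "\<And>n. next_of n (F n) (F (Suc n))" by blast
  from F(2) have "\<exists>B. \<forall>n. F (Suc n) = (\<lambda>z. F n z * B n z) \<and> (\<forall>z\<in>K n. unit_at z (B n)) \<and>
    (\<forall>z\<in>L n. bnorm (B n z - 1) \<le> (1/2) ^ (n + 3))"
    unfolding next_of_def by (intro choice) blast
  then obtain B where B: "\<And>n z. F (Suc n) z = F n z * B n z" "\<And>n z. z \<in> K n \<Longrightarrow> unit_at z (B n)"
    "\<And>n z. z \<in> L n \<Longrightarrow> bnorm (B n z - 1) \<le> (1/2) ^ (n + 3)"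
    by metis
  \<comment> \<open>Near \<open>p\<close> the limit is a finite product times a unit: the tail from
    stage \<open>m\<close> converges to an invertible holomorphic \<open>U\<close>, while all
    singularities sit in \<open>F m\<close>, which is carried along pointwise.\<close>
  have local: "\<exists>r m U. r > 0 \<and> ball p r \<subseteq> K m \<and>
      (\<forall>z\<in>ball p r. unit_at z U \<and> btends (\<lambda>n. F n z) (F m z * U z))" if p: "p \<in> D" for p
  proof -
    obtain r m' where r: "r > 0" "ball p r \<subseteq> exh D (real m')"
      using exh_ball[OF D(1) p] by blast
    \<comment> \<open>Doubling makes \<open>L m\<close> the exhausting set of index
      \<open>m'\<close>; from stage \<open>m\<close> on, the factors are small there.\<close>
    define m where "m = 2 * m'"
    have rL: "ball p r \<subseteq> L m" using r(2) by (simp add: L_def m_def)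
    define Q where "Q = rec_nat (\<lambda>z. 1) (\<lambda>n q z. q z * B (m + n) z)"
    have Q: "Q 0 z = 1" "Q (Suc n) z = Q n z * B (m + n) z" for n z
      by (simp_all add: Q_def)
    have FQ: "F (n + m) z = F m z * Q n z" for n z
    proof (induction n)
      case (Suc n)
      then show ?case using B(1)[of "n + m" z] by (simp add: Q mult.assoc add.commute)
    qed (simp add: Q)
    obtain U where U: "\<And>z. z \<in> ball p r \<Longrightarrow> unit_at z U" "\<And>z. z \<in> ball p r \<Longrightarrow> btends (\<lambda>n. Q n z) (U z)"
    proof (rule product_limit[of "ball p r" "\<lambda>n. B (m + n)" Q])
      fix n z assume z: "z \<in> ball p r"
      then have zL: "z \<in> L (m + n)" using rL L_mono[of m "m + n"] by auto
      then show "bana (B (m + n)) z" using B(2)[of z "m + n"] LK by (auto simp: unit_at_def)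
      have "(1/2 :: real) ^ (m + n + 3) \<le> (1/2) ^ (n + 3)" by (intro power_decreasing) auto
      then show "bnorm (B (m + n) z - 1) \<le> (1/2) ^ (n + 3)" using B(3)[OF zL] by linarith
    qed (use Q in auto)
    have "btends (\<lambda>n. F n z) (F m z * U z)" if "z \<in> ball p r" for z
      using btends_mult_left[OF U(2)[OF that], of "F m z"]
      by (simp only: FQ[symmetric] btends_offset[of "\<lambda>n. F n z" m "F m z * U z"])
    then show ?thesis using r(1) rL LK[of m] U(1) by (intro exI[of _ r] exI[of _ m] exI[of _ U]) auto
  qed
  \<comment> \<open>Outside \<open>D\<close> nothing is known about convergence; the value 0 there
    keeps \<open>\<Psi>\<close> symmetric on the whole plane.\<close>
  define \<Psi> where "\<Psi> = (\<lambda>z. if z \<in> D then THE l. btends (\<lambda>n. F n z) l else 0)"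
  have \<Psi>: "\<Psi> z = l" if "z \<in> D" "btends (\<lambda>n. F n z) l" for z l
    unfolding \<Psi>_def using that btends_unique by (auto intro!: the_equality)
  have "bsym \<Psi>"
    unfolding bsym_def
  proof
    fix z
    show "\<Psi> (cnj z) = bcnj (\<Psi> z)"
    proof (cases "z \<in> D")
      case True
      then obtain l where l: "btends (\<lambda>n. F n z) l"
        using local[OF True] centre_in_ball by metis
      have "F n (cnj z) = bcnj (F n z)" for n using F(1) by (simp add: good_def bsym_def)
      then have "btends (\<lambda>n. F n (cnj z)) (bcnj l)" using btends_bcnj[OF l] by simp
      then show ?thesis using \<Psi>[OF True l] \<Psi>[OF D(2)[OF True]] by simp
    next
      case False
      then have "cnj z \<notin> D" using D(2)[of "cnj z"] by auto
      with False show ?thesis by (simp add: \<Psi>_def)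
    qed
  qed
  moreover have "eqv p \<Psi> (T p)" if p: "p \<in> D" "0 \<le> Im p" for p
  proof -
    obtain r m U where r: "r > 0" "ball p r \<subseteq> K m" and U: "\<And>z. z \<in> ball p r \<Longrightarrow> unit_at z U"
      "\<And>z. z \<in> ball p r \<Longrightarrow> btends (\<lambda>n. F n z) (F m z * U z)"
      using local[OF p(1)] by blast
    have "eventually (\<lambda>z. z \<in> ball p r) (at p)"
      by (rule eventually_at_open) (use r in auto)
    then have "eventually (\<lambda>z. \<Psi> z = F m z * U z) (at p)"
    proof eventually_elim
      case (elim z)
      then show ?case using subset_trans[OF r(2) KD] by (intro \<Psi> U(2)) auto
    qed
    then have 1: "eqv p \<Psi> (F m)"
      unfolding eqv_def using U(1)[of p] r(1) by auto
    have "p \<in> K m" using r by auto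
    have good_p: "if p \<in> P \<inter> K m then eqv p (F m) (T p) else unit_at p (F m)"
      using F(1)[of m] p unfolding good_def by blast
    show ?thesis
    proof (cases "p \<in> P")
      case True
      then show ?thesis using 1 good_p \<open>p \<in> K m\<close> eqv_trans by auto
    next
      case False
      then have "unit_at p (F m)" using good_p by simp
      then have "eqv p (F m) (\<lambda>_. 1)" using eqv_mult_unit[of p "F m" "\<lambda>_. 1"] by simp
      moreover have "eqv p (T p) (\<lambda>_. 1)" using False p unfolding P_def by blast
      ultimately show ?thesis using 1 eqv_trans eqv_sym by blast
    qed
  qed
  ultimately show ?thesis by blast
qed

section \<open>Stem functions as biquaternionic functions\<close>

definition qre :: "biquat \<Rightarrow> quat" where
  "qre x = (Re (b0 x), Re (b1 x), Re (b2 x), Re (b3 x))"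

definition qim :: "biquat \<Rightarrow> quat" where
  "qim x = (Im (b0 x), Im (b1 x), Im (b2 x), Im (b3 x))"

definition toB :: "quat \<Rightarrow> quat \<Rightarrow> biquat" where
  "toB A C = Biquat (Complex (qcomp 0 A) (qcomp 0 C)) (Complex (qcomp 1 A) (qcomp 1 C))
     (Complex (qcomp 2 A) (qcomp 2 C)) (Complex (qcomp 3 A) (qcomp 3 C))"

text \<open>Replaces the central imaginary unit by \<open>J\<close>, placed on the left. The map is
  additive but not multiplicative; it does respect left factors of the form
  \<open>cB c\<close>.\<close>

definition ev :: "quat \<Rightarrow> biquat \<Rightarrow> quat" where
  "ev J x = qre x + qmul J (qim x)"

definition fS :: "(complex \<Rightarrow> biquat) \<Rightarrow> quat \<Rightarrow> quat" where
  "fS \<Phi> q = ev (qunit_of q) (\<Phi> (qcpx q))"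

definition stem :: "(quat \<Rightarrow> quat) \<Rightarrow> complex \<Rightarrow> biquat" where
  "stem f z = toB (stem1 f z) (stem2 f z)"

lemma qcomp_simps [simp]:
  "qcomp 0 (a, b, c, d) = a" "qcomp (Suc 0) (a, b, c, d) = b"
  "qcomp 2 (a, b, c, d) = c" "qcomp 3 (a, b, c, d) = d"
  by (simp_all add: qcomp_def)

lemma qre_toB [simp]: "qre (toB A C) = A" and qim_toB [simp]: "qim (toB A C) = C"
  by (cases A, cases C, simp add: qre_def qim_def toB_def)+

lemma toB_eq [simp]: "toB (qre x) (qim x) = x"
  by (simp add: toB_def qre_def qim_def biquat_eq_iff)

lemma toB_eqI: "qre x = A \<Longrightarrow> qim x = C \<Longrightarrow> toB A C = x"
  using toB_eq by blast

lemma toB_mult: "toB A C * toB A' C' = toB (qmul A A' - qmul C C') (qmul A C' + qmul C A')"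
  by (cases A, cases C, cases A', cases C')
    (simp add: toB_def biquat_eq_iff biquat_mult_sel complex_eq_iff algebra_simps)

lemma bconj_toB: "bconj (toB A C) = toB (qconj A) (qconj C)"
  by (cases A, cases C) (simp add: toB_def biquat_eq_iff complex_eq_iff)

lemma bcnj_toB: "bcnj (toB A C) = toB A (- C)"
  by (cases A, cases C) (simp add: toB_def biquat_eq_iff complex_eq_iff)

lemma slice_of_eq: "slice_of F1 F2 = fS (\<lambda>z. toB (F1 z) (F2 z))"
  by (simp add: slice_of_def fS_def ev_def fun_eq_iff)

lemma sprod_eq: "sprod f g = fS (\<lambda>z. stem f z * stem g z)"
  by (simp add: sprod_def slice_of_eq stem_def toB_mult)

lemma sconj_eq: "sconj f = fS (\<lambda>z. bconj (stem f z))"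
  by (simp add: sconj_def slice_of_eq stem_def bconj_toB)

section \<open>Imaginary units and the polar form of a quaternion\<close>

lemma imag_units_iff: "J \<in> imag_units \<longleftrightarrow> (\<exists>b c d. J = (0, b, c, d) \<and> b\<^sup>2 + c\<^sup>2 + d\<^sup>2 = 1)"
proof
  assume "J \<in> imag_units"
  obtain a b c d where J: "J = (a, b, c, d)" by (cases J) auto
  have *: "a * a - b * b - c * c - d * d = - 1" "a * b = 0" "a * c = 0" "a * d = 0"
    using \<open>J \<in> imag_units\<close> by (auto simp: J imag_units_def qreal_def)
  have "a = 0"
  proof (rule ccontr)
    assume "a \<noteq> 0"
    then have "a * a = - 1" using * by auto
    then show False using zero_le_square[of a] by linarith
  qed
  then show "\<exists>b c d. J = (0, b, c, d) \<and> b\<^sup>2 + c\<^sup>2 + d\<^sup>2 = 1"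
    using * by (auto simp: J power2_eq_square)
next
  assume "\<exists>b c d. J = (0, b, c, d) \<and> b\<^sup>2 + c\<^sup>2 + d\<^sup>2 = 1"
  then show "J \<in> imag_units"
    by (auto simp: imag_units_def qreal_def power2_eq_square algebra_simps)
qed

lemma imag_unitsE:
  assumes "J \<in> imag_units"
  obtains b c d where "J = (0, b, c, d)" "b\<^sup>2 + c\<^sup>2 + d\<^sup>2 = 1"
  using assms unfolding imag_units_iff by blast

lemma norm_imag: "norm ((b, c, d) :: real \<times> real \<times> real) = sqrt (b\<^sup>2 + c\<^sup>2 + d\<^sup>2)"
  by (simp add: norm_Pair algebra_simps)

lemma qi_unit [simp]: "qi \<in> imag_units"
  by (simp add: imag_units_iff qi_def)

lemma uminus_unit: "J \<in> imag_units \<Longrightarrow> - J \<in> imag_units"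
  by (elim imag_unitsE) (simp add: imag_units_iff)

lemma qunit_of_unit [simp]: "qunit_of q \<in> imag_units"
proof (cases "snd q = 0")
  case False
  obtain a b c d where q: "q = (a, b, c, d)" by (cases q) auto
  have "norm (b, c, d) > 0" using False q by simp
  moreover have "(norm (b, c, d))\<^sup>2 = b\<^sup>2 + c\<^sup>2 + d\<^sup>2"
    by (simp add: norm_imag)
  ultimately have "b\<^sup>2 + c\<^sup>2 + d\<^sup>2 \<noteq> 0" "(norm (b, c, d))\<^sup>2 = b\<^sup>2 + c\<^sup>2 + d\<^sup>2"
    by (metis less_irrefl power_eq_0_iff)+
  then show ?thesis
    using False by (simp add: qunit_of_def q imag_units_iff power_divide flip: add_divide_distrib)
qed (simp add: qunit_of_def)

lemma qslice_polar: "qslice (fst q) (qunit_of q) (norm (snd q)) = q"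
proof (cases "snd q = 0")
  case True
  then show ?thesis by (cases q) (simp add: qslice_def qreal_def zero_prod_def)
next
  case False
  then show ?thesis by (cases q) (simp add: qslice_def qreal_def qunit_of_def)
qed

lemma qcpx_qslice:
  assumes "J \<in> imag_units" shows "qcpx (qslice x J y) = Complex x \<bar>y\<bar>"
  using assms
proof (elim imag_unitsE)
  fix b c d assume J: "J = (0, b, c, d)" "b\<^sup>2 + c\<^sup>2 + d\<^sup>2 = 1"
  have "norm (y *\<^sub>R (b, c, d)) = \<bar>y\<bar>" using J(2) by (simp only: norm_scaleR norm_imag) simp
  then show ?thesis using J(1) by (simp add: qcpx_def qslice_def qreal_def)
qed

lemma qunit_of_qslice:
  assumes "J \<in> imag_units" "y \<noteq> 0"
  shows "qunit_of (qslice x J y) = (if y > 0 then J else - J)"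
  using assms(1)
proof (elim imag_unitsE)
  fix b c d assume J: "J = (0, b, c, d)" "b\<^sup>2 + c\<^sup>2 + d\<^sup>2 = 1"
  have "norm (y *\<^sub>R (b, c, d)) = \<bar>y\<bar>" using J(2) by (simp only: norm_scaleR norm_imag) simp
  moreover have "(b, c, d) \<noteq> 0" using J(2) by (auto simp: zero_prod_def)
  ultimately show ?thesis
    using J(1) assms(2) by (auto simp: qunit_of_def qslice_def qreal_def zero_prod_def)
qed

lemma ev_bcnj: "ev (- J) (bcnj x) = ev J x"
  by (cases J) (simp add: ev_def qre_def qim_def)

lemma ev_real: "bcnj x = x \<Longrightarrow> ev I x = ev J x"
proof -
  assume "bcnj x = x"
  then have "qim x = 0"
    by (auto simp: qim_def biquat_eq_iff complex_eq_iff zero_prod_def)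
  then show ?thesis by (cases I, cases J) (simp add: ev_def zero_prod_def)
qed

text \<open>\<open>fS\<close> reads off the representation with \<open>y \<ge> 0\<close>. For
  \<open>y < 0\<close> this replaces \<open>(J, y)\<close> by \<open>(-J, -y)\<close>, which
  symmetry compensates; for \<open>y = 0\<close> it uses \<open>qi\<close> whatever \<open>J\<close>
  is, but then \<open>\<Phi>\<close> has a value with zero \<open>qim\<close>, on which all units
  agree.\<close>

lemma fS_qslice:
  assumes "bsym \<Phi>" "J \<in> imag_units"
  shows "fS \<Phi> (qslice x J y) = ev J (\<Phi> (Complex x y))"
proof -
  have cnj: "\<Phi> (Complex x (- t)) = bcnj (\<Phi> (Complex x t))" for t
    using assms(1) unfolding bsym_def by (metis complex_cnj)
  consider "y > 0" | "y = 0" | "y < 0" by linarith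
  then show ?thesis
  proof cases
    case 1
    then show ?thesis by (simp add: fS_def qcpx_qslice qunit_of_qslice assms)
  next
    case 2
    then have "bcnj (\<Phi> (Complex x y)) = \<Phi> (Complex x y)" using cnj[of 0] by simp
    then show ?thesis
      using 2 ev_real by (simp add: fS_def qcpx_qslice assms)
  next
    case 3
    then show ?thesis
      by (simp add: fS_def qcpx_qslice qunit_of_qslice assms cnj ev_bcnj)
  qed
qed

text \<open>True for every \<open>f\<close>, since \<open>stem1\<close> and \<open>stem2\<close>
  come from the even and odd parts in \<open>Im z\<close> of \<open>f\<close> on one slice. Hence
  symmetry can be required on the whole plane.\<close>

lemma bsym_stem: "bsym (stem f)"
  unfolding bsym_def stem_def bcnj_toB
proof
  fix z
  have "stem1 f (cnj z) = stem1 f z" by (simp add: stem1_def add.commute)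
  moreover have neg: "qmul qi (c *\<^sub>R (x - y)) = - qmul qi (c *\<^sub>R (y - x))" for c x y
    by (cases x, cases y) (simp add: qi_def algebra_simps)
  have "stem2 f (cnj z) = - stem2 f z" unfolding stem2_def by (subst neg) simp
  ultimately show "toB (stem1 f (cnj z)) (stem2 f (cnj z)) = toB (stem1 f z) (- stem2 f z)" by simp
qed

lemma stem_eqI:
  assumes "f (qslice (Re z) qi (Im z)) = ev qi x" "f (qslice (Re z) qi (- Im z)) = ev qi (bcnj x)"
  shows "stem f z = x"
  unfolding stem_def
proof (rule toB_eqI)
  show "qre x = stem1 f z"
    unfolding stem1_def assms by (simp add: ev_def qre_def qim_def qi_def)
  show "qim x = stem2 f z"
    unfolding stem2_def assms by (simp add: ev_def qre_def qim_def qi_def)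
qed

lemma stem_fS:
  assumes "bsym \<Phi>" shows "stem (fS \<Phi>) = \<Phi>"
proof
  fix z
  have "Complex (Re z) (- Im z) = cnj z" by (simp add: complex_eq_iff)
  then show "stem (fS \<Phi>) z = \<Phi> z"
    using assms by (intro stem_eqI) (simp_all add: fS_qslice bsym_def)
qed

lemma qmul_unit_twice:
  assumes "J \<in> imag_units" shows "qmul J (qmul J v) = - v"
  using assms
proof (elim imag_unitsE)
  fix b c d assume J: "J = (0, b, c, d)" "b\<^sup>2 + c\<^sup>2 + d\<^sup>2 = 1"
  have "qmul J (qmul J v) = - ((b\<^sup>2 + c\<^sup>2 + d\<^sup>2) *\<^sub>R v)"
    unfolding J(1) by (cases v) (simp add: power2_eq_square algebra_simps)
  then show ?thesis using J(2) by simp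
qed

lemma qmul_linear:
  "qmul J (x + y) = qmul J x + qmul J y" "qmul J (t *\<^sub>R x) = t *\<^sub>R qmul J x"
  by (cases J, cases x, cases y, simp add: algebra_simps)+

text \<open>\<open>ev J (cB c)\<close> lies in the commutative plane spanned by 1 and
  \<open>J\<close>, so it can be moved past the \<open>J\<close> inside \<open>ev J x\<close>. This
  is why the powers of \<open>Delta\<close> and the reciprocal of the symmetrization act by
  pointwise multiplication.\<close>

lemma ev_cB_mult:
  assumes "J \<in> imag_units"
  shows "qmul (ev J (cB c)) (ev J x) = ev J (cB c * x)"
proof -
  have "qmul (ev J (cB c)) w = Re c *\<^sub>R w + Im c *\<^sub>R qmul J w" for w
    by (cases J, cases w) (simp add: ev_def qre_def qim_def algebra_simps)
  moreover have "qre (cB c * x) = Re c *\<^sub>R qre x + (- Im c) *\<^sub>R qim x"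
    "qim (cB c * x) = Re c *\<^sub>R qim x + Im c *\<^sub>R qre x"
    by (simp_all add: qre_def qim_def)
  ultimately show ?thesis
    by (simp add: ev_def qmul_linear qmul_unit_twice[OF assms] scaleR_add_right)
qed

lemma qinv_ev_cB:
  assumes "J \<in> imag_units"
  shows "qinv (ev J (cB c)) = ev J (cB (inverse c))"
  using assms
proof (elim imag_unitsE)
  fix b1 c1 d1 assume J: "J = (0, b1, c1, d1)" "b1\<^sup>2 + c1\<^sup>2 + d1\<^sup>2 = 1"
  have e: "ev J (cB a) = (Re a, b1 * Im a, c1 * Im a, d1 * Im a)" for a
    by (simp add: J(1) ev_def qre_def qim_def)
  have "(norm (ev J (cB c)))\<^sup>2 = (Re c)\<^sup>2 + (b1\<^sup>2 + c1\<^sup>2 + d1\<^sup>2) * (Im c)\<^sup>2"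
    unfolding e by (simp add: norm_Pair power_mult_distrib algebra_simps)
  then have n: "(norm (ev J (cB c)))\<^sup>2 = (Re c)\<^sup>2 + (Im c)\<^sup>2" using J(2) by simp
  show ?thesis
    unfolding qinv_def n unfolding e by (simp add: divide_inverse)
qed

lemma ssym_eq: "ssym f = fS (\<lambda>z. cB (bN (stem f z)))"
proof -
  have "bsym (\<lambda>z. bconj (stem f z))" using bsym_stem[of f] by (simp add: bsym_def)
  then show ?thesis
    by (simp add: ssym_def sprod_eq sconj_eq stem_fS bconj_mult_self)
qed

text \<open>At zeros of the symmetrization both sides are 0, by the conventions for
  \<open>qinv\<close> and \<open>binv\<close>.\<close>

lemma sinv_eq: "sinv f = fS (\<lambda>z. binv (stem f z))"
proof
  fix q
  show "sinv f q = fS (\<lambda>z. binv (stem f z)) q"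
    by (simp add: sinv_def ssym_eq sconj_eq fS_def qinv_ev_cB ev_cB_mult binv_def)
qed

lemma stem_sinv: "stem (sinv f) = (\<lambda>z. binv (stem f z))"
  unfolding sinv_eq by (rule stem_fS[OF bsym_binv[OF bsym_stem]])

lemma sprod_sinv_eq: "sprod (sinv f) g = fS (\<lambda>z. binv (stem f z) * stem g z)"
  by (simp add: sprod_eq stem_sinv)

text \<open>With \<open>e = (1 - \<i>J)/2\<close>: if \<open>A + JC = 0\<close>, then
  \<open>A + \<i>C = (\<i> - J)C\<close>, and \<open>(1 - \<i>J)(\<i> - J) = 0\<close>. One
  \<open>e\<close> serves all \<open>x\<close>.\<close>

lemma ev_idem:
  assumes "J \<in> imag_units"
  obtains e where "idem e" "\<And>x. ev J x = 0 \<Longrightarrow> e * x = 0"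
  using assms
proof (elim imag_unitsE)
  fix b c d assume J: "J = (0, b, c, d)" "b\<^sup>2 + c\<^sup>2 + d\<^sup>2 = 1"
  define e where "e = Biquat (1/2) (Complex 0 (- b / 2)) (Complex 0 (- c / 2)) (Complex 0 (- d / 2))"
  have d2: "d * (d * t) = t - b * (b * t) - c * (c * t)" for t
  proof -
    have "(b\<^sup>2 + c\<^sup>2 + d\<^sup>2) * t = t" using J(2) by simp
    then show ?thesis by (simp add: power2_eq_square algebra_simps)
  qed
  have "idem e"
    using J(2) by (simp add: idem_def e_def biquat_eq_iff complex_eq_iff power2_eq_square field_simps)
  moreover have "e * x = 0" if "ev J x = 0" for x
  proof -
    have r: "Re (b0 x) = b * Im (b1 x) + c * Im (b2 x) + d * Im (b3 x)"
      "Re (b1 x) = - (b * Im (b0 x) + c * Im (b3 x) - d * Im (b2 x))"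
      "Re (b2 x) = - (- b * Im (b3 x) + c * Im (b0 x) + d * Im (b1 x))"
      "Re (b3 x) = - (b * Im (b2 x) - c * Im (b1 x) + d * Im (b0 x))"
      using that by (auto simp: ev_def J(1) qre_def qim_def zero_prod_def algebra_simps)
    show ?thesis
      by (simp add: biquat_eq_iff biquat_mult_sel e_def complex_eq_iff r d2 field_simps)
  qed
  ultimately show thesis using that by blast
qed

text \<open>An invertible \<open>x\<close> could be cancelled from \<open>e * x = 0\<close>, leaving
  \<open>e = 0\<close>. So an invertible stem value produces no zero on its sphere.\<close>

lemma bN_eq_0_of_ev:
  assumes "J \<in> imag_units" "ev J x = 0" shows "bN x = 0"
proof (rule ccontr)
  assume "bN x \<noteq> 0"
  obtain e where e: "idem e" "e * x = 0" using ev_idem[OF assms(1)] assms(2) by metis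
  have "e = e * x * binv x" using \<open>bN x \<noteq> 0\<close> by (simp add: mult.assoc binv_right)
  then have "e = 0" using e(2) by simp
  with e(1) show False by (simp add: idem_def)
qed

text \<open>The annihilating idempotent determines the unit through
  \<open>e = (1 - \<i>J)/2\<close>, and the real part of \<open>2 * e * x\<close> is exactly
  \<open>ev J x\<close>. So a zero-free slice function has an invertible stem.\<close>

lemma ev_eq_0_of_bN:
  assumes "bN x = 0" obtains J where "J \<in> imag_units" "ev J x = 0"
proof -
  obtain e where e: "idem e" "e * x = 0" using idem_annihilating[OF assms] by blast
  define J :: quat where "J = (0, - 2 * Im (b1 e), - 2 * Im (b2 e), - 2 * Im (b3 e))"
  have re: "b0 e = 1/2" "Re (b1 e) = 0" "Re (b2 e) = 0" "Re (b3 e) = 0"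
    using e(1) by (auto simp: idem_def biquat_eq_iff complex_eq_iff)
  have "Re ((b1 e)\<^sup>2 + (b2 e)\<^sup>2 + (b3 e)\<^sup>2) = - 1/4"
    using e(1) by (simp add: idem_def)
  then have "(Im (b1 e))\<^sup>2 + (Im (b2 e))\<^sup>2 + (Im (b3 e))\<^sup>2 = 1/4"
    using re by (simp add: Re_power2)
  then have "(- 2 * Im (b1 e))\<^sup>2 + (- 2 * Im (b2 e))\<^sup>2 + (- 2 * Im (b3 e))\<^sup>2 = 1"
    by (simp add: power_mult_distrib)
  then have "J \<in> imag_units"
    unfolding imag_units_iff using J_def by blast
  moreover have "ev J x = 2 *\<^sub>R qre (e * x)"
    by (simp add: ev_def J_def qre_def qim_def biquat_mult_sel re algebra_simps)
  then have "ev J x = 0" using e(2) by (simp add: qre_def zero_prod_def)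
  ultimately show thesis using that by blast
qed

lemma ev_diff: "ev J (x - y) = ev J x - ev J y"
  by (cases J) (simp add: ev_def qre_def qim_def algebra_simps)

text \<open>Subtracting gives \<open>(I - J) * C = 0\<close> for \<open>C = qim x\<close>, and
  quaternions have no zero divisors. Two values on one sphere thus determine the stem value.\<close>

lemma ev_two_units:
  assumes "I \<noteq> J" "ev I x = 0" "ev J x = 0" shows "x = 0"
proof -
  obtain a b c d where IJ: "I - J = (a, b, c, d)" by (cases "I - J") auto
  define n where "n = a * a + b * b + c * c + d * d"
  have "n \<noteq> 0"
  proof
    assume "n = 0"
    then have "a = 0 \<and> b = 0 \<and> c = 0 \<and> d = 0"
      unfolding n_def
      using zero_le_square[of a] zero_le_square[of b] zero_le_square[of c] zero_le_square[of d]
      by (smt (verit) mult_eq_0_iff)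
    then have "I - J = 0" using IJ by (simp add: zero_prod_def)
    with assms(1) show False by simp
  qed
  obtain p q r s where im: "qim x = (p, q, r, s)" by (cases "qim x") auto
  have "qmul (I - J) (qim x) = ev I x - ev J x"
    by (cases I, cases J) (simp add: ev_def im algebra_simps)
  then have *: "qmul (a, b, c, d) (p, q, r, s) = 0" using assms IJ im by simp
  have "qmul (a, - b, - c, - d) (qmul (a, b, c, d) (p, q, r, s)) = (n * p, n * q, n * r, n * s)"
    by (simp add: n_def algebra_simps)
  then have "(n * p, n * q, n * r, n * s) = 0" unfolding * by (simp add: zero_prod_def)
  then have 0: "qim x = 0" using \<open>n \<noteq> 0\<close> im by (simp add: zero_prod_def)
  then have "qre x = 0" using assms(2) by (cases I) (simp add: ev_def zero_prod_def)
  with 0 show ?thesis using toB_eq[of x] by (simp add: qre_def qim_def zero_prod_def biquat_eq_iff complex_eq_iff)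
qed

section \<open>Spheres and their characteristic polynomials\<close>

lemma q_ev_cB: "q = ev (qunit_of q) (cB (qcpx q))"
  by (cases q) (auto simp: ev_def qre_def qim_def qunit_of_def qcpx_def qi_def zero_prod_def)

text \<open>In the plane of 1 and \<open>J\<close> containing \<open>q\<close>, the function is the
  real polynomial with roots \<open>qcpx p\<close> and its conjugate. This matches the pole
  condition of \<open>semiregular\<close> with that of \<open>mgerm\<close>.\<close>

lemma Delta_ev:
  "qpow (Delta p q) m = ev (qunit_of q) (cB (((qcpx q - qcpx p) * (qcpx q - cnj (qcpx p))) ^ m))"
proof -
  define J where "J = qunit_of q"
  define z where "z = qcpx q"
  have J: "J \<in> imag_units" by (simp add: J_def)
  have q: "q = ev J (cB z)" unfolding J_def z_def by (rule q_ev_cB)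
  have qq: "qmul q q = ev J (cB (z * z))"
    unfolding q using ev_cB_mult[OF J, of z "cB z"] by (simp add: cB_mult)
  have np: "(norm p)\<^sup>2 = (fst p)\<^sup>2 + (norm (snd p))\<^sup>2"
    by (cases p) (simp add: norm_Pair)
  have "Delta p q = ev J (cB (z * z)) - (2 * fst p) *\<^sub>R ev J (cB z) + qreal ((norm p)\<^sup>2)"
    unfolding Delta_def qq using q by simp
  also have "\<dots> = ev J (cB ((z - qcpx p) * (z - cnj (qcpx p))))"
    unfolding np by (cases J) (simp add: ev_def qre_def qim_def qreal_def qcpx_def algebra_simps power2_eq_square)
  finally have D: "Delta p q = ev J (cB ((z - qcpx p) * (z - cnj (qcpx p))))" .
  have "qpow (ev J (cB c)) m = ev J (cB (c ^ m))" for c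
  proof (induction m)
    case 0
    show ?case by (cases J) (simp add: qpow_def ev_def qre_def qim_def qreal_def)
  next
    case (Suc m)
    then show ?case using ev_cB_mult[OF J, of c "cB (c ^ m)"] by (simp add: qpow_def cB_mult)
  qed
  then show ?thesis unfolding D J_def z_def by blast
qed

lemma Delta_mult_fS:
  "qmul (qpow (Delta p q) m) (fS \<Phi> q)
    = fS (\<lambda>z. cB (((z - qcpx p) * (z - cnj (qcpx p))) ^ m) * \<Phi> z) q"
  unfolding Delta_ev fS_def by (simp add: ev_cB_mult)

lemma qsphere_iff: "q \<in> qsphere p \<longleftrightarrow> qcpx q = qcpx p"
proof
  assume "q \<in> qsphere p"
  then show "qcpx q = qcpx p" by (auto simp: qsphere_def qcpx_qslice) (simp add: qcpx_def)
next
  assume "qcpx q = qcpx p"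
  then have "fst q = fst p" "norm (snd q) = norm (snd p)" by (auto simp: qcpx_def)
  then have "q = qslice (fst p) (qunit_of q) (norm (snd p))" using qslice_polar[of q] by simp
  then show "q \<in> qsphere p" unfolding qsphere_def using qunit_of_unit by blast
qed

section \<open>Slice-regular and semiregular functions\<close>

lemma qslice_qi: "qslice (Re z) qi (Im z) = (Re z, Im z, 0, 0)"
  by (simp add: qslice_def qreal_def qi_def)

lemma open_slice_dom:
  assumes "open W" shows "open (slice_dom W)"
proof -
  have "slice_dom W = (\<lambda>z. (Re z, Im z, 0, 0)) -` W"
    by (auto simp: slice_dom_def qslice_qi)
  also have "open \<dots>"
    by (rule open_vimage[OF assms]) (intro continuous_intros)
  finally show ?thesis .
qed

lemma qslice_mem_iff:
  assumes "axsym W" "J \<in> imag_units"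
  shows "qslice x J y \<in> W \<longleftrightarrow> Complex x y \<in> slice_dom W"
  using assms(1)[unfolded axsym_def] assms(2) qi_unit unfolding slice_dom_def mem_Collect_eq complex.sel
  by blast

lemma mem_iff_qcpx: "axsym W \<Longrightarrow> q \<in> W \<longleftrightarrow> qcpx q \<in> slice_dom W"
  using qslice_mem_iff[of W "qunit_of q" "fst q" "norm (snd q)"] qslice_polar[of q]
  by (simp add: qcpx_def)

lemma qslice_uminus: "qslice x (- J) y = qslice x J (- y)"
  by (simp add: qslice_def)

lemma cnj_slice_dom:
  assumes "axsym W" "z \<in> slice_dom W" shows "cnj z \<in> slice_dom W"
proof -
  have "qslice (Re z) qi (Im z) \<in> W" using assms(2) by (simp add: slice_dom_def)
  then have "qslice (Re z) (- qi) (Im z) \<in> W"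
    using assms(1) qi_unit uminus_unit[OF qi_unit] unfolding axsym_def by blast
  then show ?thesis by (simp add: slice_dom_def qslice_uminus)
qed

lemma continuous_on_qcpx: "continuous_on UNIV qcpx"
  unfolding qcpx_def Complex_eq by (intro continuous_intros)

lemma open_qcpx_vimage: "open D \<Longrightarrow> open (qcpx -` D)"
  by (rule open_vimage[OF _ continuous_on_qcpx])

lemma axsym_qcpx_vimage: "axsym (qcpx -` D)"
  by (auto simp: axsym_def qcpx_qslice)

lemma slice_dom_qcpx_vimage:
  assumes "\<And>z. z \<in> D \<Longrightarrow> cnj z \<in> D" shows "slice_dom (qcpx -` D) = D"
proof -
  have "Complex (Re z) \<bar>Im z\<bar> \<in> D \<longleftrightarrow> z \<in> D" for z
  proof -
    have "Complex (Re z) \<bar>Im z\<bar> = z \<or> Complex (Re z) \<bar>Im z\<bar> = cnj z"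
      by (auto simp: complex_eq_iff)
    then show ?thesis using assms[of z] assms[of "cnj z"] by auto
  qed
  then show ?thesis by (auto simp: slice_dom_def qcpx_qslice)
qed

text \<open>The definition only asserts that some stem pair exists; evaluating on the slice of
  \<open>qi\<close> shows that on \<open>slice_dom W\<close> it is \<open>stem h\<close>, which
  therefore inherits holomorphy.\<close>

lemma slice_regularD:
  assumes "slice_regular W h"
  shows "open W" "axsym W" "\<And>z. z \<in> slice_dom W \<Longrightarrow> bana (stem h) z"
    "\<And>q. q \<in> W \<Longrightarrow> h q = fS (stem h) q"
proof -
  show W: "open W" "axsym W" using assms by (auto simp: slice_regular_def)
  obtain F1 F2 where F: "\<And>z. z \<in> slice_dom W \<Longrightarrow> F1 (cnj z) = F1 z \<and> F2 (cnj z) = - F2 z"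
    and hol: "stem_holo (slice_dom W) F1 F2"
    and h: "\<And>x y J. J \<in> imag_units \<Longrightarrow> qslice x J y \<in> W \<Longrightarrow>
      h (qslice x J y) = F1 (Complex x y) + qmul J (F2 (Complex x y))"
    using assms unfolding slice_regular_def by blast
  define \<Phi> where "\<Phi> = (\<lambda>z. toB (F1 z) (F2 z))"
  have h': "h (qslice x J y) = ev J (\<Phi> (Complex x y))" if "J \<in> imag_units" "Complex x y \<in> slice_dom W" for x y J
    using h[OF that(1)] that W(2) by (simp add: qslice_mem_iff ev_def \<Phi>_def)
  have stem: "stem h z = \<Phi> z" if z: "z \<in> slice_dom W" for z
  proof (rule stem_eqI)
    show "h (qslice (Re z) qi (Im z)) = ev qi (\<Phi> z)"
      using h'[OF qi_unit, of "Re z" "Im z"] z by simp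
    have "Complex (Re z) (- Im z) = cnj z" by (simp add: complex_eq_iff)
    moreover have "\<Phi> (cnj z) = bcnj (\<Phi> z)" using F[OF z] by (simp add: \<Phi>_def bcnj_toB)
    ultimately show "h (qslice (Re z) qi (- Im z)) = ev qi (bcnj (\<Phi> z))"
      using h'[OF qi_unit, of "Re z" "- Im z"] cnj_slice_dom[OF W(2) z] by simp
  qed
  show "bana (stem h) z" if z: "z \<in> slice_dom W" for z
  proof (rule bana_cong)
    have "(\<lambda>z. Complex (qcomp k (F1 z)) (qcomp k (F2 z))) analytic_on {z}" if "k < 4" for k
      using hol that z open_slice_dom[OF W(1)] unfolding stem_holo_def analytic_at by blast
    from this[of 0] this[of 1] this[of 2] this[of 3] show "bana \<Phi> z"
      by (simp add: bana_def \<Phi>_def toB_def)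
    show "eventually (\<lambda>w. \<Phi> w = stem h w) (nhds z)"
      using eventually_nhds_in_open[OF open_slice_dom[OF W(1)] z]
      by eventually_elim (simp add: stem)
  qed
  show "h q = fS (stem h) q" if "q \<in> W" for q
  proof -
    have z: "qcpx q \<in> slice_dom W" using that mem_iff_qcpx[OF W(2)] by blast
    have "h (qslice (fst q) (qunit_of q) (norm (snd q))) = ev (qunit_of q) (\<Phi> (qcpx q))"
      using h'[OF qunit_of_unit, of "fst q" "norm (snd q)"] z by (simp add: qcpx_def)
    then show ?thesis by (simp add: qslice_polar fS_def stem[OF z])
  qed
qed

lemma slice_regularI:
  assumes W: "open W" "axsym W" and \<Phi>: "bsym \<Phi>" "\<And>z. z \<in> slice_dom W \<Longrightarrow> bana \<Phi> z"
  shows "slice_regular W (fS \<Phi>)"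
proof -
  have hol: "f holomorphic_on slice_dom W" if "\<And>z. z \<in> slice_dom W \<Longrightarrow> f analytic_on {z}" for f
    using that by (meson analytic_imp_holomorphic analytic_on_analytic_at)
  have "(\<lambda>w. b0 (\<Phi> w)) holomorphic_on slice_dom W" "(\<lambda>w. b1 (\<Phi> w)) holomorphic_on slice_dom W"
    "(\<lambda>w. b2 (\<Phi> w)) holomorphic_on slice_dom W" "(\<lambda>w. b3 (\<Phi> w)) holomorphic_on slice_dom W"
    using \<Phi>(2) by (auto intro!: hol simp: bana_def)
  moreover have "k = 0 \<or> k = 1 \<or> k = 2 \<or> k = 3" if "k < 4" for k :: nat using that by linarith
  ultimately have "stem_holo (slice_dom W) (\<lambda>z. qre (\<Phi> z)) (\<lambda>z. qim (\<Phi> z))"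
    unfolding stem_holo_def by (fastforce simp: qre_def qim_def)
  moreover have "qre (\<Phi> (cnj z)) = qre (\<Phi> z)" "qim (\<Phi> (cnj z)) = - qim (\<Phi> z)" for z
    using \<Phi>(1) by (auto simp: bsym_def qre_def qim_def)
  moreover have "fS \<Phi> (qslice x J y) = qre (\<Phi> (Complex x y)) + qmul J (qim (\<Phi> (Complex x y)))"
    if "J \<in> imag_units" for x y J
    using that by (simp add: fS_qslice \<Phi>(1) ev_def)
  ultimately show ?thesis
    unfolding slice_regular_def using W
    by (intro conjI exI[of _ "\<lambda>z. qre (\<Phi> z)"] exI[of _ "\<lambda>z. qim (\<Phi> z)"]) simp_all
qed

lemma stem_cong:
  assumes "f (qslice (Re z) qi (Im z)) = g (qslice (Re z) qi (Im z))"
    "f (qslice (Re z) qi (- Im z)) = g (qslice (Re z) qi (- Im z))"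
  shows "stem f z = stem g z"
  using assms by (simp add: stem_def stem1_def stem2_def)

text \<open>The stem of the extension across the sphere is compared with that of \<open>f\<close>
  times the power of \<open>Delta\<close>. The polynomial is unchanged when \<open>z\<close> and
  \<open>cnj z\<close> are exchanged, so it does not matter which of them is
  \<open>qcpx p\<close>.\<close>

lemma semiregular_germ:
  assumes f: "semiregular U f" and z: "z \<in> slice_dom U"
  obtains m g where "bana g z"
    "eventually (\<lambda>w. g w = cB (((w - z) * (w - cnj z)) ^ m) * stem f w) (at z)"
proof -
  obtain U' where U': "U' \<subseteq> U" "slice_regular U' f"
    "\<And>p. p \<in> U - U' \<Longrightarrow> \<exists>W m g. p \<in> W \<and> W \<subseteq> U \<and> W - qsphere p \<subseteq> U' \<and>
      slice_regular W g \<and> (\<forall>q\<in>W - qsphere p. g q = qmul (qpow (Delta p q) m) (f q))"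
    using f unfolding semiregular_def by blast
  define p where "p = qslice (Re z) qi (Im z)"
  have p: "p \<in> U" using z by (simp add: p_def slice_dom_def)
  show thesis
  proof (cases "p \<in> U'")
    case True
    then have "bana (stem f) z"
      using slice_regularD(3)[OF U'(2)] by (simp add: p_def slice_dom_def)
    then show thesis using that[of "stem f" 0] by simp
  next
    case False
    then obtain W m g where W: "p \<in> W" "W - qsphere p \<subseteq> U'" "slice_regular W g"
      "\<And>q. q \<in> W - qsphere p \<Longrightarrow> g q = qmul (qpow (Delta p q) m) (f q)"
      using U'(3)[of p] p by blast
    note Wr = slice_regularD[OF W(3)]
    have zW: "z \<in> slice_dom W" using W(1) by (simp add: p_def slice_dom_def)
    define \<Theta> where "\<Theta> = (\<lambda>w. cB (((w - qcpx p) * (w - cnj (qcpx p))) ^ m) * stem f w)"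
    have sym: "bsym \<Theta>"
      using bsym_stem[of f] by (simp add: \<Theta>_def bsym_def mult.commute)
    have g: "g q = fS \<Theta> q" if "q \<in> W - qsphere p" for q
      using that W(2,4) slice_regularD(4)[OF U'(2)] Delta_mult_fS[of p q m "stem f"]
      unfolding \<Theta>_def by (metis subsetD)
    have pz: "qcpx p = z \<or> qcpx p = cnj z"
      by (auto simp: p_def qcpx_qslice complex_eq_iff)
    have "stem g w = cB (((w - z) * (w - cnj z)) ^ m) * stem f w"
      if w: "w \<in> slice_dom W" "w \<noteq> z" "w \<noteq> cnj z" for w
    proof -
      have notp: "Complex (Re w) \<bar>Im w\<bar> \<noteq> qcpx p"
        using pz w(2,3) by (auto simp: complex_eq_iff abs_if split: if_splits)
      have "cnj w \<in> slice_dom W" by (rule cnj_slice_dom[OF Wr(2) w(1)])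
      then have "qslice (Re w) qi (Im w) \<in> W - qsphere p" "qslice (Re w) qi (- Im w) \<in> W - qsphere p"
        using w(1) notp by (auto simp: slice_dom_def qsphere_iff qcpx_qslice)
      then have "stem g w = stem (fS \<Theta>) w"
        by (intro stem_cong g)
      also have "\<dots> = cB (((w - z) * (w - cnj z)) ^ m) * stem f w"
        unfolding stem_fS[OF sym] unfolding \<Theta>_def using pz by (auto simp: mult.commute)
      finally show ?thesis .
    qed
    moreover have "eventually (\<lambda>w. w \<in> slice_dom W \<and> w \<noteq> z \<and> w \<noteq> cnj z) (at z)"
      using eventually_at_open[OF open_slice_dom[OF Wr(1)] zW] eventually_at_neq2[of z "cnj z"]
      by eventually_elim simp
    ultimately have "eventually (\<lambda>w. stem g w = cB (((w - z) * (w - cnj z)) ^ m) * stem f w) (at z)"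
      by (auto elim: eventually_mono)
    then show thesis using that[of "stem g" m] Wr(3)[OF zW] by blast
  qed
qed

lemma analytic_order:
  fixes f :: "complex \<Rightarrow> complex"
  assumes "f analytic_on {z}" "\<not> eventually (\<lambda>w. f w = 0) (at z)"
  obtains n e where "e analytic_on {z}" "e z \<noteq> 0" "eventually (\<lambda>w. f w = (w - z) ^ n * e w) (at z)"
proof -
  obtain r where r: "r > 0" "f holomorphic_on ball z r"
    using assms(1) unfolding analytic_on_def by auto
  have "\<exists>w\<in>ball z r. f w \<noteq> 0"
  proof (rule ccontr)
    assume "\<not> (\<exists>w\<in>ball z r. f w \<noteq> 0)"
    moreover have "eventually (\<lambda>w. w \<in> ball z r) (at z)" by (rule eventually_at_open) (use r in auto)
    ultimately have "eventually (\<lambda>w. f w = 0) (at z)" by (auto elim: eventually_mono)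
    with assms(2) show False by blast
  qed
  then obtain s where s: "s > 0" "zor_poly f z holomorphic_on cball z s"
    "\<And>w. w \<in> cball z s \<Longrightarrow> f w = zor_poly f z w * (w - z) ^ nat (zorder f z) \<and> zor_poly f z w \<noteq> 0"
    using zorder_exist_zero[of f "ball z r" z] r by (auto split: if_splits)
  show thesis
  proof (rule that)
    show "zor_poly f z analytic_on {z}"
      unfolding analytic_on_def using s(1,2) holomorphic_on_subset[OF s(2) ball_subset_cball] by auto
    show "zor_poly f z z \<noteq> 0" using s by auto
    have "eventually (\<lambda>w. w \<in> ball z s) (at z)" by (rule eventually_at_open) (use s in auto)
    then show "eventually (\<lambda>w. f w = (w - z) ^ nat (zorder f z) * zor_poly f z w) (at z)"
      by eventually_elim (use s(3) in auto)
  qed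
qed

lemma at_eventually_nhds:
  fixes z :: complex
  assumes "eventually P (at z)" shows "eventually (\<lambda>w. eventually P (nhds w)) (at z)"
proof -
  obtain S where S: "open S" "z \<in> S" "\<And>w. w \<in> S \<Longrightarrow> w \<noteq> z \<Longrightarrow> P w"
    using assms unfolding eventually_at_topological by blast
  have "eventually P (nhds w)" if "w \<in> S" "w \<noteq> z" for w
    unfolding eventually_nhds using S that by (intro exI[of _ "S - {z}"]) auto
  then show ?thesis
    unfolding eventually_at_topological using S(1,2) by blast
qed

text \<open>Close to \<open>z\<close> but off it, the clearing polynomial and the norm
  \<open>(w - z)^n * e w\<close> are nonzero. This is the discreteness of the support of a
  divisor.\<close>

lemma mgerm_eventually_unit:
  assumes "mgerm z G" shows "eventually (\<lambda>w. unit_at w G) (at z)"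
proof -
  obtain m n g e where g: "bana g z" and e: "e analytic_on {z}" "e z \<noteq> 0"
    and gG: "eventually (\<lambda>w. g w = cB (((w - z) * (w - cnj z)) ^ m) * G w \<and> bN (g w) = (w - z) ^ n * e w) (at z)"
    using assms unfolding mgerm_def by blast
  have e_ev: "eventually (\<lambda>w. e w \<noteq> 0) (at z)"
    by (rule eventually_at_of_nhds[OF eventually_analytic_nonzero[OF e]])
  have g_ev: "eventually (\<lambda>w. bana g w) (at z)"
    by (rule eventually_at_of_nhds[OF bana_eventually[OF g]])
  define c where "c = (\<lambda>w. ((w - z) * (w - cnj z)) ^ m)"
  have "eventually (\<lambda>w. cB (inverse (c w)) * g w = G w) (at z)"
    using gG eventually_at_neq2[of z "cnj z"]
  proof eventually_elim
    case (elim w)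
    then have "c w \<noteq> 0" "g w = cB (c w) * G w" by (auto simp: c_def)
    then show ?case by (simp flip: mult.assoc cB_mult)
  qed
  from e_ev g_ev at_eventually_nhds[OF this] gG eventually_at_neq2[of z "cnj z"] show ?thesis
  proof eventually_elim
    case (elim w)
    then have c: "c w \<noteq> 0" "g w = cB (c w) * G w" by (auto simp: c_def)
    have "bana (\<lambda>w. cB (inverse (c w)) * g w) w"
      using c(1) elim(2) unfolding c_def
      by (intro bana_mult bana_cB analytic_on_inverse) (auto intro!: analytic_intros)
    then have "bana G w" using elim(3) by (rule bana_cong)
    moreover have "bN (g w) \<noteq> 0" using elim by auto
    then have "bN (G w) \<noteq> 0" unfolding c(2) by auto
    ultimately show ?case by (simp add: unit_at_def)
  qed
qed

text \<open>Each new value is forced by continuity of the local representative, and its uniqueness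
  makes the choice commute with conjugation; outside the symmetrized set the value is 0. The
  extension serves both to clear a pole and to produce the zero-free function required by
  \<open>SR_star\<close>.\<close>

lemma bsym_extension:
  assumes \<Theta>: "bsym \<Theta>" and B: "open B" "\<And>z. z \<in> B \<Longrightarrow> \<exists>g. bana g z \<and> eventually (\<lambda>w. \<Theta> w = g w) (at z)"
  obtains \<Theta>' where "bsym \<Theta>'"
    "\<And>z. z \<in> B \<or> cnj z \<in> B \<Longrightarrow> bana \<Theta>' z"
    "\<And>z g. z \<in> B \<or> cnj z \<in> B \<Longrightarrow> bana g z \<Longrightarrow> eventually (\<lambda>w. \<Theta> w = g w) (at z) \<Longrightarrow>
      \<Theta>' z = g z \<and> eventually (\<lambda>w. \<Theta>' w = \<Theta> w) (at z)"
proof -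
  define N where "N = B \<union> cnj -` B"
  have N: "open N"
    unfolding N_def by (intro open_Un B(1) open_vimage[OF B(1)] continuous_intros)
  have N_cnj: "cnj z \<in> N \<longleftrightarrow> z \<in> N" for z by (auto simp: N_def)
  define ext where "ext = (\<lambda>z v. \<exists>g. bana g z \<and> eventually (\<lambda>w. \<Theta> w = g w) (at z) \<and> v = g z)"
  have ext_unique: "v = v'" if v: "ext z v" "ext z v'" for z v v'
  proof -
    obtain g g' where g: "bana g z" "eventually (\<lambda>w. \<Theta> w = g w) (at z)" "v = g z"
      and g': "bana g' z" "eventually (\<lambda>w. \<Theta> w = g' w) (at z)" "v' = g' z"
      using v unfolding ext_def by blast
    have "eventually (\<lambda>w. g w = g' w) (at z)" using g(2) g'(2) by eventually_elim simp
    then show ?thesis using bana_eq_at[OF g(1) g'(1)] g(3) g'(3) by simp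
  qed
  have ext_cnj: "ext (cnj z) (bcnj v)" if v: "ext z v" for z v
  proof -
    obtain g where g: "bana g z" "eventually (\<lambda>w. \<Theta> w = g w) (at z)" "v = g z"
      using v unfolding ext_def by blast
    have "eventually (\<lambda>w. \<Theta> w = bcnj (g (cnj w))) (at (cnj z))"
      using eventually_at_cnj[OF g(2)]
    proof eventually_elim
      case (elim w)
      have "\<Theta> w = bcnj (\<Theta> (cnj w))" using \<Theta> by (simp add: bsym_def)
      then show ?case using elim by simp
    qed
    then show ?thesis
      unfolding ext_def using bana_cnj[OF g(1)] g(3) by (intro exI[of _ "\<lambda>w. bcnj (g (cnj w))"]) simp
  qed
  have ext_ex: "\<exists>v. ext z v" if "z \<in> N" for z
  proof (cases "z \<in> B")
    case True
    then show ?thesis using B(2) unfolding ext_def by blast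
  next
    case False
    then have "\<exists>v. ext (cnj z) v" using that B(2)[of "cnj z"] unfolding ext_def N_def by blast
    then show ?thesis using ext_cnj[of "cnj z"] by auto
  qed
  define \<Theta>' where "\<Theta>' = (\<lambda>z. if z \<in> N then THE v. ext z v else 0)"
  have \<Theta>'_eq: "\<Theta>' z = v" if "z \<in> N" "ext z v" for z v
    unfolding \<Theta>'_def using that ext_unique by (auto intro!: the_equality)
  have near: "eventually (\<lambda>w. \<Theta>' w = g w) (nhds z)"
    if "z \<in> N" "bana g z" "eventually (\<lambda>w. \<Theta> w = g w) (at z)" for z g
  proof (rule eventually_nhds_of_at)
    show "\<Theta>' z = g z" using that by (intro \<Theta>'_eq) (auto simp: ext_def)
    show "eventually (\<lambda>w. \<Theta>' w = g w) (at z)"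
      using eventually_at_open[OF N that(1)] eventually_at_of_nhds[OF bana_eventually[OF that(2)]]
        at_eventually_nhds[OF that(3)]
    proof eventually_elim
      case (elim w)
      \<comment> \<open>The same \<open>g\<close> is a local representative at all nearby points, so
        the extension agrees with it on a full neighbourhood and not only at
        \<open>z\<close>.\<close>
      then have "ext w (g w)" unfolding ext_def using eventually_at_of_nhds by blast
      then show ?case using elim(1) \<Theta>'_eq by blast
    qed
  qed
  show thesis
  proof (rule that)
    show "bsym \<Theta>'"
      unfolding bsym_def
    proof
      fix z
      show "\<Theta>' (cnj z) = bcnj (\<Theta>' z)"
      proof (cases "z \<in> N")
        case True
        then obtain v where "ext z v" using ext_ex by blast
        then show ?thesis using \<Theta>'_eq ext_cnj True N_cnj by metis
      qed (simp add: \<Theta>'_def N_cnj)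
    qed
    show "bana \<Theta>' z" if "z \<in> B \<or> cnj z \<in> B" for z
    proof -
      have z: "z \<in> N" using that by (auto simp: N_def)
      then obtain g where g: "bana g z" "eventually (\<lambda>w. \<Theta> w = g w) (at z)"
        using ext_ex unfolding ext_def by blast
      have "eventually (\<lambda>w. g w = \<Theta>' w) (nhds z)"
        using near[OF z g] by eventually_elim simp
      then show ?thesis by (rule bana_cong[OF g(1)])
    qed
    show "\<Theta>' z = g z \<and> eventually (\<lambda>w. \<Theta>' w = \<Theta> w) (at z)"
      if "z \<in> B \<or> cnj z \<in> B" "bana g z" "eventually (\<lambda>w. \<Theta> w = g w) (at z)" for z g
    proof
      have "z \<in> N" using that(1) by (auto simp: N_def)
      note n = near[OF this that(2,3)]
      show "\<Theta>' z = g z" by (rule eventually_nhds_x_imp_x[OF n])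
      show "eventually (\<lambda>w. \<Theta>' w = \<Theta> w) (at z)"
        using eventually_at_of_nhds[OF n] that(3) by eventually_elim simp
    qed
  qed
qed

section \<open>Agreement of slice functions on dense open sets\<close>

lemma imag_unit_islimpt:
  assumes "J \<in> imag_units" "open V" "qslice x J y \<in> V"
  obtains I where "I \<in> imag_units" "I \<noteq> J" "qslice x I y \<in> V"
proof -
  obtain b c d where J: "J = (0, b, c, d)" "b\<^sup>2 + c\<^sup>2 + d\<^sup>2 = 1"
    using assms(1) by (rule imag_unitsE)
  define S where "S = sphere (0 :: real \<times> real \<times> real) 1"
  have S: "(p, q, r) \<in> S \<longleftrightarrow> (0, p, q, r) \<in> imag_units" for p q r
    by (simp add: S_def imag_units_iff norm_imag)
  have "connected S"
    unfolding S_def by (rule connected_sphere) simp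
  moreover have bS: "(b, c, d) \<in> S" using S J assms(1) by simp
  moreover have "S \<noteq> {(b, c, d)}"
  proof
    assume eq: "S = {(b, c, d)}"
    have "(- b, - c, - d) \<in> S" using J by (simp add: S imag_units_iff)
    then have "b = 0" "c = 0" "d = 0" using eq by auto
    with J(2) show False by simp
  qed
  ultimately have "(b, c, d) islimpt S"
    using connected_imp_perfect by blast
  moreover define V' where "V' = (\<lambda>v. qslice x (0, v) y) -` V"
  have "open V'"
    unfolding V'_def qslice_def by (rule open_vimage[OF assms(2)]) (intro continuous_intros)
  moreover have "(b, c, d) \<in> V'" using assms(3) J(1) by (simp add: V'_def)
  ultimately obtain v where "v \<in> S" "v \<in> V'" "v \<noteq> (b, c, d)"
    unfolding islimpt_def by blast
  then show thesis
    using that[of "(0, v)"] J(1) S by (cases v) (auto simp: V'_def)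
qed

text \<open>A dense open set meets the spheres over \<open>O'\<close> in a point around which it
  contains a second point of the same sphere, as the sphere of units has no isolated point; two
  values determine the stem there.\<close>

lemma smr_agree_stem:
  assumes W: "axsym W" and agree: "smr_agree W h f"
    and h: "\<And>q. q \<in> W \<Longrightarrow> h q = fS \<Phi> q" and f: "\<And>q. q \<in> W \<Longrightarrow> f q = fS \<Psi> q"
    and sym: "bsym \<Phi>" "bsym \<Psi>" and O: "open O'" "O' \<subseteq> slice_dom W" "O' \<noteq> {}"
  obtains z where "z \<in> O'" "\<Phi> z = \<Psi> z"
proof -
  obtain W' where W': "open W'" "W' \<subseteq> W" "W \<subseteq> closure W'" "\<And>q. q \<in> W' \<Longrightarrow> h q = f q"
    using agree unfolding smr_agree_def by blast
  obtain z0 where z0: "z0 \<in> O'" "Im z0 \<noteq> 0"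
  proof -
    obtain z1 where z1: "z1 \<in> O'" using O(3) by blast
    obtain r where r: "r > 0" "ball z1 r \<subseteq> O'" using O(1) z1 open_contains_ball by blast
    show thesis
    proof (cases "Im z1 = 0")
      case True
      have "dist z1 (z1 + \<i> * of_real (r / 2)) < r"
        using r(1) by (simp add: dist_norm norm_mult)
      then have "z1 + \<i> * of_real (r / 2) \<in> O'" using r(2) by auto
      then show thesis using that True r(1) by auto
    qed (use that z1 in auto)
  qed
  \<comment> \<open>\<open>qcpx\<close> takes values in the closed upper half-plane only, so
    \<open>O'\<close> is symmetrized; the point found may be the conjugate of one in
    \<open>O'\<close>, and symmetry brings it back.\<close>
  define N where "N = (O' \<union> cnj -` O') \<inter> {z. Im z \<noteq> 0}"
  have "open N"
    unfolding N_def
    by (intro open_Int open_Un O(1) open_vimage[OF O(1)] open_Collect_neq continuous_intros)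
  then have V: "open (qcpx -` N)" by (rule open_qcpx_vimage)
  define q0 where "q0 = qslice (Re z0) qi (Im z0)"
  have "qcpx q0 = z0 \<or> qcpx q0 = cnj z0"
    by (auto simp: q0_def qcpx_qslice complex_eq_iff)
  then have "q0 \<in> qcpx -` N" using z0 by (auto simp: N_def)
  moreover have "q0 \<in> closure W'"
    using z0(1) O(2) W'(3) by (auto simp: q0_def slice_dom_def)
  ultimately obtain q where q: "q \<in> W'" "q \<in> qcpx -` N"
    using V open_Int_closure_eq_empty[of "qcpx -` N" W'] by blast
  define z where "z = qcpx q"
  define J where "J = qunit_of q"
  have z: "Im z > 0"
    using q(2) by (auto simp: N_def z_def qcpx_def)
  have qq: "q = qslice (Re z) J (Im z)"
    unfolding z_def J_def using qslice_polar[of q] by (simp add: qcpx_def)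
  have J: "J \<in> imag_units" by (simp add: J_def)
  obtain I where I: "I \<in> imag_units" "I \<noteq> J" "qslice (Re z) I (Im z) \<in> W'"
    using imag_unit_islimpt[OF J W'(1)] q(1) unfolding qq by blast
  have zero: "ev K (\<Phi> z - \<Psi> z) = 0" if K: "K \<in> imag_units" "qslice (Re z) K (Im z) \<in> W'" for K
  proof -
    have "qslice (Re z) K (Im z) \<in> W" using K(2) W'(2) by blast
    then have "fS \<Phi> (qslice (Re z) K (Im z)) = fS \<Psi> (qslice (Re z) K (Im z))"
      using W'(4)[OF K(2)] h f by simp
    then show ?thesis by (simp add: fS_qslice sym K(1) ev_diff)
  qed
  have "\<Phi> z - \<Psi> z = 0"
    using ev_two_units[OF I(2) zero[OF I(1,3)] zero[OF J]] q(1) qq by simp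
  then have eq: "\<Phi> z = \<Psi> z" by simp
  then have "\<Phi> (cnj z) = \<Psi> (cnj z)" using sym by (simp add: bsym_def)
  moreover have "z \<in> O' \<or> cnj z \<in> O'" using q(2) by (auto simp: N_def z_def)
  ultimately show thesis using that eq by blast
qed

section \<open>Divisors are principal\<close>

lemma eventually_at_open_set:
  fixes z :: complex
  assumes "eventually P (at z)"
  obtains O' where "open O'" "O' \<noteq> {}" "\<And>w. w \<in> O' \<Longrightarrow> P w"
proof -
  obtain S where S: "open S" "z \<in> S" "\<And>w. w \<in> S \<Longrightarrow> w \<noteq> z \<Longrightarrow> P w"
    using assms unfolding eventually_at_topological by blast
  have "S \<noteq> {z}" using S(1) not_open_singleton by blast
  then have "S - {z} \<noteq> {}" using S(2) by blast
  moreover have "open (S - {z})" using S(1) by auto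
  ultimately show thesis using that[of "S - {z}"] S(3) by blast
qed

lemma bana_neq:
  assumes "bana F w" "bana G w" "F w \<noteq> G w"
  shows "eventually (\<lambda>x. F x \<noteq> G x) (nhds w)"
proof -
  have *: "eventually (\<lambda>x. F x \<noteq> G x) (nhds w)"
    if "(\<lambda>x. c (F x)) analytic_on {w}" "(\<lambda>x. c (G x)) analytic_on {w}" "c (F w) \<noteq> c (G w)"
    for c :: "biquat \<Rightarrow> complex"
  proof -
    have "eventually (\<lambda>x. c (F x) - c (G x) \<noteq> 0) (nhds w)"
      by (rule eventually_analytic_nonzero) (use that in \<open>auto intro!: analytic_intros\<close>)
    then show ?thesis by eventually_elim auto
  qed
  from assms(3) consider "b0 (F w) \<noteq> b0 (G w)" | "b1 (F w) \<noteq> b1 (G w)" |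
    "b2 (F w) \<noteq> b2 (G w)" | "b3 (F w) \<noteq> b3 (G w)"
    by (auto simp: biquat_eq_iff)
  then show ?thesis
    by cases (use *[of b0] *[of b1] *[of b2] *[of b3] assms(1,2) in \<open>simp_all add: bana_def\<close>)
qed

text \<open>If the norm vanished identically near \<open>z\<close>, then \<open>binv\<close> would
  be 0 on an open set, and the zero-free \<open>h\<close> representing
  \<open>sprod (sinv f) f\<close> would have a stem that vanishes at some point there.\<close>

lemma mgerm_of_semiregular:
  assumes f: "semiregular U f" and star: "SR_star U (sprod (sinv f) f)" and z: "z \<in> slice_dom U"
  shows "mgerm z (stem f)"
proof -
  obtain m g where g: "bana g z"
    "eventually (\<lambda>w. g w = cB (((w - z) * (w - cnj z)) ^ m) * stem f w) (at z)"
    using semiregular_germ[OF f z] by blast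
  obtain h where h: "slice_regular U h" "\<And>q. q \<in> U \<Longrightarrow> h q \<noteq> 0" "smr_agree U h (sprod (sinv f) f)"
    using star unfolding SR_star_def by blast
  note hr = slice_regularD[OF h(1)]
  have "\<not> eventually (\<lambda>w. bN (g w) = 0) (at z)"
  proof
    assume "eventually (\<lambda>w. bN (g w) = 0) (at z)"
    then have "eventually (\<lambda>w. bN (stem f w) = 0 \<and> w \<in> slice_dom U) (at z)"
      using g(2) eventually_at_neq2[of z "cnj z"] eventually_at_open[OF open_slice_dom[OF hr(1)] z]
      by eventually_elim auto
    then obtain O' where O: "open O'" "O' \<noteq> {}" "\<And>w. w \<in> O' \<Longrightarrow> bN (stem f w) = 0 \<and> w \<in> slice_dom U"
      by (rule eventually_at_open_set) blast
    obtain w where w: "w \<in> O'" "stem h w = binv (stem f w) * stem f w"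
      by (rule smr_agree_stem[OF hr(2) h(3) hr(4), of "\<lambda>w. binv (stem f w) * stem f w" O'])
        (use O in \<open>auto simp: sprod_sinv_eq intro!: bsym_stem bsym_mult bsym_binv\<close>)
    have "stem h w = 0" using w O(3) by (simp add: binv_def)
    moreover have "qslice (Re w) qi (Im w) \<in> U" using O(3)[OF w(1)] by (simp add: slice_dom_def)
    then have "h (qslice (Re w) qi (Im w)) = fS (stem h) (qslice (Re w) qi (Im w))"
      "h (qslice (Re w) qi (Im w)) \<noteq> 0"
      using hr(4) h(2) by blast+
    then have "ev qi (stem h w) \<noteq> 0"
      using fS_qslice[OF bsym_stem qi_unit, of h "Re w" "Im w"] by simp
    ultimately show False by (simp add: ev_def qre_def qim_def qi_def zero_prod_def)
  qed
  then obtain n e where e: "e analytic_on {z}" "e z \<noteq> 0" "eventually (\<lambda>w. bN (g w) = (w - z) ^ n * e w) (at z)"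
    by (rule analytic_order[OF analytic_bN[OF g(1)]])
  show ?thesis
    unfolding mgerm_def using g e eventually_conj[OF g(2) e(3)] by blast
qed

text \<open>The zero-free \<open>h\<close> has an invertible stem. Near \<open>z\<close> but off it,
  both \<open>stem h\<close> and the quotient are holomorphic, so a difference at one point would
  persist on an open set, against agreement on a dense one.\<close>

lemma eqv_of_SR_star:
  assumes star: "SR_star W (sprod (sinv f) g)" and z: "z \<in> slice_dom W"
    and mf: "mgerm z (stem f)" and mg: "mgerm z (stem g)"
  shows "eqv z (stem g) (stem f)"
proof -
  obtain h where h: "slice_regular W h" "\<And>q. q \<in> W \<Longrightarrow> h q \<noteq> 0" "smr_agree W h (sprod (sinv f) g)"
    using star unfolding SR_star_def by blast
  note hr = slice_regularD[OF h(1)]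
  have "bN (stem h z) \<noteq> 0"
  proof
    assume "bN (stem h z) = 0"
    then obtain J where J: "J \<in> imag_units" "ev J (stem h z) = 0" by (rule ev_eq_0_of_bN)
    have inW: "qslice (Re z) J (Im z) \<in> W" using qslice_mem_iff[OF hr(2) J(1)] z by simp
    have "h (qslice (Re z) J (Im z)) = ev J (stem h z)"
      using hr(4)[OF inW] fS_qslice[OF bsym_stem J(1), of h "Re z" "Im z"] by simp
    then show False using h(2)[OF inW] J(2) by simp
  qed
  then have u: "unit_at z (stem h)" using hr(3)[OF z] by (simp add: unit_at_def)
  have "eventually (\<lambda>w. stem g w = stem f w * stem h w) (at z)"
    using eventually_at_open[OF open_slice_dom[OF hr(1)] z] mgerm_eventually_unit[OF mf] mgerm_eventually_unit[OF mg]
  proof eventually_elim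
    case (elim w)
    have v: "bana (\<lambda>w. binv (stem f w) * stem g w) w"
      using elim(2,3) by (simp add: unit_at_def bana_mult bana_binv)
    have "stem h w = binv (stem f w) * stem g w"
    proof (rule ccontr)
      assume "stem h w \<noteq> binv (stem f w) * stem g w"
      then have "eventually (\<lambda>x. stem h x \<noteq> binv (stem f x) * stem g x) (nhds w)"
        by (rule bana_neq[OF hr(3)[OF elim(1)] v])
      then obtain S where S: "open S" "w \<in> S" "\<And>x. x \<in> S \<Longrightarrow> stem h x \<noteq> binv (stem f x) * stem g x"
        unfolding eventually_nhds by blast
      obtain x where "x \<in> S \<inter> slice_dom W" "stem h x = binv (stem f x) * stem g x"
        by (rule smr_agree_stem[OF hr(2) h(3) hr(4), of "\<lambda>w. binv (stem f w) * stem g w" "S \<inter> slice_dom W"])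
          (use S elim(1) open_slice_dom[OF hr(1)] in \<open>auto simp: sprod_sinv_eq intro!: bsym_stem bsym_mult bsym_binv\<close>)
      then show False using S(3) by blast
    qed
    then show ?case using elim(2) by (simp add: unit_at_def binv_cancel_right)
  qed
  then show ?thesis unfolding eqv_def using u by blast
qed

lemma mgerm_eqv:
  assumes "mgerm z G" "eqv z F G" shows "mgerm z F"
proof -
  obtain m n g e where g: "bana g z" and e: "e analytic_on {z}" "e z \<noteq> 0"
    and gG: "eventually (\<lambda>w. g w = cB (((w - z) * (w - cnj z)) ^ m) * G w \<and> bN (g w) = (w - z) ^ n * e w) (at z)"
    using assms(1) unfolding mgerm_def by blast
  obtain u where u: "bana u z" "bN (u z) \<noteq> 0" "eventually (\<lambda>w. F w = G w * u w) (at z)"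
    using assms(2) unfolding eqv_def unit_at_def by blast
  have "eventually (\<lambda>w. g w * u w = cB (((w - z) * (w - cnj z)) ^ m) * F w
      \<and> bN (g w * u w) = (w - z) ^ n * (e w * bN (u w))) (at z)"
    using gG u(3)
  proof eventually_elim
    case (elim w)
    have 1: "g w = cB (((w - z) * (w - cnj z)) ^ m) * G w" and 2: "bN (g w) = (w - z) ^ n * e w"
      using elim by blast+
    have "g w * u w = cB (((w - z) * (w - cnj z)) ^ m) * F w"
      unfolding 1 elim(2) by (rule mult.assoc)
    moreover have "bN (g w * u w) = (w - z) ^ n * (e w * bN (u w))"
      unfolding bN_mult 2 by (rule mult.assoc)
    ultimately show ?case ..
  qed
  moreover have "bana (\<lambda>w. g w * u w) z" by (intro bana_mult u g)
  moreover have "(\<lambda>w. e w * bN (u w)) analytic_on {z}" "e z * bN (u z) \<noteq> 0"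
    using u e by (auto intro!: analytic_intros analytic_bN)
  ultimately show ?thesis unfolding mgerm_def by blast
qed

lemma open_eventually_nhds: "open {z :: complex. eventually P (nhds z)}"
proof (subst open_subopen, rule ballI)
  fix z assume "z \<in> {z. eventually P (nhds z)}"
  then obtain S where S: "open S" "z \<in> S" "\<And>w. w \<in> S \<Longrightarrow> P w"
    unfolding eventually_nhds by blast
  have "S \<subseteq> {z. eventually P (nhds z)}"
    unfolding eventually_nhds using S by blast
  with S show "\<exists>T. open T \<and> z \<in> T \<and> T \<subseteq> {z. eventually P (nhds z)}" by blast
qed

text \<open>The regular part consists of the spheres over points where \<open>\<Psi>\<close> itself
  is analytic, so a removable singularity with a wrong value is treated like a pole. Around an
  exceptional sphere the cleared function is extended over a symmetric neighbourhood.\<close>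

lemma semiregular_fS:
  assumes W: "open \<Omega>" "axsym \<Omega>" and sym: "bsym \<Psi>"
    and mer: "\<And>z. z \<in> slice_dom \<Omega> \<Longrightarrow> mgerm z \<Psi>"
  shows "semiregular \<Omega> (fS \<Psi>)"
proof -
  define D where "D = slice_dom \<Omega>"
  have D: "open D" "\<And>z. z \<in> D \<Longrightarrow> cnj z \<in> D"
    unfolding D_def using open_slice_dom[OF W(1)] cnj_slice_dom[OF W(2)] by auto
  have \<Omega>: "q \<in> \<Omega> \<longleftrightarrow> qcpx q \<in> D" for q
    unfolding D_def by (rule mem_iff_qcpx[OF W(2)])
  have bana_cnj: "bana F (cnj z)" if "bsym F" "bana F z" for F z
    using bana_cnj[OF that(2)] that(1) by (simp add: bsym_def)
  define D' where "D' = {z \<in> D. bana \<Psi> z}"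
  have D'_sym: "cnj z \<in> D'" if "z \<in> D'" for z
    using that D(2) bana_cnj[OF sym] by (auto simp: D'_def)
  have "{z. bana \<Psi> z} = {z. eventually (bana \<Psi>) (nhds z)}"
    using bana_eventually eventually_nhds_x_imp_x by blast
  then have "open {z. bana \<Psi> z}" using open_eventually_nhds by simp
  then have D'_open: "open D'"
    using open_Int[OF D(1)] unfolding D'_def Collect_conj_eq by simp
  define U' where "U' = qcpx -` D'"
  have U'_dom: "slice_dom U' = D'" unfolding U'_def using D'_sym by (rule slice_dom_qcpx_vimage)
  have U'_reg: "slice_regular U' (fS \<Psi>)"
  proof (rule slice_regularI[OF _ _ sym])
    show "open U'" "axsym U'"
      unfolding U'_def using open_qcpx_vimage[OF D'_open] axsym_qcpx_vimage by auto
    show "bana \<Psi> z" if "z \<in> slice_dom U'" for z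
      using that unfolding U'_dom by (simp add: D'_def)
  qed
  have pole: "\<exists>W m g. p \<in> W \<and> W \<subseteq> \<Omega> \<and> W - qsphere p \<subseteq> U' \<and> slice_regular W g \<and>
      (\<forall>q\<in>W - qsphere p. g q = qmul (qpow (Delta p q) m) (fS \<Psi> q))" if p: "p \<in> \<Omega> - U'" for p
  proof -
    define z0 where "z0 = qcpx p"
    have z0: "z0 \<in> D" using p \<Omega> by (simp add: z0_def)
    have mz: "mgerm z0 \<Psi>" using mer z0 by (simp add: D_def)
    then obtain m g where g: "bana g z0"
      "eventually (\<lambda>w. g w = cB (((w - z0) * (w - cnj z0)) ^ m) * \<Psi> w) (at z0)"
      unfolding mgerm_def eventually_conj_iff by blast
    define \<Theta> where "\<Theta> = (\<lambda>w. cB (((w - z0) * (w - cnj z0)) ^ m) * \<Psi> w)"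
    have \<Theta>_sym: "bsym \<Theta>" using sym by (simp add: \<Theta>_def bsym_def mult.commute)
    obtain B where B: "open B" "z0 \<in> B" "B \<subseteq> D" "\<And>w. w \<in> B \<Longrightarrow> w \<noteq> z0 \<Longrightarrow> bana \<Psi> w"
    proof -
      have "eventually (\<lambda>w. bana \<Psi> w) (at z0)"
        using mgerm_eventually_unit[OF mz] by eventually_elim (simp add: unit_at_def)
      then obtain S where "open S" "z0 \<in> S" "\<And>w. w \<in> S \<Longrightarrow> w \<noteq> z0 \<Longrightarrow> bana \<Psi> w"
        unfolding eventually_at_topological by blast
      then show thesis using that[of "S \<inter> D"] D(1) z0 by auto
    qed
    have \<Theta>_bana: "bana \<Theta> w" if "bana \<Psi> w" for w
      unfolding \<Theta>_def by (intro bana_mult bana_cB that analytic_intros)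
    obtain \<Theta>' where \<Theta>': "bsym \<Theta>'" "\<And>z. z \<in> B \<or> cnj z \<in> B \<Longrightarrow> bana \<Theta>' z"
      "\<And>z g. z \<in> B \<or> cnj z \<in> B \<Longrightarrow> bana g z \<Longrightarrow> eventually (\<lambda>w. \<Theta> w = g w) (at z) \<Longrightarrow>
        \<Theta>' z = g z \<and> eventually (\<lambda>w. \<Theta>' w = \<Theta> w) (at z)"
    proof (rule bsym_extension[OF \<Theta>_sym B(1)])
      fix z assume z: "z \<in> B"
      show "\<exists>g. bana g z \<and> eventually (\<lambda>w. \<Theta> w = g w) (at z)"
      proof (cases "z = z0")
        case True
        have "eventually (\<lambda>w. \<Theta> w = g w) (at z0)"
          using g(2) by eventually_elim (simp add: \<Theta>_def)
        then show ?thesis using g(1) True by blast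
      next
        case False
        then show ?thesis using \<Theta>_bana[OF B(4)[OF z]] by (intro exI[of _ \<Theta>]) simp
      qed
    qed blast
    define N where "N = B \<union> cnj -` B"
    have N_open: "open N"
      unfolding N_def by (intro open_Un B(1) open_vimage[OF B(1)] continuous_intros)
    have ND: "N \<subseteq> D" using B(3) D(2) unfolding N_def by force
    have N_sym: "cnj z \<in> N" if "z \<in> N" for z using that by (auto simp: N_def)
    have N_bana: "bana \<Psi> z" if "z \<in> N" "z \<noteq> z0" "z \<noteq> cnj z0" for z
    proof (cases "z \<in> B")
      case True then show ?thesis using B(4) that by blast
    next
      case False
      then have "cnj z \<in> B" using that(1) by (simp add: N_def)
      moreover have "cnj z \<noteq> z0" using that(3) by auto
      ultimately have "bana \<Psi> (cnj z)" by (rule B(4))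
      then show ?thesis using bana_cnj[OF sym] by fastforce
    qed
    define W where "W = qcpx -` N"
    have W_dom: "slice_dom W = N" unfolding W_def using N_sym by (rule slice_dom_qcpx_vimage)
    have off: "qcpx q \<noteq> z0 \<and> qcpx q \<noteq> cnj z0" if "q \<notin> qsphere p" for q
    proof -
      have "qcpx q \<noteq> qcpx p" using that qsphere_iff by blast
      \<comment> \<open>Imaginary parts of \<open>qcpx\<close> are norms, so a value equals a
        conjugate value only on the real axis.\<close>
      moreover have "qcpx q = qcpx p" if "qcpx q = cnj (qcpx p)"
      proof -
        have "fst q = fst p" "norm (snd q) = - norm (snd p)"
          using that by (simp_all add: qcpx_def complex_eq_iff)
        then have "norm (snd q) = norm (snd p)"
          using norm_ge_zero[of "snd q"] norm_ge_zero[of "snd p"] by linarith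
        with \<open>fst q = fst p\<close> show ?thesis by (simp add: qcpx_def)
      qed
      ultimately show ?thesis by (auto simp: z0_def)
    qed
    have "slice_regular W (fS \<Theta>')"
    proof (rule slice_regularI[OF _ _ \<Theta>'(1)])
      show "open W" "axsym W"
        unfolding W_def using open_qcpx_vimage[OF N_open] axsym_qcpx_vimage by auto
      show "bana \<Theta>' z" if "z \<in> slice_dom W" for z
        using that \<Theta>'(2) unfolding W_dom by (auto simp: N_def)
    qed
    moreover have "p \<in> W" using B(2) by (simp add: W_def N_def z0_def)
    moreover have "W \<subseteq> \<Omega>" using ND \<Omega> by (auto simp: W_def)
    moreover have "W - qsphere p \<subseteq> U'"
      using off N_bana ND by (auto simp: W_def U'_def D'_def)
    moreover have "fS \<Theta>' q = qmul (qpow (Delta p q) m) (fS \<Psi> q)" if q: "q \<in> W - qsphere p" for q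
    proof -
      have "qcpx q \<in> N" "bana \<Theta> (qcpx q)"
        using q off[of q] N_bana \<Theta>_bana by (auto simp: W_def)
      then have "\<Theta>' (qcpx q) = \<Theta> (qcpx q)"
        using \<Theta>'(3)[of "qcpx q" \<Theta>] by (simp add: N_def)
      then have "fS \<Theta>' q = fS \<Theta> q" by (simp add: fS_def)
      then show ?thesis unfolding Delta_mult_fS by (simp add: \<Theta>_def z0_def)
    qed
    ultimately show ?thesis by blast
  qed
  have "U' \<subseteq> \<Omega>" using \<Omega> by (auto simp: U'_def D'_def)
  then show ?thesis
    unfolding semiregular_def using W U'_reg pole by blast
qed

text \<open>On a punctured neighbourhood of each point the quotient is a unit; filling in the points
  gives an invertible stem, hence a function without zeros. It agrees with the quotient near each
  point, except possibly at the point itself, which makes the set of agreement dense.\<close>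

lemma SR_star_of_eqv:
  assumes W: "open W" "axsym W" and sym: "bsym \<Psi>"
    and mer: "\<And>z. z \<in> slice_dom W \<Longrightarrow> mgerm z (stem f)"
    and eq: "\<And>z. z \<in> slice_dom W \<Longrightarrow> eqv z \<Psi> (stem f)"
  shows "SR_star W (sprod (sinv f) (fS \<Psi>))"
proof -
  define D where "D = slice_dom W"
  have D: "open D" unfolding D_def by (rule open_slice_dom[OF W(1)])
  have mem: "q \<in> W \<longleftrightarrow> qcpx q \<in> D" for q unfolding D_def by (rule mem_iff_qcpx[OF W(2)])
  define \<Theta> where "\<Theta> = (\<lambda>w. binv (stem f w) * \<Psi> w)"
  have \<Theta>_sym: "bsym \<Theta>" unfolding \<Theta>_def by (intro bsym_mult bsym_binv bsym_stem sym)
  have prod: "sprod (sinv f) (fS \<Psi>) = fS \<Theta>"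
    by (simp add: sprod_sinv_eq stem_fS[OF sym] \<Theta>_def)
  have loc: "\<exists>u. unit_at z u \<and> eventually (\<lambda>w. \<Theta> w = u w) (at z)" if z: "z \<in> D" for z
  proof -
    obtain u where u: "unit_at z u" "eventually (\<lambda>w. \<Psi> w = stem f w * u w) (at z)"
      using eq z unfolding D_def eqv_def by blast
    have "eventually (\<lambda>w. unit_at w (stem f)) (at z)"
      using mgerm_eventually_unit mer z unfolding D_def by blast
    with u(2) have "eventually (\<lambda>w. \<Theta> w = u w) (at z)"
      by eventually_elim (simp add: \<Theta>_def unit_at_def binv_cancel_left)
    with u(1) show ?thesis by blast
  qed
  obtain \<Theta>' where \<Theta>': "bsym \<Theta>'" "\<And>z. z \<in> D \<or> cnj z \<in> D \<Longrightarrow> bana \<Theta>' z"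
    "\<And>z g. z \<in> D \<or> cnj z \<in> D \<Longrightarrow> bana g z \<Longrightarrow> eventually (\<lambda>w. \<Theta> w = g w) (at z) \<Longrightarrow>
      \<Theta>' z = g z \<and> eventually (\<lambda>w. \<Theta>' w = \<Theta> w) (at z)"
  proof (rule bsym_extension[OF \<Theta>_sym D])
    show "\<exists>g. bana g z \<and> eventually (\<lambda>w. \<Theta> w = g w) (at z)" if "z \<in> D" for z
      using loc[OF that] unfolding unit_at_def by blast
  qed blast
  have \<Theta>'_loc: "bN (\<Theta>' z) \<noteq> 0 \<and> eventually (\<lambda>w. \<Theta>' w = \<Theta> w) (at z)" if z: "z \<in> D" for z
  proof -
    obtain u where u: "bana u z" "bN (u z) \<noteq> 0" "eventually (\<lambda>w. \<Theta> w = u w) (at z)"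
      using loc[OF z] unfolding unit_at_def by blast
    then show ?thesis using \<Theta>'(3)[OF disjI1[OF z] u(1,3)] by simp
  qed
  have "slice_regular W (fS \<Theta>')"
    using slice_regularI[OF W \<Theta>'(1)] \<Theta>'(2) unfolding D_def by blast
  moreover have "fS \<Theta>' q \<noteq> 0" if "q \<in> W" for q
    using \<Theta>'_loc mem that bN_eq_0_of_ev[OF qunit_of_unit] unfolding fS_def by blast
  moreover have "smr_agree W (fS \<Theta>') (fS \<Theta>)"
  proof -
    define E where "E = D \<inter> {z. eventually (\<lambda>w. \<Theta>' w = \<Theta> w) (nhds z)}"
    have E: "open E" unfolding E_def by (intro open_Int D open_eventually_nhds)
    have "fS \<Theta>' q = fS \<Theta> q" if "q \<in> qcpx -` E" for q
    proof -
      have "eventually (\<lambda>w. \<Theta>' w = \<Theta> w) (nhds (qcpx q))" using that by (simp add: E_def)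
      from eventually_nhds_x_imp_x[OF this] show ?thesis by (simp add: fS_def)
    qed
    moreover have "qcpx -` E \<subseteq> W" using mem by (auto simp: E_def)
    moreover have "W \<subseteq> closure (qcpx -` E)"
    proof
      fix q assume "q \<in> W"
      then have z: "qcpx q \<in> D" using mem by simp
      show "q \<in> closure (qcpx -` E)"
        unfolding closure_approachable
      proof (intro allI impI)
        fix e :: real assume "e > 0"
        have "eventually (\<lambda>w. w \<in> E) (at (qcpx q))"
          using eventually_at_open[OF D z] at_eventually_nhds[OF conjunct2[OF \<Theta>'_loc[OF z]]]
          by eventually_elim (simp add: E_def)
        then obtain d where d: "d > 0" "\<And>w. w \<noteq> qcpx q \<Longrightarrow> dist w (qcpx q) < d \<Longrightarrow> w \<in> E"
          unfolding eventually_at by blast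
        define t where "t = min d e / 2"
        have t: "0 < t" "t < d" "t < e" using d(1) \<open>e > 0\<close> by (auto simp: t_def)
        \<comment> \<open>A real translation shifts \<open>q\<close> and \<open>qcpx q\<close> by
          the same amount, which keeps \<open>qcpx q'\<close> in the punctured
          neighbourhood.\<close>
        define q' where "q' = (fst q + t, snd q)"
        have diff: "qcpx q' = qcpx q + of_real t" by (simp add: q'_def qcpx_def complex_eq_iff)
        have "qcpx q' \<in> E"
          using t by (intro d(2)) (auto simp: diff dist_norm)
        moreover have "dist q' q < e"
          using t by (cases q) (simp add: q'_def dist_Pair_Pair dist_norm)
        ultimately show "\<exists>q'\<in>qcpx -` E. dist q' q < e" by blast
      qed
    qed
    ultimately show ?thesis
      unfolding smr_agree_def using open_qcpx_vimage[OF E] by blast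
  qed
  ultimately show ?thesis unfolding SR_star_def prod by blast
qed

theorem mainTheorem12:
  fixes \<Omega> :: "quat set" and U :: "'i \<Rightarrow> quat set" and F :: "'i \<Rightarrow> quat \<Rightarrow> quat"
  assumes "open \<Omega>" and "connected \<Omega>" and "axsym \<Omega>"
    and "\<forall>l. open (U l) \<and> axsym (U l) \<and> U l \<subseteq> \<Omega>"
    and "(\<Union>l. U l) = \<Omega>"
    and "\<forall>l. semiregular (U l) (F l) \<and> \<not> smr_zero (U l) (F l)"
    and "\<forall>k l. SR_star (U k \<inter> U l) (sprod (sinv (F k)) (F l))"
  shows "\<exists>f V. semiregular \<Omega> f \<and>
           (\<forall>l. open (V l) \<and> axsym (V l) \<and> V l \<subseteq> U l) \<and> (\<Union>l. V l) = \<Omega> \<and>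
           (\<forall>l. SR_star (V l) (sprod (sinv (F l)) f))"
proof -
  define D where "D = slice_dom \<Omega>"
  have D: "open D" "\<And>z. z \<in> D \<Longrightarrow> cnj z \<in> D"
    unfolding D_def using open_slice_dom[OF assms(1)] cnj_slice_dom[OF assms(3)] by auto
  have U: "open (U l)" "axsym (U l)" "U l \<subseteq> \<Omega>" for l using assms(4) by auto
  have cover: "z \<in> D \<longleftrightarrow> (\<exists>l. z \<in> slice_dom (U l))" for z
    unfolding D_def slice_dom_def using assms(5) by auto
  have dom_int: "slice_dom (U k \<inter> U l) = slice_dom (U k) \<inter> slice_dom (U l)" for k l
    by (auto simp: slice_dom_def)
  have mer: "mgerm z (stem (F l))" if "z \<in> slice_dom (U l)" for z l
    using mgerm_of_semiregular[of "U l" "F l" z] assms(6,7) that by (metis Int_absorb)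
  have cocycle: "eqv z (stem (F l)) (stem (F k))" if "z \<in> slice_dom (U k)" "z \<in> slice_dom (U l)" for z k l
    using eqv_of_SR_star[of "U k \<inter> U l" "F k" "F l" z] assms(7) that mer dom_int by blast
  \<comment> \<open>Any member of the covering may be chosen at a point: by \<open>cocycle\<close>
    its germ is the same up to a unit.\<close>
  define sel where "sel = (\<lambda>z. SOME l. z \<in> slice_dom (U l))"
  have sel: "z \<in> slice_dom (U (sel z))" if "z \<in> D" for z
    unfolding sel_def using that cover by (metis someI_ex)
  define T where "T = (\<lambda>z. stem (F (sel z)))"
  have "\<exists>\<Psi>. bsym \<Psi> \<and> (\<forall>p\<in>D. 0 \<le> Im p \<longrightarrow> eqv p \<Psi> (T p))"
  proof (rule product_theorem[OF D])
    fix p assume p: "p \<in> D"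
    show "bsym (T p) \<and> mgerm p (T p)"
      unfolding T_def using bsym_stem mer sel[OF p] by blast
    have "eventually (\<lambda>z. z \<in> slice_dom (U (sel p))) (at p)"
      by (rule eventually_at_open[OF open_slice_dom[OF U(1)] sel[OF p]])
    then show "eventually (\<lambda>z. 0 \<le> Im z \<longrightarrow> eqv z (T z) (\<lambda>_. 1)) (at p)"
      using mgerm_eventually_unit[OF mer[OF sel[OF p]]]
    proof eventually_elim
      case (elim z)
      have "z \<in> D" using elim(1) cover by blast
      then have "eqv z (T z) (stem (F (sel p)))"
        unfolding T_def using cocycle sel elim(1) by blast
      moreover have "eqv z (stem (F (sel p))) (\<lambda>_. 1)"
        using eqv_mult_unit[OF elim(2), of "\<lambda>_. 1"] by simp
      ultimately show ?case using eqv_trans by blast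
    qed
  qed
  then obtain \<Psi> where \<Psi>: "bsym \<Psi>" "\<And>p. p \<in> D \<Longrightarrow> 0 \<le> Im p \<Longrightarrow> eqv p \<Psi> (T p)" by blast
  have upper: "eqv z \<Psi> (stem (F l))" if "z \<in> slice_dom (U l)" "0 \<le> Im z" for z l
  proof -
    have "z \<in> D" using that(1) cover by blast
    then show ?thesis
      using \<Psi>(2)[of z] that cocycle[OF that(1) sel] unfolding T_def by (blast intro: eqv_trans)
  qed
  \<comment> \<open>The product was solved on the closed upper half only; below it the relation is
    reflected, using the symmetry of \<open>\<Psi>\<close> and of the stems.\<close>
  have eq: "eqv z \<Psi> (stem (F l))" if z: "z \<in> slice_dom (U l)" for z l
  proof (cases "0 \<le> Im z")
    case False
    have "eqv (cnj z) \<Psi> (stem (F l))"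
      using False by (intro upper cnj_slice_dom[OF U(2) z]) simp
    from eqv_cnj[OF this \<Psi>(1) bsym_stem] show ?thesis by simp
  qed (rule upper[OF z])
  have mer_\<Psi>: "mgerm z \<Psi>" if "z \<in> slice_dom \<Omega>" for z
    using that cover mer eq mgerm_eqv unfolding D_def by blast
  show ?thesis
  \<comment> \<open>The covering \<open>U\<close> itself serves as \<open>V\<close>, since the
    relation to \<open>F l\<close> holds at every point of \<open>slice_dom (U l)\<close>.\<close>
  proof (intro exI conjI)
    show "semiregular \<Omega> (fS \<Psi>)"
      by (rule semiregular_fS[OF assms(1,3) \<Psi>(1) mer_\<Psi>])
    show "\<forall>l. open (U l) \<and> axsym (U l) \<and> U l \<subseteq> U l" using U by blast
    show "(\<Union>l. U l) = \<Omega>" by (rule assms(5))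
    show "\<forall>l. SR_star (U l) (sprod (sinv (F l)) (fS \<Psi>))"
      by (intro allI SR_star_of_eqv U \<Psi>(1) mer eq)
  qed
qed

end
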